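(* Let $A=[a_1|\cdots|a_N]:\mathbb{R}^N\to V$ be a flat arrangement of rank $d=\dim V\ge2$, with $n=d-1$, $r=N-d$, flat-arrangement polynomial $f_A(t)=\sum_{i=0}^r\alpha_it^i$ and projected hypersimplices $P_1,\dots,P_{N-1}\subset W$. Let $c=(c_1,\dots,c_\ell)$ be a composition of $n$ with every $c_j\ge1$, and let $1\le s\le N-\ell$. For $0\le a\le n-\ell$ define $q^{(a)}\in\mathbb{Z}_{\ge0}^n$ by $q^{(a)}_{a+j}=c_j$ for $1\le j\le\ell$ and $q^{(a)}_k=0$ otherwise. Then $$\operatorname{MV}_W(P_s[c_1],P_{s+1}[c_2],\dots,P_{s+\ell-1}[c_\ell])=\frac1{n!}\sum_{a=0}^{n-\ell}\operatorname{ME}(q^{(a)})\,\alpha_{s-a-1},$$ where coefficients $\alpha_i$ with $i\notin\{0,\dots,r\}$ are interpreted as zero.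
   Context: $V$ is a real vector space of dimension $d$ with a nonzero alternating form $\omega_V\in\bigwedge^dV^*$. A flat arrangement in $V$ is a labeled spanning family of vectors $a_1,\dots,a_N\in V$ (repetitions allowed), viewed as a surjective linear map $A:\mathbb{R}^N\to V$, such that there is $\varphi\in V^*$ with $\varphi(a_j)=1$ for all $j$. Put $H=\varphi^{-1}(1)$ and $W=\ker\varphi$ (so $\dim W=n=d-1$). Choose $v\in H$, set $b_j=a_j-v\in W$, and give $W$ the form $\omega_W(w_1,\dots,w_n)=\omega_V(w_1,\dots,w_n,v)$, which does not depend on $v$; volumes in $W$ use the density $|\omega_W|$. A basis is a subset $B\subset[N]=\{1,\dots,N\}$ of size $d$ for which $A_B:=A|_{\mathbb{R}^B}$ is an isomorphism onto $V$; $\mathcal{B}$ is the set of bases; $w_A(B)=|\omega_V((a_b)_{b\in B})|$. A circuit vector is a nonzero vector of $\ker A$ with inclusion-minimal support. For a basis $B$ and $j\notin B$, $c^{B,j}\in\ker A$ is defined by $c^{B,j}_j=1$, $c^{B,j}_B=-A_B^{-1}a_j$, $c^{B,j}_k=0$ for $k\notin B\sqcup\{j\}$. A vector $\rho\in\mathbb{R}^N$ is circuit-generic if $\langle\rho,z\rangle\ne0$ for every circuit vector $z$. Put $\operatorname{ext}_\rho(B)=|\{j\notin B:\langle\rho,c^{B,j}\rangle>0\}|$. The flat-arrangement polynomial is $f_A(t)=\sum_{B\in\mathcal{B}}w_A(B)t^{\operatorname{ext}_\rho(B)}$ for any circuit-generic $\rho$; it is known not to depend on $\rho$. For $1\le k\le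 N-1$ the projected hypersimplex is $P_k=\operatorname{conv}\{\sum_{j\in I}b_j: I\subset[N],\ |I|=k\}\subset W$. Mixed volume $\operatorname{MV}_U$ in an $n$-dimensional density space $U$ is normalized by $\operatorname{MV}_U(K,\dots,K)=\operatorname{vol}_U(K)$; $K[q]$ means $q$ separate entries equal to $K$ (omitted if $q=0$). Mixed Eulerian numbers: let $E_n=\{x\in\mathbb{R}^{n+1}:\sum_jx_j=0\}$ with the volume density for which the lattice $E_n\cap\mathbb{Z}^{n+1}$ has covolume one, and for $1\le k\le n$ let $D_k^{(n)}=\{x\in[0,1]^{n+1}:\sum_jx_j=k\}-\frac{k}{n+1}\mathbf{1}\subset E_n$. For $q\in\mathbb{Z}_{\ge0}^n$ with $\sum q_k=n$, $\operatorname{ME}(q)=n!\operatorname{MV}_{E_n}(D_1^{(n)}[q_1],\dots,D_n^{(n)}[q_n])$. *)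

theory Defs
  imports "HOL-Analysis.Analysis" "HOL-Library.Function_Algebras"
    "HOL-Computational_Algebra.Polynomial"
begin

(* R^m is modelled by the functions nat => real vanishing outside {1..m}. *)
instantiation "fun" :: (type, real_vector) real_vector
begin

definition scaleR_fun :: "real \<Rightarrow> ('a \<Rightarrow> 'b) \<Rightarrow> 'a \<Rightarrow> 'b"
  where "scaleR_fun r f = (\<lambda>x. r *\<^sub>R f x)"

instance
  by standard (auto simp: scaleR_fun_def fun_eq_iff algebra_simps)

end

definition coord_space :: "nat set \<Rightarrow> (nat \<Rightarrow> real) set"
  where "coord_space S = {x. \<forall>j. j \<notin> S \<longrightarrow> x j = 0}"

definition supp :: "(nat \<Rightarrow> real) \<Rightarrow> nat set"
  where "supp x = {j. x j \<noteq> 0}"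

subsection \<open>Volumes and mixed volumes\<close>

definition basis_list :: "'v::real_vector set \<Rightarrow> 'v list \<Rightarrow> bool"
  where "basis_list U ws \<longleftrightarrow> distinct ws \<and> independent (set ws) \<and> span (set ws) = U"

(* Lebesgue measure of K in the linear coordinates given by ws; the parallelepiped
   spanned by ws has volume one. *)
definition frame_volume :: "'v::real_vector list \<Rightarrow> 'v set \<Rightarrow> real"
  where "frame_volume ws K =
    measure (Pi\<^sub>M {..<length ws} (\<lambda>_. lborel :: real measure))
      {x \<in> {..<length ws} \<rightarrow>\<^sub>E UNIV. (\<Sum>i<length ws. x i *\<^sub>R ws ! i) \<in> K}"

(* Volume in the subspace U for the density |\<omega>|, \<omega> a top-degree form on U. The result does
   not depend on the chosen basis: both factors change by reciprocal determinants. *)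
definition density_volume :: "'v::real_vector set \<Rightarrow> ('v list \<Rightarrow> real) \<Rightarrow> 'v set \<Rightarrow> real"
  where "density_volume U \<omega> K =
    (let ws = (SOME ws. basis_list U ws) in \<bar>\<omega> ws\<bar> * frame_volume ws K)"

(* Polarization of the volume; the sums of sets are Minkowski sums. The lemma
   mixed_volume_unique shows that this is the only possible symmetric Minkowski-additive
   functional with value vol K at (K,...,K). *)
definition mixed_volume :: "('v::comm_monoid_add set \<Rightarrow> real) \<Rightarrow> 'v set list \<Rightarrow> real"
  where "mixed_volume vol Ks = 1 / fact (length Ks) *
    (\<Sum>S \<in> Pow {..<length Ks} - {{}}.
       (-1) ^ (length Ks - card S) * vol (\<Sum>i\<in>S. Ks ! i))"

lemma additive_sum:
  fixes M :: "'v::comm_monoid_add set list \<Rightarrow> real"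
  assumes closed: "\<And>K L. K \<in> C \<Longrightarrow> L \<in> C \<Longrightarrow> K + L \<in> C"
    and additive: "\<And>xs K L ys. set xs \<subseteq> C \<Longrightarrow> set ys \<subseteq> C \<Longrightarrow> K \<in> C \<Longrightarrow> L \<in> C \<Longrightarrow>
      length xs + length ys + 1 = n \<Longrightarrow>
      M (xs @ (K + L) # ys) = M (xs @ K # ys) + M (xs @ L # ys)"
    and S: "finite S" "S \<noteq> {}" "\<And>i. i \<in> S \<Longrightarrow> F i \<in> C"
    and len: "set xs \<subseteq> C" "set ys \<subseteq> C" "length xs + length ys + 1 = n"
  shows "(\<Sum>i\<in>S. F i) \<in> C \<and> M (xs @ (\<Sum>i\<in>S. F i) # ys) = (\<Sum>i\<in>S. M (xs @ F i # ys))"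
  using S
proof (induction S rule: finite_ne_induct)
  case (singleton i)
  then show ?case by simp
next
  case (insert i S)
  then show ?case using closed additive[OF len(1,2) _ _ len(3), of "F i" "\<Sum>i\<in>S. F i"]
    by simp
qed

lemma additive_lists:
  fixes M :: "'v::comm_monoid_add set list \<Rightarrow> real"
  assumes closed: "\<And>K L. K \<in> C \<Longrightarrow> L \<in> C \<Longrightarrow> K + L \<in> C"
    and additive: "\<And>xs K L ys. set xs \<subseteq> C \<Longrightarrow> set ys \<subseteq> C \<Longrightarrow> K \<in> C \<Longrightarrow> L \<in> C \<Longrightarrow>
      length xs + length ys + 1 = n \<Longrightarrow>
      M (xs @ (K + L) # ys) = M (xs @ K # ys) + M (xs @ L # ys)"
    and S: "finite S" "S \<noteq> {}" "\<And>i. i \<in> S \<Longrightarrow> F i \<in> C"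
  shows "m \<le> n \<Longrightarrow> M (replicate n (\<Sum>i\<in>S. F i)) =
    (\<Sum>js | set js \<subseteq> S \<and> length js = m. M (map F js @ replicate (n - m) (\<Sum>i\<in>S. F i)))"
proof (induction m)
  case 0
  have "{js. set js \<subseteq> S \<and> length js = 0} = {[]}" by auto
  then show ?case by simp
next
  case (Suc m)
  let ?K = "\<Sum>i\<in>S. F i"
  let ?L = "\<lambda>m. {js. set js \<subseteq> S \<and> length js = m}"
  have KC: "?K \<in> C"
    using S by (induction S rule: finite_ne_induct) (auto intro: closed)
  have rep: "replicate (n - m) ?K = ?K # replicate (n - Suc m) ?K"
    using Suc.prems by (metis Suc_diff_le diff_Suc_Suc replicate_Suc)
  have step: "M (map F js @ replicate (n - m) ?K) =
      (\<Sum>i\<in>S. M (map F (js @ [i]) @ replicate (n - Suc m) ?K))" if "js \<in> ?L m" for js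
  proof -
    have "set (map F js) \<subseteq> C" using that S(3) by auto
    moreover have "set (replicate (n - Suc m) ?K) \<subseteq> C" using KC by auto
    moreover have "length (map F js) + length (replicate (n - Suc m) ?K) + 1 = n"
      using that Suc.prems by simp
    ultimately have "M (map F js @ ?K # replicate (n - Suc m) ?K) =
        (\<Sum>i\<in>S. M (map F js @ F i # replicate (n - Suc m) ?K))"
      using additive_sum[where F = F and n = n and C = C and M = M and xs = "map F js" and ys = "replicate (n - Suc m) ?K",
          OF closed additive S]
      by blast
    then show ?thesis using rep by simp
  qed
  have bij: "bij_betw (\<lambda>(js, i). js @ [i]) (?L m \<times> S) (?L (Suc m))"
  proof (rule bij_betw_byWitness[where f' = "\<lambda>js. (butlast js, last js)"])
    show "\<forall>js\<in>?L (Suc m). (\<lambda>(js, i). js @ [i]) (butlast js, last js) = js"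
      by (auto simp: length_Suc_conv)
    show "(\<lambda>js. (butlast js, last js)) ` ?L (Suc m) \<subseteq> ?L m \<times> S"
      by (force dest: in_set_butlastD intro: last_in_set)
  qed auto
  have fin: "finite (?L m)" using S(1) by (rule finite_lists_length_eq)
  have "M (replicate n ?K) = (\<Sum>js\<in>?L m. M (map F js @ replicate (n - m) ?K))"
    using Suc by simp
  also have "\<dots> = (\<Sum>js\<in>?L m. \<Sum>i\<in>S. M (map F (js @ [i]) @ replicate (n - Suc m) ?K))"
    by (rule sum.cong[OF refl step])
  also have "\<dots> = (\<Sum>(js, i)\<in>?L m \<times> S. M (map F (js @ [i]) @ replicate (n - Suc m) ?K))"
    by (rule sum.cartesian_product)
  also have "\<dots> = (\<Sum>js\<in>?L (Suc m). M (map F js @ replicate (n - Suc m) ?K))"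
    using sum.reindex_bij_betw[OF bij, of "\<lambda>js. M (map F js @ replicate (n - Suc m) ?K)"]
    by (simp add: case_prod_unfold)
  finally show ?case .
qed

lemma alternating_supersets:
  fixes X :: "nat set"
  assumes "X \<subseteq> {..<n}"
  shows "(\<Sum>S | X \<subseteq> S \<and> S \<subseteq> {..<n}. (-1) ^ (n - card S)) = (if X = {..<n} then 1 else (0::real))"
proof -
  have "(\<Sum>S | X \<subseteq> S \<and> S \<subseteq> {..<n}. (-1::real) ^ (n - card S)) = (\<Sum>T\<in>Pow ({..<n} - X). (-1) ^ card T)"
  proof (rule sum.reindex_bij_witness[where i = "\<lambda>T. {..<n} - T" and j = "\<lambda>S. {..<n} - S"], goal_cases)
    case (5 S)
    then have "finite S" using finite_subset by blast
    then show ?case using 5 by (simp add: card_Diff_subset)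
  qed (use assms in auto)
  also have "\<dots> = (\<Prod>i\<in>{..<n} - X. (-1) + 1)"
    by (subst prod_add) simp_all
  also have "\<dots> = (if X = {..<n} then 1 else 0)"
    using assms by (auto simp: power_0_left)
  finally show ?thesis .
qed

lemma mixed_volume_unique:
  fixes M :: "'v::comm_monoid_add set list \<Rightarrow> real"
  assumes closed: "\<And>K L. K \<in> C \<Longrightarrow> L \<in> C \<Longrightarrow> K + L \<in> C"
    and symmetric: "\<And>Ks Ls. set Ks \<subseteq> C \<Longrightarrow> length Ks = n \<Longrightarrow> mset Ks = mset Ls \<Longrightarrow> M Ks = M Ls"
    and additive: "\<And>xs K L ys. set xs \<subseteq> C \<Longrightarrow> set ys \<subseteq> C \<Longrightarrow> K \<in> C \<Longrightarrow> L \<in> C \<Longrightarrow>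
      length xs + length ys + 1 = n \<Longrightarrow>
      M (xs @ (K + L) # ys) = M (xs @ K # ys) + M (xs @ L # ys)"
    and normalized: "\<And>K. K \<in> C \<Longrightarrow> M (replicate n K) = vol K"
    and Ks: "set Ks \<subseteq> C" "length Ks = n" and n: "n \<ge> 1"
  shows "mixed_volume vol Ks = M Ks"
proof -
  let ?L = "\<lambda>S. {js. set js \<subseteq> S \<and> length js = n}"
  let ?N = "{..<n}"
  let ?P = "Pow ?N - {{}}"
  let ?g = "\<lambda>js. M (map ((!) Ks) js)"
  have KsC: "Ks ! i \<in> C" if "i < n" for i using Ks that by auto
  have vol: "vol (\<Sum>i\<in>S. Ks ! i) = (\<Sum>js\<in>?L S. ?g js)" if "S \<in> ?P" for S
  proof -
    have S: "finite S" "S \<noteq> {}" "\<And>i. i \<in> S \<Longrightarrow> Ks ! i \<in> C"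
      using that KsC finite_subset by auto
    have "(\<Sum>i\<in>S. Ks ! i) \<in> C"
      using S by (induction S rule: finite_ne_induct) (auto intro: closed)
    then show ?thesis
      using normalized additive_lists[where F = "(!) Ks" and m = n and n = n and C = C and M = M, OF closed additive S] by simp
  qed
  have fin: "finite (?L ?N)" by (rule finite_lists_length_eq) simp
  have "(\<Sum>S\<in>?P. (-1) ^ (n - card S) * vol (\<Sum>i\<in>S. Ks ! i)) =
      (\<Sum>S\<in>?P. \<Sum>js\<in>?L S. (-1) ^ (n - card S) * ?g js)"
    by (intro sum.cong refl) (simp add: vol sum_distrib_left)
  also have "\<dots> = (\<Sum>S\<in>?P. \<Sum>js | js \<in> ?L ?N \<and> set js \<subseteq> S. (-1) ^ (n - card S) * ?g js)"
    by (intro sum.cong refl) auto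
  also have "\<dots> = (\<Sum>js\<in>?L ?N. \<Sum>S | S \<in> ?P \<and> set js \<subseteq> S. (-1) ^ (n - card S) * ?g js)"
    by (rule sum.swap_restrict) (use fin in auto)
  also have "\<dots> = (\<Sum>js\<in>?L ?N. if set js = ?N then M Ks else 0)"
  proof (rule sum.cong[OF refl])
    fix js assume js: "js \<in> ?L ?N"
    have "js \<noteq> []" using js n by auto
    then have "{S. S \<in> ?P \<and> set js \<subseteq> S} = {S. set js \<subseteq> S \<and> S \<subseteq> ?N}" by auto
    then have "(\<Sum>S | S \<in> ?P \<and> set js \<subseteq> S. (-1) ^ (n - card S) * ?g js) =
        (if set js = ?N then 1 else 0) * ?g js"
      using js by (simp add: alternating_supersets flip: sum_distrib_right)
    moreover have "?g js = M Ks" if eq: "set js = ?N"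
    proof -
      have "distinct js" using js eq by (intro card_distinct) simp
      then have "mset js = mset [0..<n]"
        using eq by (intro set_eq_iff_mset_eq_distinct[THEN iffD1]) (auto simp: atLeast0LessThan)
      then have "mset (map ((!) Ks) js) = mset (map ((!) Ks) [0..<n])"
        by (metis mset_map)
      also have "map ((!) Ks) [0..<n] = Ks" using Ks(2) map_nth by blast
      finally show ?thesis using Ks symmetric by metis
    qed
    ultimately show "(\<Sum>S | S \<in> ?P \<and> set js \<subseteq> S. (-1) ^ (n - card S) * ?g js) =
        (if set js = ?N then M Ks else 0)" by simp
  qed
  also have "\<dots> = real (card {js \<in> ?L ?N. set js = ?N}) * M Ks"
    using fin by (simp add: sum.If_cases Int_def)
  also have "{js \<in> ?L ?N. set js = ?N} = {js. length js = n \<and> distinct js \<and> set js \<subseteq> ?N}"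
  proof -
    have "set js = ?N" if "length js = n" "distinct js" "set js \<subseteq> ?N" for js
      using that by (intro card_subset_eq) (auto simp: distinct_card)
    then show ?thesis by (auto intro: card_distinct)
  qed
  also have "card \<dots> = fact n"
    by (subst card_lists_distinct_length_eq) (simp_all add: fact_prod)
  finally show ?thesis by (simp add: mixed_volume_def Ks(2))
qed

subsection \<open>Flat arrangements\<close>

(* A d-linear alternating form takes lists of length d. *)
definition alternating_form :: "nat \<Rightarrow> ('v::real_vector list \<Rightarrow> real) \<Rightarrow> bool"
  where "alternating_form d \<omega> \<longleftrightarrow>
    (\<forall>xs i. length xs = d \<and> i < d \<longrightarrow> linear (\<lambda>x. \<omega> (xs[i := x]))) \<and>
    (\<forall>xs i j. length xs = d \<and> i < j \<and> j < d \<and> xs ! i = xs ! j \<longrightarrow> \<omega> xs = 0)"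

definition flat_arrangement :: "nat \<Rightarrow> (nat \<Rightarrow> 'v::real_vector) \<Rightarrow> ('v \<Rightarrow> real) \<Rightarrow> bool"
  where "flat_arrangement N a \<phi> \<longleftrightarrow>
    span (a ` {1..N}) = UNIV \<and> linear \<phi> \<and> (\<forall>j\<in>{1..N}. \<phi> (a j) = 1)"

definition arr_map :: "nat \<Rightarrow> (nat \<Rightarrow> 'v::real_vector) \<Rightarrow> (nat \<Rightarrow> real) \<Rightarrow> 'v"
  where "arr_map N a x = (\<Sum>j=1..N. x j *\<^sub>R a j)"

definition arr_kernel :: "nat \<Rightarrow> (nat \<Rightarrow> 'v::real_vector) \<Rightarrow> (nat \<Rightarrow> real) set"
  where "arr_kernel N a = {z \<in> coord_space {1..N}. arr_map N a z = 0}"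

definition arr_bases :: "nat \<Rightarrow> (nat \<Rightarrow> 'v::real_vector) \<Rightarrow> nat set set"
  where "arr_bases N a =
    {B. B \<subseteq> {1..N} \<and> card B = dim (UNIV :: 'v set) \<and>
        bij_betw (arr_map N a) (coord_space B) UNIV}"

definition basis_weight :: "('v::real_vector list \<Rightarrow> real) \<Rightarrow> (nat \<Rightarrow> 'v) \<Rightarrow> nat set \<Rightarrow> real"
  where "basis_weight \<omega> a B = \<bar>\<omega> (map a (sorted_list_of_set B))\<bar>"

definition circuit_vector :: "nat \<Rightarrow> (nat \<Rightarrow> 'v::real_vector) \<Rightarrow> (nat \<Rightarrow> real) \<Rightarrow> bool"
  where "circuit_vector N a z \<longleftrightarrow> z \<in> arr_kernel N a \<and> z \<noteq> 0 \<and>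
    (\<forall>y \<in> arr_kernel N a. y \<noteq> 0 \<and> supp y \<subseteq> supp z \<longrightarrow> supp y = supp z)"

definition fund_circuit :: "nat \<Rightarrow> (nat \<Rightarrow> 'v::real_vector) \<Rightarrow> nat set \<Rightarrow> nat \<Rightarrow> nat \<Rightarrow> real"
  where "fund_circuit N a B j k =
    (if k = j then 1
     else if k \<in> B then - inv_into (coord_space B) (arr_map N a) (a j) k
     else 0)"

definition pairing :: "nat \<Rightarrow> (nat \<Rightarrow> real) \<Rightarrow> (nat \<Rightarrow> real) \<Rightarrow> real"
  where "pairing N \<rho> z = (\<Sum>k=1..N. \<rho> k * z k)"

definition circuit_generic :: "nat \<Rightarrow> (nat \<Rightarrow> 'v::real_vector) \<Rightarrow> (nat \<Rightarrow> real) \<Rightarrow> bool"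
  where "circuit_generic N a \<rho> \<longleftrightarrow> \<rho> \<in> coord_space {1..N} \<and>
    (\<forall>z. circuit_vector N a z \<longrightarrow> pairing N \<rho> z \<noteq> 0)"

definition ext :: "nat \<Rightarrow> (nat \<Rightarrow> 'v::real_vector) \<Rightarrow> (nat \<Rightarrow> real) \<Rightarrow> nat set \<Rightarrow> nat"
  where "ext N a \<rho> B = card {j \<in> {1..N} - B. pairing N \<rho> (fund_circuit N a B j) > 0}"

definition flat_poly ::
    "('v::real_vector list \<Rightarrow> real) \<Rightarrow> nat \<Rightarrow> (nat \<Rightarrow> 'v) \<Rightarrow> (nat \<Rightarrow> real) \<Rightarrow> real poly"
  where "flat_poly \<omega> N a \<rho> = (\<Sum>B \<in> arr_bases N a. monom (basis_weight \<omega> a B) (ext N a \<rho> B))"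

definition coeff_in_range :: "real poly \<Rightarrow> nat \<Rightarrow> int \<Rightarrow> real"
  where "coeff_in_range f r i = (if 0 \<le> i \<and> i \<le> int r then coeff f (nat i) else 0)"

definition W_volume ::
    "('v::real_vector list \<Rightarrow> real) \<Rightarrow> ('v \<Rightarrow> real) \<Rightarrow> 'v \<Rightarrow> 'v set \<Rightarrow> real"
  where "W_volume \<omega> \<phi> v = density_volume {w. \<phi> w = 0} (\<lambda>ws. \<omega> (ws @ [v]))"

definition proj_hypersimplex :: "nat \<Rightarrow> (nat \<Rightarrow> 'v::real_vector) \<Rightarrow> 'v \<Rightarrow> nat \<Rightarrow> 'v set"
  where "proj_hypersimplex N a v k =
    convex hull {(\<Sum>j\<in>I. a j - v) | I. I \<subseteq> {1..N} \<and> card I = k}"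

subsection \<open>Mixed Eulerian numbers\<close>

definition E_space :: "nat \<Rightarrow> (nat \<Rightarrow> real) set"
  where "E_space n = {x \<in> coord_space {1..n+1}. (\<Sum>j=1..n+1. x j) = 0}"

definition unit_vec :: "nat \<Rightarrow> nat \<Rightarrow> real"
  where "unit_vec i = (\<lambda>j. if j = i then 1 else 0)"

definition E_frame :: "nat \<Rightarrow> (nat \<Rightarrow> real) list"
  where "E_frame n = map (\<lambda>i. unit_vec (Suc i) - unit_vec (n + 1)) [0..<n]"

(* E_frame n is a Z-basis of the lattice of integer points of E_space n (see
   E_frame_lattice_basis), so this is the volume on E_space n for which that
   lattice has covolume one. *)
definition E_volume :: "nat \<Rightarrow> (nat \<Rightarrow> real) set \<Rightarrow> real"
  where "E_volume n = frame_volume (E_frame n)"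

definition centered_hypersimplex :: "nat \<Rightarrow> nat \<Rightarrow> (nat \<Rightarrow> real) set"
  where "centered_hypersimplex n k =
    (\<lambda>x j. if j \<in> {1..n+1} then x j - real k / real (n + 1) else 0) `
      {x \<in> coord_space {1..n+1}. (\<forall>j\<in>{1..n+1}. 0 \<le> x j \<and> x j \<le> 1) \<and>
                                 (\<Sum>j=1..n+1. x j) = real k}"

definition mixed_eulerian :: "nat \<Rightarrow> (nat \<Rightarrow> nat) \<Rightarrow> real"
  where "mixed_eulerian n q = fact n * mixed_volume (E_volume n)
    (concat (map (\<lambda>k. replicate (q k) (centered_hypersimplex n k)) [1..<n+1]))"

(* The parts of the list c are indexed from 0, the entries of q from 1. *)
definition shifted_composition :: "nat list \<Rightarrow> nat \<Rightarrow> nat \<Rightarrow> nat"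
  where "shifted_composition c m k =
    (if m + 1 \<le> k \<and> k \<le> m + length c then c ! (k - m - 1) else 0)"

lemma E_frame_expand:
  "(\<Sum>i<n. t i *\<^sub>R E_frame n ! i) =
    (\<lambda>j. if j \<in> {1..n} then t (j - 1) else if j = n + 1 then - (\<Sum>i<n. t i) else 0)"
proof
  fix j
  have ev: "(\<Sum>i\<in>I. f i) j = (\<Sum>i\<in>I. f i j)" for I :: "nat set" and f :: "nat \<Rightarrow> nat \<Rightarrow> real"
    by (induction I rule: infinite_finite_induct) auto
  have "(\<Sum>i<n. t i *\<^sub>R E_frame n ! i) j =
      (\<Sum>i<n. (if j - 1 = i \<and> j \<noteq> 0 then t i else 0) - (if j = n + 1 then t i else 0))"
    unfolding ev by (intro sum.cong) (auto simp: E_frame_def unit_vec_def scaleR_fun_def)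
  also have "\<dots> = (if j \<in> {1..n} then t (j - 1) else if j = n + 1 then - (\<Sum>i<n. t i) else 0)"
    by (cases j) (auto simp: sum_subtractf sum_negf)
  finally show "(\<Sum>i<n. t i *\<^sub>R E_frame n ! i) j = \<dots>" .
qed

lemma E_frame_coords:
  assumes "x \<in> E_space n"
  shows "x = (\<Sum>i<n. x (Suc i) *\<^sub>R E_frame n ! i)"
proof -
  have "(\<Sum>j=1..n+1. x j) = (\<Sum>i<n. x (Suc i)) + x (n + 1)"
    by (simp add: sum.shift_bounds_cl_Suc_ivl atLeast0AtMost lessThan_Suc_atMost[symmetric]
        flip: atLeastLessThanSuc_atLeastAtMost sum.shift_bounds_Suc_ivl atLeast0LessThan)
  then have "x (n + 1) = - (\<Sum>i<n. x (Suc i))" using assms by (simp add: E_space_def)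
  then show ?thesis
    using assms unfolding E_frame_expand by (force simp: E_space_def coord_space_def)
qed

lemma E_frame_lattice_basis:
  shows "distinct (E_frame n)" and "independent (set (E_frame n))"
    and "span (set (E_frame n)) = E_space n"
    and "{x \<in> E_space n. \<forall>j. x j \<in> \<int>} =
      {\<Sum>i<n. of_int (m i) *\<^sub>R E_frame n ! i | m :: nat \<Rightarrow> int. True}"
proof -
  have len: "length (E_frame n) = n" by (simp add: E_frame_def)
  show dist: "distinct (E_frame n)"
  proof -
    have "E_frame n ! i \<noteq> E_frame n ! k" if "i < n" "k < n" "i \<noteq> k" for i k
    proof
      assume "E_frame n ! i = E_frame n ! k"
      then have "(E_frame n ! i) (Suc i) = (E_frame n ! k) (Suc i)" by simp
      then show False using that by (simp add: E_frame_def unit_vec_def)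
    qed
    then show ?thesis by (simp add: distinct_conv_nth len)
  qed
  have set: "set (E_frame n) = (!) (E_frame n) ` {..<n}"
    by (auto simp: set_conv_nth len)
  have inj: "inj_on ((!) (E_frame n)) {..<n}"
    using dist by (simp add: inj_on_nth len)
  show "independent (set (E_frame n))"
  proof
    assume "dependent (set (E_frame n))"
    then obtain u w where u: "(\<Sum>z\<in>set (E_frame n). u z *\<^sub>R z) = 0"
      and w: "w \<in> set (E_frame n)" "u w \<noteq> 0"
      by (auto simp: dependent_finite)
    from w obtain i where i: "i < n" "w = E_frame n ! i" unfolding set by auto
    have "(\<Sum>i<n. u (E_frame n ! i) *\<^sub>R E_frame n ! i) = 0"
      using u unfolding set by (simp add: sum.reindex[OF inj])
    then have "(\<Sum>i<n. u (E_frame n ! i) *\<^sub>R E_frame n ! i) (Suc i) = 0" by simp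
    then have "u w = 0" unfolding E_frame_expand[where t = "\<lambda>i. u (E_frame n ! i)"]
      using i by simp
    then show False using w by simp
  qed
  have E: "(\<Sum>i<n. t i *\<^sub>R E_frame n ! i) \<in> E_space n" for t
  proof -
    have "(\<Sum>j=1..n. t (j - 1)) = (\<Sum>i<n. t i)"
      by (rule sum.reindex_bij_witness[where i = Suc and j = "\<lambda>j. j - 1"]) auto
    then show ?thesis unfolding E_frame_expand by (simp add: E_space_def coord_space_def)
  qed
  have span: "span (set (E_frame n)) = range (\<lambda>t. \<Sum>i<n. t i *\<^sub>R E_frame n ! i)"
  proof
    show "span (set (E_frame n)) \<subseteq> range (\<lambda>t. \<Sum>i<n. t i *\<^sub>R E_frame n ! i)"
    proof
      fix x assume "x \<in> span (set (E_frame n))"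
      then obtain u where "x = (\<Sum>z\<in>set (E_frame n). u z *\<^sub>R z)"
        by (auto simp: span_finite)
      then have "x = (\<Sum>i<n. u (E_frame n ! i) *\<^sub>R E_frame n ! i)"
        unfolding set by (simp add: sum.reindex[OF inj])
      then show "x \<in> range (\<lambda>t. \<Sum>i<n. t i *\<^sub>R E_frame n ! i)"
        by (rule range_eqI[where x = "\<lambda>i. u (E_frame n ! i)"])
    qed
    show "range (\<lambda>t. \<Sum>i<n. t i *\<^sub>R E_frame n ! i) \<subseteq> span (set (E_frame n))"
      unfolding set by (auto intro!: span_sum span_scale intro: span_base)
  qed
  show "span (set (E_frame n)) = E_space n"
  proof
    show "span (set (E_frame n)) \<subseteq> E_space n" unfolding span using E by blast
    show "E_space n \<subseteq> span (set (E_frame n))"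
    proof
      fix x assume "x \<in> E_space n"
      from E_frame_coords[OF this] show "x \<in> span (set (E_frame n))"
        unfolding span by (rule range_eqI[where x = "\<lambda>i. x (Suc i)"])
    qed
  qed
  show "{x \<in> E_space n. \<forall>j. x j \<in> \<int>} =
      {\<Sum>i<n. of_int (m i) *\<^sub>R E_frame n ! i | m :: nat \<Rightarrow> int. True}" (is "?L = ?R")
  proof
    show "?L \<subseteq> ?R"
    proof
      fix x assume x: "x \<in> ?L"
      then have "x (Suc i) = of_int \<lfloor>x (Suc i)\<rfloor>" for i by auto
      then have "x = (\<Sum>i<n. of_int \<lfloor>x (Suc i)\<rfloor> *\<^sub>R E_frame n ! i)"
        using E_frame_coords[of x n] x by simp
      then show "x \<in> ?R" by (intro CollectI exI[where x = "\<lambda>i. \<lfloor>x (Suc i)\<rfloor>"] conjI TrueI)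
    qed
    have "(\<Sum>i<n. of_int (m i) *\<^sub>R E_frame n ! i) j \<in> \<int>" for m :: "nat \<Rightarrow> int" and j
      unfolding E_frame_expand by (auto intro!: Ints_sum Ints_minus)
    then show "?R \<subseteq> ?L" using E[where t = "\<lambda>i. of_int (_ i)"] by auto
  qed
qed

end

theory Submission
  imports Defs
begin

text \<open>
  Write the Minkowski sum of the \<open>P\<^sub>k\<close> as the image of tuples of points of hypersimplices
  and lift it by \<open>\<rho>\<close>. Linear programming duality subdivides it: a dual point \<open>\<psi>\<close> tilts \<open>\<rho>\<close> to
  \<open>h j = \<rho> j - \<psi> \<cdot> b j\<close>, each hypersimplex contributes its face maximizing \<open>h\<close>, and the cells of the
  finitely many \<open>\<psi>\<close> that are determined by the coincidences among the values of \<open>h\<close> cover the sum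
  and overlap in hyperplanes only. The same finite set of \<open>\<psi>\<close> serves all subsums in the
  polarization formula, so the alternating sum can be taken cell by cell. If for some level \<open>k\<close>
  that occurs the \<open>k\<close>-th and the \<open>(k+1)\<close>-st largest value of \<open>h\<close> differ, the face of that level is
  a point, a summand of that level only translates the cell, and the alternating sum vanishes.
  Otherwise, the levels being consecutive, they all cut one level class of \<open>h\<close>. Genericity makes
  this class an independent set. A class with fewer than \<open>d\<close> elements gives flat cells. A class
  with \<open>d\<close> elements is a basis \<open>B\<close>, exactly \<open>ext B\<close> values of \<open>h\<close> lie above it, and the cell is a
  translated copy of a Minkowski sum of hypersimplices of levels \<open>k - ext B\<close>, scaled by the
  weight of \<open>B\<close>.
\<close>

text \<open>The dual points are the vertices of the arrangement of all hyperplanes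
  \<open>h i = h j\<close>. This arrangement depends neither on the levels nor on the set of
  summands; subdivisions adapted to single subsums could not be compared cell by cell. Overlaps are
  thin because two dual points whose cells share \<open>w\<close> have the same objective value
  there, an affine equation in \<open>w\<close> whose normal is their difference. Flatness enters
  through \<phi>: applied to a relation among the \<open>a j\<close> it shows that the coefficients
  sum to zero, so kernel vectors pair with \<open>h\<close> as they do with \<rho>. Hence a circuit
  inside a level class would pair to zero with \<rho>, and for a class that is a basis the pairing
  of \<rho> with a fundamental circuit is \<open>h j\<close> minus the class value, whose sign is
  what \<open>ext\<close> counts. A basis with \<open>ext B = e\<close> occupies the ranks
  \<open>e + 1\<close> to \<open>e + d\<close> of the values of \<open>h\<close>. All levels from
  \<open>s\<close> to \<open>s + l - 1\<close> cut it strictly iff \<open>e < s\<close> and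
  \<open>s + l \<le> e + d\<close>, that is \<open>0 \<le> s - 1 - e \<le> n - l\<close>: the shift
  in the formula is \<open>s - 1 - e\<close>. Volumes in different frames are compared by elementary
  operations, since the form is given only by linearity and alternation.\<close>

declare One_nat_def [simp del]

subsection \<open>Faces of hypersimplices\<close>

definition dot :: "nat \<Rightarrow> (nat \<Rightarrow> real) \<Rightarrow> (nat \<Rightarrow> real) \<Rightarrow> real"
  where "dot n x y = (\<Sum>i<n. x i * y i)"

text \<open>
  The face of the hypersimplex of level \<open>k\<close> on which \<open>h\<close> is maximal, in the form of complementary
  slackness. For constant \<open>h\<close> it is the hypersimplex.
\<close>

definition face :: "nat \<Rightarrow> (nat \<Rightarrow> real) \<Rightarrow> nat \<Rightarrow> (nat \<Rightarrow> real) set"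
  where "face N h k = {x. (\<forall>j\<in>{1..N}. 0 \<le> x j \<and> x j \<le> 1) \<and> (\<Sum>j=1..N. x j) = real k \<and>
    (\<forall>i\<in>{1..N}. \<forall>j\<in>{1..N}. h j < h i \<longrightarrow> x i = 1 \<or> x j = 0)}"

text \<open>Ties may be broken arbitrarily. Indicators of such sets are the points of a face at
  which level maxima get evaluated.\<close>

definition top_set :: "nat \<Rightarrow> (nat \<Rightarrow> real) \<Rightarrow> nat set \<Rightarrow> bool"
  where "top_set N h I \<longleftrightarrow> I \<subseteq> {1..N} \<and> (\<forall>i\<in>I. \<forall>j\<in>{1..N} - I. h j \<le> h i)"

lemma face_subset_slice: "face N h k \<subseteq> face N (\<lambda>_. 0) k"
  by (auto simp: face_def)

text \<open>With \<open>\<tau>\<close> the smallest value of \<open>h\<close> on the support of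
  \<open>x\<close>, slackness makes every term \<open>(h j - \<tau>) * (x j - y j)\<close>
  nonnegative, and the equal coordinate sums cancel the contribution of \<open>\<tau>\<close>. As
  \<open>h'\<close> is arbitrary, \<open>y\<close> may be any point of the slice.\<close>

lemma face_maximizes:
  assumes x: "x \<in> face N h k" and y: "y \<in> face N h' k"
  shows "pairing N h y \<le> pairing N h x"
proof (cases "\<exists>i\<in>{1..N}. x i > 0")
  case False
  have x0: "x j = 0" if "j \<in> {1..N}" for j
  proof -
    have "\<not> 0 < x j" using False that by blast
    moreover have "0 \<le> x j" using x that by (auto simp: face_def)
    ultimately show ?thesis by simp
  qed
  then have "real k = 0" using x by (simp add: face_def)
  then have "(\<Sum>j=1..N. y j) = 0" using y by (auto simp: face_def)
  moreover have "\<forall>j\<in>{1..N}. 0 \<le> y j" using y by (auto simp: face_def)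
  ultimately have "\<forall>j\<in>{1..N}. y j = 0" by (subst (asm) sum_nonneg_eq_0_iff) auto
  then show ?thesis using x0 by (simp add: pairing_def)
next
  case True
  define T where "T = h ` {i \<in> {1..N}. x i > 0}"
  have T: "finite T" "T \<noteq> {}" using True by (auto simp: T_def)
  define \<tau> where "\<tau> = Min T"
  obtain i where i: "i \<in> {1..N}" "x i > 0" "h i = \<tau>"
    using Min_in[OF T] by (auto simp: T_def \<tau>_def)
  have "0 \<le> (h j - \<tau>) * (x j - y j)" if j: "j \<in> {1..N}" for j
  proof -
    consider "h j < \<tau>" | "h j = \<tau>" | "h j > \<tau>" by linarith
    then show ?thesis
    proof cases
      case 1
      then have "\<not> x j > 0" using T Min_le[of T "h j"] j by (auto simp: \<tau>_def T_def)
      moreover have "x j \<ge> 0" "y j \<ge> 0" using x y j by (auto simp: face_def)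
      ultimately show ?thesis using 1 by (intro mult_nonpos_nonpos) auto
    next
      case 3
      then have "x j = 1 \<or> x i = 0" using x i(1,3) j by (simp add: face_def)
      then have "x j = 1" using i(2) by simp
      moreover have "y j \<le> 1" using y j by (auto simp: face_def)
      ultimately show ?thesis using 3 by simp
    qed simp
  qed
  then have "0 \<le> (\<Sum>j=1..N. (h j - \<tau>) * (x j - y j))" by (intro sum_nonneg) auto
  also have "\<dots> = pairing N h x - pairing N h y - \<tau> * ((\<Sum>j=1..N. x j) - (\<Sum>j=1..N. y j))"
    by (simp add: pairing_def algebra_simps sum.distrib sum_subtractf sum_distrib_left)
  also have "(\<Sum>j=1..N. x j) = (\<Sum>j=1..N. y j)" using x y by (simp add: face_def)
  finally show ?thesis by simp
qed

lemma indicator_in_face: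
  assumes "top_set N h I" "card I = k"
  shows "(\<lambda>j. if j \<in> I then 1 else 0) \<in> face N h k"
proof -
  have "I \<subseteq> {1..N}" using assms by (simp add: top_set_def)
  then have "(\<Sum>j=1..N. if j \<in> I then 1 else 0) = real k"
    using assms(2) by (simp add: sum.If_cases Int_absorb1)
  then show ?thesis using assms(1) by (fastforce simp: face_def top_set_def not_less[symmetric])
qed

lemma top_set_exists:
  assumes "k \<le> N"
  shows "\<exists>I. top_set N h I \<and> card I = k"
  using assms
proof (induction k)
  case 0
  then show ?case by (intro exI[of _ "{}"]) (simp add: top_set_def)
next
  case (Suc k)
  then obtain I where I: "top_set N h I" "card I = k" by auto
  have IN: "I \<subseteq> {1..N}" using I by (simp add: top_set_def)
  then have finI: "finite I" using finite_subset by blast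
  have "{1..N} - I \<noteq> {}"
  proof
    assume "{1..N} - I = {}"
    then have "card {1..N} \<le> card I" using finI by (intro card_mono) auto
    then show False using I Suc.prems by simp
  qed
  then have "Max (h ` ({1..N} - I)) \<in> h ` ({1..N} - I)" by (intro Max_in) auto
  then obtain i where i: "i \<in> {1..N} - I" "h i = Max (h ` ({1..N} - I))" by auto
  then have max: "h j \<le> h i" if "j \<in> {1..N} - I" for j using that by simp
  have "top_set N h (insert i I)" "card (insert i I) = Suc k"
    using i(1) max I finI by (auto simp: top_set_def)
  then show ?case by blast
qed

text \<open>The support function of the hypersimplex of level \<open>k\<close>, i.e. the sum of the
  \<open>k\<close> largest values of \<open>h\<close>. All points of the face give the same pairing,
  so the choice does not matter.\<close>

definition level_max :: "nat \<Rightarrow> (nat \<Rightarrow> real) \<Rightarrow> nat \<Rightarrow> real"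
  where "level_max N h k = pairing N h (SOME x. x \<in> face N h k)"

lemma level_max_eq: "x \<in> face N h k \<Longrightarrow> level_max N h k = pairing N h x"
  unfolding level_max_def by (rule antisym) (metis face_maximizes someI_ex)+

lemma pairing_indicator:
  "I \<subseteq> {1..N} \<Longrightarrow> pairing N h (\<lambda>j. if j \<in> I then 1 else 0) = (\<Sum>j\<in>I. h j)"
  by (simp add: pairing_def if_distrib sum.If_cases Int_absorb1 cong: if_cong)

lemma level_max_top_set:
  assumes "top_set N h I" "card I = k"
  shows "level_max N h k = (\<Sum>j\<in>I. h j)"
  using level_max_eq[OF indicator_in_face[OF assms]] pairing_indicator assms(1)
  by (simp add: top_set_def)

text \<open>\<open>S\<close> indexes summands rather than levels, so a level may occur several
  times. Row \<open>X k\<close> is the point taken from summand \<open>k\<close>.\<close>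

definition mix :: "nat \<Rightarrow> (nat \<Rightarrow> nat \<Rightarrow> real) \<Rightarrow> nat set \<Rightarrow> (nat \<Rightarrow> nat \<Rightarrow> real) \<Rightarrow> nat \<Rightarrow> real"
  where "mix N b S X i = (\<Sum>k\<in>S. \<Sum>j=1..N. X k j * b j i)"

text \<open>Bounds are imposed on all entries, including rows outside \<open>S\<close> and columns
  outside \<open>{1..N}\<close>, to obtain a compact subset of the product space over all
  indices.\<close>

definition face_tuples :: "nat \<Rightarrow> (nat \<Rightarrow> real) \<Rightarrow> (nat \<Rightarrow> nat) \<Rightarrow> nat set \<Rightarrow> (nat \<Rightarrow> nat \<Rightarrow> real) set"
  where "face_tuples N h \<kappa> S = {X. (\<forall>k j. 0 \<le> X k j \<and> X k j \<le> 1) \<and> (\<forall>k\<in>S. X k \<in> face N h (\<kappa> k))}"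

definition cell :: "nat \<Rightarrow> nat \<Rightarrow> (nat \<Rightarrow> nat \<Rightarrow> real) \<Rightarrow> (nat \<Rightarrow> real) \<Rightarrow> (nat \<Rightarrow> nat) \<Rightarrow> nat set \<Rightarrow> (nat \<Rightarrow> real) set"
  where "cell n N b h \<kappa> S = {w \<in> {..<n} \<rightarrow>\<^sub>E UNIV. \<exists>X\<in>face_tuples N h \<kappa> S. \<forall>i<n. w i = mix N b S X i}"

lemma face_cong:
  assumes "x \<in> face N h k" "\<And>j. j \<in> {1..N} \<Longrightarrow> y j = x j"
  shows "y \<in> face N h k"
  using assms by (simp add: face_def del: atLeastAtMost_iff)

text \<open>Entries that do not influence \<open>mix\<close> can be set to zero, which supplies the
  global bounds in \<open>face_tuples\<close>.\<close>

lemma cellI: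
  assumes "w \<in> {..<n} \<rightarrow>\<^sub>E UNIV" "\<And>k. k \<in> S \<Longrightarrow> X k \<in> face N h (\<kappa> k)"
    "\<And>i. i < n \<Longrightarrow> w i = mix N b S X i"
  shows "w \<in> cell n N b h \<kappa> S"
proof -
  define Y where "Y k j = (if k \<in> S \<and> j \<in> {1..N} then X k j else 0)" for k j
  have "Y k \<in> face N h (\<kappa> k)" if "k \<in> S" for k
    by (rule face_cong[OF assms(2)[OF that]]) (simp add: Y_def that)
  moreover have "0 \<le> Y k j \<and> Y k j \<le> 1" for k j
    using assms(2)[of k] by (auto simp: face_def Y_def)
  moreover have "mix N b S X i = mix N b S Y i" for i
    by (simp add: mix_def Y_def)
  ultimately show ?thesis using assms(1,3) by (auto simp: cell_def face_tuples_def)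
qed

lemma continuous_eval2: "continuous_on UNIV (\<lambda>X :: nat \<Rightarrow> nat \<Rightarrow> real. X k j)"
  by (rule continuous_on_product_then_coordinatewise[OF continuous_on_product_coordinates])

text \<open>Tychonoff, applied to rows and then to tuples of rows; slackness is a closed condition
  because it is a disjunction of equations whose premise does not involve the tuple.\<close>

lemma compact_face_tuples:
  "compact (face_tuples N h \<kappa> S)"
proof -
  have PiE_UNIV: "compact (PiE UNIV (\<lambda>_::nat. K))" if "compact K" for K :: "'a::topological_space set"
    using that compactin_PiE[of "\<lambda>_. euclidean" "UNIV::nat set" "\<lambda>_. K"]
    by (simp add: euclidean_product_topology)
  have "compact (PiE UNIV (\<lambda>_::nat. PiE UNIV (\<lambda>_::nat. {0..1::real})))"
    by (intro PiE_UNIV compact_Icc)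
  moreover have "closed {X :: nat \<Rightarrow> nat \<Rightarrow> real. \<forall>k\<in>S. X k \<in> face N h (\<kappa> k)}"
    unfolding face_def mem_Collect_eq Ball_def
    by (intro closed_Collect_all closed_Collect_imp closed_Collect_conj closed_Collect_disj
        closed_Collect_le closed_Collect_eq continuous_on_const continuous_eval2
        continuous_on_sum open_Collect_const)
  ultimately have "compact (PiE UNIV (\<lambda>_::nat. PiE UNIV (\<lambda>_::nat. {0..1::real})) \<inter>
      {X. \<forall>k\<in>S. X k \<in> face N h (\<kappa> k)})"
    by (rule compact_Int_closed)
  also have "\<dots> = face_tuples N h \<kappa> S"
    by (auto simp: face_tuples_def PiE_iff)
  finally show ?thesis .
qed

lemma continuous_mix: "continuous_on A (\<lambda>X. mix N b S X i)"
  unfolding mix_def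
  by (rule continuous_on_subset[OF _ subset_UNIV])
    (intro continuous_on_sum continuous_on_mult continuous_on_const continuous_eval2)

text \<open>Exchange argument: if \<open>h j < h i\<close> while \<open>z i < 1\<close> and
  \<open>z j > 0\<close>, moving a little mass from \<open>j\<close> to \<open>i\<close> stays in
  the slice and raises the pairing above that of \<open>x\<close>, against
  \<open>face_maximizes\<close>.\<close>

lemma maximizer_in_face:
  assumes x: "x \<in> face N h k" and z: "z \<in> face N h' k" and eq: "pairing N h z = pairing N h x"
  shows "z \<in> face N h k"
proof -
  have zc: "\<forall>j\<in>{1..N}. 0 \<le> z j \<and> z j \<le> 1" "(\<Sum>j=1..N. z j) = real k"
    using z by (auto simp: face_def)
  have "z i = 1 \<or> z j = 0" if ij: "i \<in> {1..N}" "j \<in> {1..N}" "h j < h i" for i j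
  proof (rule ccontr)
    assume "\<not> ?thesis"
    then have "z i < 1" "z j > 0" using zc(1)[rule_format, OF ij(1)] zc(1)[rule_format, OF ij(2)] by auto
    define \<epsilon> where "\<epsilon> = min (1 - z i) (z j)"
    have \<epsilon>: "\<epsilon> > 0" "\<epsilon> \<le> 1 - z i" "\<epsilon> \<le> z j" using \<open>z i < 1\<close> \<open>z j > 0\<close> by (auto simp: \<epsilon>_def)
    define u where "u m = (if m = i then \<epsilon> else 0) - (if m = j then \<epsilon> else 0)" for m
    have "i \<noteq> j" using ij by auto
    have hu: "h m * u m = (if m = i then \<epsilon> * h i else 0) - (if m = j then \<epsilon> * h j else 0)" for m
      by (simp add: u_def)
    have su: "(\<Sum>m=1..N. u m) = 0" "(\<Sum>m=1..N. h m * u m) = \<epsilon> * (h i - h j)"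
      using ij unfolding hu by (simp_all add: u_def sum_subtractf algebra_simps)
    have "0 \<le> z m + u m \<and> z m + u m \<le> 1" if "m \<in> {1..N}" for m
      using zc(1)[rule_format, OF that] \<epsilon> \<open>i \<noteq> j\<close> by (auto simp: u_def)
    then have "(\<lambda>m. z m + u m) \<in> face N (\<lambda>_. 0) k"
      using zc(2) su(1) by (simp add: face_def sum.distrib)
    from face_maximizes[OF x this] have "\<epsilon> * (h i - h j) \<le> 0"
      using eq su(2) by (simp add: pairing_def algebra_simps sum.distrib)
    then show False using \<epsilon>(1) ij(3) by (simp add: mult_le_0_iff)
  qed
  then show ?thesis using zc by (auto simp: face_def)
qed

text \<open>The disjunctions in \<open>face\<close> do not show convexity. It comes from the
  description of the face as the set of maximizers, since a convex combination has the same pairing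
  with \<open>h\<close>.\<close>

lemma face_convex:
  assumes "x \<in> face N h k" "y \<in> face N h k" "0 \<le> t" "t \<le> 1"
  shows "(\<lambda>j. (1 - t) * x j + t * y j) \<in> face N h k"
proof (rule maximizer_in_face[OF assms(1)])
  have "0 \<le> (1 - t) * x j + t * y j \<and> (1 - t) * x j + t * y j \<le> 1" if "j \<in> {1..N}" for j
  proof -
    have "0 \<le> x j" "x j \<le> 1" "0 \<le> y j" "y j \<le> 1" using assms that by (auto simp: face_def)
    then show ?thesis using assms(3,4)
      by (auto intro: convex_bound_le[of "x j" 1 "y j" "1 - t" t])
  qed
  moreover have "(\<Sum>j=1..N. (1 - t) * x j + t * y j) = real k"
  proof -
    have "(\<Sum>j=1..N. (1 - t) * x j + t * y j) = (1 - t) * (\<Sum>j=1..N. x j) + t * (\<Sum>j=1..N. y j)"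
      by (simp only: sum.distrib sum_distrib_left)
    also have "\<dots> = (1 - t) * real k + t * real k" using assms(1,2) by (simp only: face_def mem_Collect_eq)
    also have "\<dots> = real k" by (simp add: left_diff_distrib)
    finally show ?thesis .
  qed
  ultimately show "(\<lambda>j. (1 - t) * x j + t * y j) \<in> face N (\<lambda>_. 0) k" by (simp add: face_def)
  have "pairing N h (\<lambda>j. (1 - t) * x j + t * y j) = (1 - t) * pairing N h x + t * pairing N h y"
    unfolding pairing_def sum_distrib_left sum.distrib[symmetric]
    by (rule sum.cong) (simp_all add: distrib_left)
  also have "pairing N h y = pairing N h x"
    using face_maximizes[OF assms(1,2)] face_maximizes[OF assms(2,1)] by simp
  finally show "pairing N h (\<lambda>j. (1 - t) * x j + t * y j) = pairing N h x"
    by (simp add: algebra_simps)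
qed

subsection \<open>Subdivision by linear programming duality\<close>

lemma dot_add_scale: "dot n (\<lambda>i. x i + t * y i) z = dot n x z + t * dot n y z"
  by (simp add: dot_def algebra_simps sum.distrib sum_distrib_left)

lemma dot_diff: "dot n (\<lambda>i. x i - y i) z = dot n x z - dot n y z"
  by (simp add: dot_def algebra_simps sum_subtractf)

lemma dot_mix: "dot n \<eta> (mix N b S X) = (\<Sum>k\<in>S. \<Sum>j=1..N. X k j * dot n \<eta> (b j))"
proof -
  have "dot n \<eta> (mix N b S X) = (\<Sum>i<n. \<Sum>k\<in>S. \<Sum>j=1..N. X k j * (\<eta> i * b j i))"
    by (simp add: dot_def mix_def sum_distrib_left mult_ac)
  also have "\<dots> = (\<Sum>k\<in>S. \<Sum>i<n. \<Sum>j=1..N. X k j * (\<eta> i * b j i))"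
    by (rule sum.swap)
  also have "\<dots> = (\<Sum>k\<in>S. \<Sum>j=1..N. \<Sum>i<n. X k j * (\<eta> i * b j i))"
    by (rule sum.cong[OF refl sum.swap])
  finally show ?thesis by (simp add: dot_def sum_distrib_left)
qed

lemma dot_cong: "(\<And>i. i < n \<Longrightarrow> w i = w' i) \<Longrightarrow> dot n \<eta> w = dot n \<eta> w'"
  by (simp add: dot_def)

lemma cellE:
  assumes "w \<in> cell n N b h \<kappa> S"
  obtains X where "w \<in> {..<n} \<rightarrow>\<^sub>E UNIV" "\<And>k. k \<in> S \<Longrightarrow> X k \<in> face N h (\<kappa> k)"
    "\<And>i. i < n \<Longrightarrow> w i = mix N b S X i"
  using assms unfolding cell_def face_tuples_def by blast

text \<open>The assumption says that the points \<open>b j\<close> affinely span R^n. It provides,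
  in every direction of the dual space, two tilted values that move relative to each other.\<close>

locale tilted =
  fixes n N :: nat and b :: "nat \<Rightarrow> nat \<Rightarrow> real" and \<rho> :: "nat \<Rightarrow> real"
  assumes separating: "(\<And>i j. i \<in> {1..N} \<Longrightarrow> j \<in> {1..N} \<Longrightarrow> dot n \<eta> (b i) = dot n \<eta> (b j)) \<Longrightarrow>
    i < n \<Longrightarrow> \<eta> i = 0"
begin

definition tilt :: "(nat \<Rightarrow> real) \<Rightarrow> nat \<Rightarrow> real"
  where "tilt \<psi> j = \<rho> j - dot n \<psi> (b j)"

definition ties :: "(nat \<Rightarrow> real) \<Rightarrow> (nat \<times> nat) set"
  where "ties \<psi> = {(i, j) \<in> {1..N} \<times> {1..N}. tilt \<psi> i = tilt \<psi> j}"

text \<open>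
  The points that are determined by their ties; vanishing beyond \<open>n\<close> normalizes the representation.
\<close>

definition verts :: "(nat \<Rightarrow> real) set"
  where "verts = {\<psi>. (\<forall>i\<ge>n. \<psi> i = 0) \<and>
    (\<forall>\<eta>. (\<forall>(i, j)\<in>ties \<psi>. dot n \<eta> (b i) = dot n \<eta> (b j)) \<longrightarrow> (\<forall>i<n. \<eta> i = 0))}"

text \<open>Dual objective of the linear program that maximizes the total \<rho>-height over all
  decompositions of \<open>w\<close> into points of the hypersimplices.\<close>

definition obj :: "(nat \<Rightarrow> nat) \<Rightarrow> nat set \<Rightarrow> (nat \<Rightarrow> real) \<Rightarrow> (nat \<Rightarrow> real) \<Rightarrow> real"
  where "obj \<kappa> S w \<psi> = (\<Sum>k\<in>S. level_max N (tilt \<psi>) (\<kappa> k)) + dot n \<psi> w"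

lemma vertsD:
  assumes "\<psi> \<in> verts" "\<And>i j. (i, j) \<in> ties \<psi> \<Longrightarrow> dot n \<eta> (b i) = dot n \<eta> (b j)" "i < n"
  shows "\<eta> i = 0"
proof -
  have "\<forall>(i, j)\<in>ties \<psi>. dot n \<eta> (b i) = dot n \<eta> (b j)" using assms(2) by blast
  then show ?thesis using assms(1,3) unfolding verts_def by blast
qed

text \<open>A vertex is recovered from its ties: the difference of two points with equal ties
  satisfies the homogeneous tie equations, hence vanishes below \<open>n\<close>, and beyond
  \<open>n\<close> both are zero. There are finitely many tie relations.\<close>

lemma finite_verts: "finite verts"
proof -
  have "inj_on ties verts"
  proof (rule inj_onI)
    fix \<psi> \<psi>' assume v: "\<psi> \<in> verts" "\<psi>' \<in> verts" and eq: "ties \<psi> = ties \<psi>'"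
    have "dot n (\<lambda>i. \<psi> i - \<psi>' i) (b i) = dot n (\<lambda>i. \<psi> i - \<psi>' i) (b j)" if "(i, j) \<in> ties \<psi>" for i j
    proof -
      have "tilt \<psi> i = tilt \<psi> j" "tilt \<psi>' i = tilt \<psi>' j"
        using that eq by (auto simp: ties_def)
      then show ?thesis by (simp add: dot_diff tilt_def)
    qed
    then have "\<psi> i - \<psi>' i = 0" if "i < n" for i
      using vertsD[OF v(1), of "\<lambda>i. \<psi> i - \<psi>' i"] that by blast
    moreover have "\<psi> i = \<psi>' i" if "i \<ge> n" for i using v that by (simp add: verts_def)
    ultimately show "\<psi> = \<psi>'" by (metis eq_iff_diff_eq_0 HOL.ext not_le)
  qed
  moreover have "ties ` verts \<subseteq> Pow ({1..N} \<times> {1..N})" by (auto simp: ties_def)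
  ultimately show ?thesis using inj_on_finite by blast
qed

lemma pairing_tilt: "pairing N (tilt \<psi>) x = pairing N \<rho> x - (\<Sum>j=1..N. x j * dot n \<psi> (b j))"
  by (simp add: pairing_def tilt_def algebra_simps sum_subtractf)

lemma sum_pairing_tilt:
  assumes "\<And>i. i < n \<Longrightarrow> w i = mix N b S X i"
  shows "(\<Sum>k\<in>S. pairing N (tilt \<psi>) (X k)) + dot n \<psi> w = (\<Sum>k\<in>S. pairing N \<rho> (X k))"
proof -
  have "dot n \<psi> w = dot n \<psi> (mix N b S X)" using assms by (rule dot_cong)
  then show ?thesis by (simp add: pairing_tilt dot_mix sum_subtractf)
qed

lemma face_nonempty: "k \<le> N \<Longrightarrow> face N h k \<noteq> {}"
  using top_set_exists indicator_in_face by fastforce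

text \<open>Weak duality: the dual parts of the tilts add up to \<open>dot n \<psi> w\<close>, and
  each tilted pairing is at most its level maximum.\<close>

lemma obj_ge:
  assumes "\<And>k. k \<in> S \<Longrightarrow> \<kappa> k \<le> N" "\<And>k. k \<in> S \<Longrightarrow> X k \<in> face N h (\<kappa> k)"
    "\<And>i. i < n \<Longrightarrow> w i = mix N b S X i"
  shows "(\<Sum>k\<in>S. pairing N \<rho> (X k)) \<le> obj \<kappa> S w \<psi>"
proof -
  have "pairing N (tilt \<psi>) (X k) \<le> level_max N (tilt \<psi>) (\<kappa> k)" if k: "k \<in> S" for k
  proof -
    obtain y where y: "y \<in> face N (tilt \<psi>) (\<kappa> k)" using face_nonempty assms(1) k by blast
    show ?thesis using level_max_eq[OF y] face_maximizes[OF y assms(2)[OF that]] by simp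
  qed
  then have "(\<Sum>k\<in>S. pairing N (tilt \<psi>) (X k)) \<le> (\<Sum>k\<in>S. level_max N (tilt \<psi>) (\<kappa> k))"
    by (rule sum_mono)
  then show ?thesis using sum_pairing_tilt[of w S X \<psi>] assms(3) by (simp add: obj_def)
qed

text \<open>The equality case of weak duality: rows in the faces selected by \<open>\<psi>\<close>
  attain all level maxima.\<close>

lemma obj_eq:
  assumes "\<And>k. k \<in> S \<Longrightarrow> X k \<in> face N (tilt \<psi>) (\<kappa> k)" "\<And>i. i < n \<Longrightarrow> w i = mix N b S X i"
  shows "obj \<kappa> S w \<psi> = (\<Sum>k\<in>S. pairing N \<rho> (X k))"
  using sum_pairing_tilt[of w S X \<psi>] assms(2) level_max_eq[OF assms(1)] by (simp add: obj_def)

text \<open>Both dual points attain the optimal value for \<open>w\<close>, so their objectives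
  agree there; spelled out, this is an affine equation in \<open>w\<close>.\<close>

lemma cell_overlap:
  assumes \<kappa>: "\<And>k. k \<in> S \<Longrightarrow> \<kappa> k \<le> N"
    and w: "w \<in> cell n N b (tilt \<psi>) \<kappa> S" "w \<in> cell n N b (tilt \<psi>') \<kappa> S"
  shows "dot n (\<lambda>i. \<psi> i - \<psi>' i) w =
    (\<Sum>k\<in>S. level_max N (tilt \<psi>') (\<kappa> k)) - (\<Sum>k\<in>S. level_max N (tilt \<psi>) (\<kappa> k))"
proof -
  obtain X where X: "\<And>k. k \<in> S \<Longrightarrow> X k \<in> face N (tilt \<psi>) (\<kappa> k)" "\<And>i. i < n \<Longrightarrow> w i = mix N b S X i"
    using w(1) by (rule cellE) blast
  obtain Y where Y: "\<And>k. k \<in> S \<Longrightarrow> Y k \<in> face N (tilt \<psi>') (\<kappa> k)" "\<And>i. i < n \<Longrightarrow> w i = mix N b S Y i"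
    using w(2) by (rule cellE) blast
  have "obj \<kappa> S w \<psi> = obj \<kappa> S w \<psi>'"
    using obj_eq[OF X] obj_eq[OF Y] obj_ge[OF \<kappa> X, of \<psi>'] obj_ge[OF \<kappa> Y, of \<psi>] by simp
  then show ?thesis by (simp add: obj_def dot_diff)
qed

section \<open>Descent along lines in the dual space\<close>

lemma tilt_line: "tilt (\<lambda>i. \<psi> i + t * \<eta> i) j = tilt \<psi> j - t * dot n \<eta> (b j)"
  by (simp add: tilt_def dot_add_scale)

text \<open>As long as the same index sets stay on top, every level maximum is the sum of the tilted
  values over a fixed set, hence linear in \<open>t\<close>.\<close>

lemma obj_line:
  assumes "\<And>k. k \<in> S \<Longrightarrow> top_set N (tilt \<psi>) (I k) \<and> card (I k) = \<kappa> k"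
    and "\<And>k. k \<in> S \<Longrightarrow> top_set N (tilt (\<lambda>i. \<psi> i + t * \<eta> i)) (I k)"
  shows "obj \<kappa> S w (\<lambda>i. \<psi> i + t * \<eta> i) =
    obj \<kappa> S w \<psi> + t * (dot n \<eta> w - (\<Sum>k\<in>S. \<Sum>j\<in>I k. dot n \<eta> (b j)))"
proof -
  have "level_max N (tilt (\<lambda>i. \<psi> i + t * \<eta> i)) (\<kappa> k) =
      level_max N (tilt \<psi>) (\<kappa> k) - t * (\<Sum>j\<in>I k. dot n \<eta> (b j))" if "k \<in> S" for k
    using level_max_top_set[of N "tilt \<psi>" "I k" "\<kappa> k"] assms(1)[OF that]
      level_max_top_set[OF assms(2)[OF that], of "\<kappa> k"]
    by (simp add: tilt_line sum_subtractf sum_distrib_left)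
  then have "(\<Sum>k\<in>S. level_max N (tilt (\<lambda>i. \<psi> i + t * \<eta> i)) (\<kappa> k)) =
      (\<Sum>k\<in>S. level_max N (tilt \<psi>) (\<kappa> k)) - t * (\<Sum>k\<in>S. \<Sum>j\<in>I k. dot n \<eta> (b j))"
    by (simp add: sum_subtractf sum_distrib_left)
  then show ?thesis by (simp add: obj_def dot_add_scale right_diff_distrib)
qed

lemma top_set_line:
  assumes "top_set N (tilt \<psi>) I"
    and "\<And>i j. i \<in> {1..N} \<Longrightarrow> j \<in> {1..N} \<Longrightarrow> tilt \<psi> j \<le> tilt \<psi> i \<Longrightarrow>
      tilt (\<lambda>i. \<psi> i + t * \<eta> i) j \<le> tilt (\<lambda>i. \<psi> i + t * \<eta> i) i"
  shows "top_set N (tilt (\<lambda>i. \<psi> i + t * \<eta> i)) I"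
  using assms unfolding top_set_def by blast

text \<open>The ratio test of the simplex method: \<open>t\<close> is the first time at which two
  distinct tilted values meet. Until then the weak order persists, so the objective is linear with
  nonpositive slope. Old ties survive because \<open>\<eta>\<close> respects them, and the colliding
  pair is a new one.\<close>

lemma descent_step:
  assumes I: "\<And>k. k \<in> S \<Longrightarrow> top_set N (tilt \<psi>) (I k) \<and> card (I k) = \<kappa> k"
    and \<eta>: "\<And>i j. (i, j) \<in> ties \<psi> \<Longrightarrow> dot n \<eta> (b i) = dot n \<eta> (b j)"
    and slope: "dot n \<eta> w - (\<Sum>k\<in>S. \<Sum>j\<in>I k. dot n \<eta> (b j)) \<le> 0"
    and pos: "i0 \<in> {1..N}" "j0 \<in> {1..N}" "tilt \<psi> i0 > tilt \<psi> j0" "dot n \<eta> (b i0) > dot n \<eta> (b j0)"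
  shows "\<exists>t. obj \<kappa> S w (\<lambda>i. \<psi> i + t * \<eta> i) \<le> obj \<kappa> S w \<psi> \<and> ties \<psi> \<subset> ties (\<lambda>i. \<psi> i + t * \<eta> i)"
proof -
  define P where "P = {(i, j) \<in> {1..N} \<times> {1..N}. tilt \<psi> i > tilt \<psi> j \<and> dot n \<eta> (b i) > dot n \<eta> (b j)}"
  define r where "r = (\<lambda>(i, j). (tilt \<psi> i - tilt \<psi> j) / (dot n \<eta> (b i) - dot n \<eta> (b j)))"
  have P: "finite P" "P \<noteq> {}"
    using pos by (auto simp: P_def intro: finite_subset[of _ "{1..N} \<times> {1..N}"])
  define t where "t = Min (r ` P)"
  have "t \<in> r ` P" using P by (auto simp: t_def)
  then obtain i1 j1 where ij: "(i1, j1) \<in> P" "t = r (i1, j1)" by auto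
  have t: "t > 0" using ij by (auto simp: P_def r_def)
  have tle: "t \<le> r p" if "p \<in> P" for p using that P by (simp add: t_def)
  let ?\<psi> = "\<lambda>i. \<psi> i + t * \<eta> i"
  have order: "tilt ?\<psi> j \<le> tilt ?\<psi> i"
    if m: "i \<in> {1..N}" "j \<in> {1..N}" and le: "tilt \<psi> j \<le> tilt \<psi> i" for i j
  proof (cases "tilt \<psi> j = tilt \<psi> i")
    case True
    then have "dot n \<eta> (b i) = dot n \<eta> (b j)" using m by (intro \<eta>) (simp add: ties_def)
    then show ?thesis using True by (simp add: tilt_line)
  next
    case False
    then have lt: "tilt \<psi> j < tilt \<psi> i" using le by simp
    show ?thesis
    proof (cases "dot n \<eta> (b i) > dot n \<eta> (b j)")
      case True
      then have "(i, j) \<in> P" using m lt by (simp add: P_def)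
      from tle[OF this] show ?thesis using True by (simp add: r_def tilt_line field_simps)
    next
      case False
      then have "t * dot n \<eta> (b i) \<le> t * dot n \<eta> (b j)" using t by simp
      then show ?thesis using lt by (simp add: tilt_line)
    qed
  qed
  have "obj \<kappa> S w ?\<psi> = obj \<kappa> S w \<psi> + t * (dot n \<eta> w - (\<Sum>k\<in>S. \<Sum>j\<in>I k. dot n \<eta> (b j)))"
    by (intro obj_line I top_set_line order) (use I in auto)
  then have "obj \<kappa> S w ?\<psi> \<le> obj \<kappa> S w \<psi>"
    using slope t by (simp add: mult_le_0_iff)
  moreover have "ties \<psi> \<subseteq> ties ?\<psi>"
  proof
    fix p assume "p \<in> ties \<psi>"
    moreover obtain i j where "p = (i, j)" by (cases p)
    ultimately show "p \<in> ties ?\<psi>" using \<eta>[of i j] by (simp add: ties_def tilt_line)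
  qed
  moreover have "(i1, j1) \<in> ties ?\<psi>" "(i1, j1) \<notin> ties \<psi>"
    using ij by (auto simp: ties_def P_def tilt_line r_def field_simps)
  ultimately show ?thesis by blast
qed

text \<open>
  The objective is linear along a line until two values of the tilt meet, so from any point one can
  move to a vertex without increasing it; this yields a global minimizer without a compactness
  argument.
\<close>

lemma descent:
  assumes \<kappa>: "\<And>k. k \<in> S \<Longrightarrow> \<kappa> k \<le> N" and bound: "\<And>\<psi>. C \<le> obj \<kappa> S w \<psi>"
    and \<psi>: "\<forall>i\<ge>n. \<psi> i = 0"
  shows "\<exists>\<psi>'\<in>verts. obj \<kappa> S w \<psi>' \<le> obj \<kappa> S w \<psi>"
  using \<psi>
proof (induction "card ({1..N} \<times> {1..N} - ties \<psi>)" arbitrary: \<psi> rule: less_induct)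
  case less
  show ?case
  proof (cases "\<psi> \<in> verts")
    case False
    then obtain \<eta>0 i0 where \<eta>0: "\<forall>(i, j)\<in>ties \<psi>. dot n \<eta>0 (b i) = dot n \<eta>0 (b j)" "i0 < n" "\<eta>0 i0 \<noteq> 0"
      using less.prems by (auto simp: verts_def)
    have "\<forall>k\<in>S. \<exists>I. top_set N (tilt \<psi>) I \<and> card I = \<kappa> k" using \<kappa> top_set_exists by blast
    then obtain I where I: "\<And>k. k \<in> S \<Longrightarrow> top_set N (tilt \<psi>) (I k) \<and> card (I k) = \<kappa> k"
      by metis
    define slope where "slope \<eta> = dot n \<eta> w - (\<Sum>k\<in>S. \<Sum>j\<in>I k. dot n \<eta> (b j))" for \<eta>
    \<comment> \<open>Truncation keeps the moved point zero beyond \<open>n\<close> and changes no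
      value of \<open>dot n\<close>.\<close>
    define \<eta>1 where "\<eta>1 i = (if i < n then \<eta>0 i else 0)" for i
    have d1: "dot n \<eta>1 z = dot n \<eta>0 z" for z by (simp add: dot_def \<eta>1_def)
    have neg: "dot n (\<lambda>i. - \<eta>1 i) z = - dot n \<eta>1 z" for z by (simp add: dot_def sum_negf)
    define adm where "adm \<eta> \<longleftrightarrow> (\<forall>i\<ge>n. \<eta> i = 0) \<and> (\<exists>i<n. \<eta> i \<noteq> 0) \<and>
      (\<forall>(i, j)\<in>ties \<psi>. dot n \<eta> (b i) = dot n \<eta> (b j))" for \<eta>
    have adm1: "adm \<eta>1" using \<eta>0 d1 by (auto simp: adm_def \<eta>1_def)
    have admneg: "adm (\<lambda>i. - \<eta>1 i)"
      using adm1 by (auto simp: adm_def neg)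
    have sneg: "slope (\<lambda>i. - \<eta>1 i) = - slope \<eta>1" by (simp add: slope_def neg sum_negf)
    define hit where "hit \<eta> \<longleftrightarrow> (\<exists>i\<in>{1..N}. \<exists>j\<in>{1..N}. tilt \<psi> i > tilt \<psi> j \<and> dot n \<eta> (b i) > dot n \<eta> (b j))" for \<eta>
    \<comment> \<open>If no two values ever meet, the order persists on the whole ray and the
      objective is linear there; a negative slope would take it below \<open>C\<close>.\<close>
    have nohit: "slope \<eta> \<ge> 0" if ad: "adm \<eta>" and nh: "\<not> hit \<eta>" for \<eta>
    proof (rule ccontr)
      assume "\<not> slope \<eta> \<ge> 0"
      then have sl: "slope \<eta> < 0" by simp
      have order: "tilt (\<lambda>i. \<psi> i + t * \<eta> i) j \<le> tilt (\<lambda>i. \<psi> i + t * \<eta> i) i"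
        if "t \<ge> 0" and m: "i \<in> {1..N}" "j \<in> {1..N}" and le: "tilt \<psi> j \<le> tilt \<psi> i" for t i j
      proof (cases "tilt \<psi> j = tilt \<psi> i")
        case True
        then have "(i, j) \<in> ties \<psi>" using m by (simp add: ties_def)
        then have "dot n \<eta> (b i) = dot n \<eta> (b j)" using ad by (auto simp: adm_def)
        then show ?thesis using True by (simp add: tilt_line)
      next
        case False
        then have "\<not> dot n \<eta> (b i) > dot n \<eta> (b j)" using nh m le by (force simp: hit_def)
        then have "t * dot n \<eta> (b i) \<le> t * dot n \<eta> (b j)" using \<open>t \<ge> 0\<close> by (intro mult_left_mono) auto
        then show ?thesis using le by (simp add: tilt_line)
      qed
      have lin: "obj \<kappa> S w (\<lambda>i. \<psi> i + t * \<eta> i) = obj \<kappa> S w \<psi> + t * slope \<eta>" if "t \<ge> 0" for t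
        unfolding slope_def by (intro obj_line I top_set_line order that) (use I in auto)
      define t where "t = (obj \<kappa> S w \<psi> - C + 1) / (- slope \<eta>)"
      have "t \<ge> 0" unfolding t_def using bound[of \<psi>] sl by (intro divide_nonneg_nonneg) auto
      moreover have "t * slope \<eta> = - (obj \<kappa> S w \<psi> - C + 1)" using sl by (simp add: t_def)
      ultimately have "obj \<kappa> S w (\<lambda>i. \<psi> i + t * \<eta> i) < C" using lin by simp
      then show False using bound by (simp add: not_less[symmetric])
    qed
    have somehit: "hit \<eta>1 \<or> hit (\<lambda>i. - \<eta>1 i)"
    proof -
      obtain i where "i < n" "\<eta>1 i \<noteq> 0" using adm1 by (auto simp: adm_def)
      then obtain i j where ij: "i \<in> {1..N}" "j \<in> {1..N}" "dot n \<eta>1 (b i) \<noteq> dot n \<eta>1 (b j)"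
        using separating[of \<eta>1] by blast
      then have "(i, j) \<notin> ties \<psi>" using adm1 by (auto simp: adm_def)
      then have "tilt \<psi> i \<noteq> tilt \<psi> j" using ij by (simp add: ties_def)
      then show ?thesis using ij unfolding hit_def neg by (smt (verit))
    qed
    \<comment> \<open>The slopes of \<open>\<eta>1\<close> and its negative are opposite, and one of
      the two hits. If that one has positive slope, the other has negative slope and by
      \<open>nohit\<close> must hit as well.\<close>
    have "\<exists>\<eta>. adm \<eta> \<and> hit \<eta> \<and> slope \<eta> \<le> 0"
    proof (rule ccontr)
      assume no: "\<not> ?thesis"
      have "\<not> hit \<eta>1 \<or> \<not> slope \<eta>1 \<le> 0" "\<not> hit (\<lambda>i. - \<eta>1 i) \<or> \<not> slope (\<lambda>i. - \<eta>1 i) \<le> 0"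
        using no adm1 admneg by blast+
      then show False using nohit[OF adm1] nohit[OF admneg] somehit sneg by linarith
    qed
    then obtain \<eta> where \<eta>: "adm \<eta>" "hit \<eta>" "slope \<eta> \<le> 0" by blast
    have "\<exists>t. obj \<kappa> S w (\<lambda>i. \<psi> i + t * \<eta> i) \<le> obj \<kappa> S w \<psi> \<and> ties \<psi> \<subset> ties (\<lambda>i. \<psi> i + t * \<eta> i)"
    proof -
      obtain i j where "i \<in> {1..N}" "j \<in> {1..N}" "tilt \<psi> i > tilt \<psi> j" "dot n \<eta> (b i) > dot n \<eta> (b j)"
        using \<eta>(2) by (auto simp: hit_def)
      then show ?thesis
        using \<eta> by (intro descent_step[OF I]) (auto simp: adm_def slope_def)
    qed
    then obtain t where t: "obj \<kappa> S w (\<lambda>i. \<psi> i + t * \<eta> i) \<le> obj \<kappa> S w \<psi>"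
      "ties \<psi> \<subset> ties (\<lambda>i. \<psi> i + t * \<eta> i)" by blast
    have "ties (\<lambda>i. \<psi> i + t * \<eta> i) \<subseteq> {1..N} \<times> {1..N}" by (auto simp: ties_def)
    then have "card ({1..N} \<times> {1..N} - ties (\<lambda>i. \<psi> i + t * \<eta> i)) < card ({1..N} \<times> {1..N} - ties \<psi>)"
      using t(2) by (intro psubset_card_mono) auto
    moreover have "\<forall>i\<ge>n. \<psi> i + t * \<eta> i = 0" using less.prems \<eta>(1) by (simp add: adm_def)
    ultimately obtain \<psi>' where "\<psi>' \<in> verts" "obj \<kappa> S w \<psi>' \<le> obj \<kappa> S w (\<lambda>i. \<psi> i + t * \<eta> i)"
      using less.hyps by blast
    then show ?thesis using t(1) order_trans by blast
  qed blast
qed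

text \<open>Projection onto a compact convex set: \<open>\<eta>\<close> points from \<open>w\<close>
  to the nearest point of the cell. The distance is minimized over tuples, where compactness is
  available, and convexity of faces supplies the segments for the variational inequality.\<close>

lemma separation:
  assumes \<kappa>: "\<And>k. k \<in> S \<Longrightarrow> \<kappa> k \<le> N"
    and w: "w \<in> {..<n} \<rightarrow>\<^sub>E UNIV" "w \<notin> cell n N b h \<kappa> S"
  shows "\<exists>\<eta>. (\<forall>i\<ge>n. \<eta> i = 0) \<and> (\<forall>X. (\<forall>k\<in>S. X k \<in> face N h (\<kappa> k)) \<longrightarrow> dot n \<eta> w < dot n \<eta> (mix N b S X))"
proof -
  let ?F = "face_tuples N h \<kappa> S"
  define f where "f X = (\<Sum>i<n. (mix N b S X i - w i)\<^sup>2)" for X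
  have "\<forall>k\<in>S. \<exists>I. top_set N h I \<and> card I = \<kappa> k" using \<kappa> top_set_exists by blast
  then obtain I where I: "\<And>k. k \<in> S \<Longrightarrow> top_set N h (I k) \<and> card (I k) = \<kappa> k" by metis
  then have "(\<lambda>k j. if j \<in> I k then 1 else 0) \<in> ?F"
    using indicator_in_face by (auto simp: face_tuples_def)
  then have "?F \<noteq> {}" by blast
  moreover have "continuous_on ?F f"
    unfolding f_def by (intro continuous_on_sum continuous_on_power continuous_on_diff continuous_mix continuous_on_const)
  ultimately obtain X0 where X0: "X0 \<in> ?F" "\<And>X. X \<in> ?F \<Longrightarrow> f X0 \<le> f X"
    using continuous_attains_inf[OF compact_face_tuples] by blast
  define \<eta> where "\<eta> i = (if i < n then mix N b S X0 i - w i else 0)" for i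
  have dotpos: "dot n \<eta> \<eta> > 0"
  proof -
    have "\<exists>i<n. w i \<noteq> mix N b S X0 i" using w X0(1) by (auto simp: cell_def)
    then obtain i where i: "i < n" "\<eta> i \<noteq> 0" by (auto simp: \<eta>_def)
    then have "0 < \<eta> i * \<eta> i" using zero_less_mult_iff by (metis linorder_neqE_linordered_idom)
    also have "\<dots> \<le> dot n \<eta> \<eta>" unfolding dot_def using i by (intro member_le_sum) auto
    finally show ?thesis .
  qed
  have "dot n \<eta> w < dot n \<eta> (mix N b S X)" if X: "\<forall>k\<in>S. X k \<in> face N h (\<kappa> k)" for X
  proof -
    define Y where "Y k j = (if k \<in> S \<and> j \<in> {1..N} then X k j else 0)" for k j
    have YF: "Y k \<in> face N h (\<kappa> k)" if "k \<in> S" for k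
      by (rule face_cong[of "X k"]) (use X that in \<open>simp_all add: Y_def\<close>)
    have Y01: "0 \<le> Y k j \<and> Y k j \<le> 1" for k j
      using X by (auto simp: face_def Y_def)
    have mixY: "mix N b S X i = mix N b S Y i" for i by (simp add: mix_def Y_def)
    define e where "e i = mix N b S Y i - mix N b S X0 i" for i
    \<comment> \<open>Moving from \<open>X0\<close> towards \<open>Y\<close> cannot decrease the
      squared distance; the right-hand side is its increment.\<close>
    have quad: "0 \<le> 2 * t * dot n \<eta> e + t\<^sup>2 * dot n e e" if t: "0 < t" "t \<le> 1" for t
    proof -
      define Z where "Z k j = (1 - t) * X0 k j + t * Y k j" for k j
      have "Z k \<in> face N h (\<kappa> k)" if "k \<in> S" for k
        using face_convex[of "X0 k" N h "\<kappa> k" "Y k" t] X0(1) YF that t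
        unfolding Z_def face_tuples_def by simp
      moreover have "0 \<le> Z k j \<and> Z k j \<le> 1" for k j
        using X0(1) Y01[of k j] t convex_bound_le[of "X0 k j" 1 "Y k j" "1 - t" t]
        by (auto simp: Z_def face_tuples_def)
      ultimately have "Z \<in> ?F" by (auto simp: face_tuples_def)
      then have "f X0 \<le> f Z" by (rule X0(2))
      moreover have "mix N b S Z i = mix N b S X0 i + t * e i" for i
        by (simp add: mix_def Z_def e_def algebra_simps sum.distrib sum_subtractf sum_distrib_left)
      then have "f Z = (\<Sum>i<n. (\<eta> i + t * e i)\<^sup>2)"
        unfolding f_def by (intro sum.cong) (simp_all add: \<eta>_def add_diff_eq diff_add_eq)
      moreover have "f X0 = (\<Sum>i<n. (\<eta> i)\<^sup>2)" by (simp add: f_def \<eta>_def)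
      moreover have "(\<Sum>i<n. (\<eta> i + t * e i)\<^sup>2) =
          (\<Sum>i<n. (\<eta> i)\<^sup>2) + (2 * t * dot n \<eta> e + t\<^sup>2 * dot n e e)"
        unfolding dot_def sum_distrib_left sum.distrib[symmetric]
        by (rule sum.cong) (simp_all add: power2_eq_square algebra_simps)
      ultimately show ?thesis by simp
    qed
    have "dot n \<eta> e \<ge> 0"
    proof (rule ccontr)
      assume "\<not> ?thesis"
      then have neg: "dot n \<eta> e < 0" by simp
      have ee: "dot n e e \<ge> 0" by (simp add: dot_def sum_nonneg)
      \<comment> \<open>So small that the linear term outweighs the quadratic one.\<close>
      define t where "t = min 1 (- dot n \<eta> e / (dot n e e + 1))"
      have "0 < - dot n \<eta> e / (dot n e e + 1)" using neg ee by (intro divide_pos_pos) auto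
      then have t: "0 < t" "t \<le> 1" "t \<le> - dot n \<eta> e / (dot n e e + 1)" by (simp_all add: t_def)
      have "t * (dot n e e + 1) \<le> - dot n \<eta> e"
        using t(3) ee by (subst (asm) pos_le_divide_eq) auto
      then have "t * dot n e e < - 2 * dot n \<eta> e" using t neg by (simp add: algebra_simps)
      then have "t * (2 * dot n \<eta> e + t * dot n e e) < 0" using t by (simp add: mult_less_0_iff)
      then show False using quad[OF t(1,2)] by (simp add: power2_eq_square algebra_simps)
    qed
    moreover have "dot n \<eta> e = dot n \<eta> (mix N b S X) - dot n \<eta> w - dot n \<eta> \<eta>"
      unfolding dot_def sum_subtractf[symmetric]
      by (rule sum.cong) (simp_all add: e_def \<eta>_def mixY algebra_simps)
    ultimately show ?thesis using dotpos by simp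
  qed
  moreover have "\<forall>i\<ge>n. \<eta> i = 0" by (simp add: \<eta>_def)
  ultimately show ?thesis by blast
qed

text \<open>
  If \<open>w\<close> is outside the cell of \<open>\<psi>\<close>, a separating functional is a descent direction at \<open>\<psi>\<close>.
\<close>

lemma minimizer_cell:
  assumes \<kappa>: "\<And>k. k \<in> S \<Longrightarrow> \<kappa> k \<le> N"
    and w: "w \<in> {..<n} \<rightarrow>\<^sub>E UNIV" and \<psi>: "\<forall>i\<ge>n. \<psi> i = 0"
    and min: "\<And>\<psi>'. \<forall>i\<ge>n. \<psi>' i = 0 \<Longrightarrow> obj \<kappa> S w \<psi> \<le> obj \<kappa> S w \<psi>'"
  shows "w \<in> cell n N b (tilt \<psi>) \<kappa> S"
proof (rule ccontr)
  assume "\<not> ?thesis"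
  from separation[OF \<kappa> w this] obtain \<eta> where \<eta>: "\<forall>i\<ge>n. \<eta> i = 0"
    "\<And>X. \<forall>k\<in>S. X k \<in> face N (tilt \<psi>) (\<kappa> k) \<Longrightarrow> dot n \<eta> w < dot n \<eta> (mix N b S X)"
    by blast
  \<comment> \<open>For small positive \<open>t\<close> all strict inequalities among the finitely
    many tilted values persist.\<close>
  have "\<forall>\<^sub>F t in at_right 0. \<forall>p\<in>{(i, j) \<in> {1..N} \<times> {1..N}. tilt \<psi> i < tilt \<psi> j}.
      tilt \<psi> (fst p) - t * dot n \<eta> (b (fst p)) < tilt \<psi> (snd p) - t * dot n \<eta> (b (snd p))"
  proof (rule eventually_ball_finite)
    show "finite {(i, j) \<in> {1..N} \<times> {1..N}. tilt \<psi> i < tilt \<psi> j}"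
      by (rule finite_subset[of _ "{1..N} \<times> {1..N}"]) auto
    show "\<forall>p\<in>{(i, j) \<in> {1..N} \<times> {1..N}. tilt \<psi> i < tilt \<psi> j}. \<forall>\<^sub>F t in at_right 0.
      tilt \<psi> (fst p) - t * dot n \<eta> (b (fst p)) < tilt \<psi> (snd p) - t * dot n \<eta> (b (snd p))"
    proof
      fix p assume "p \<in> {(i, j) \<in> {1..N} \<times> {1..N}. tilt \<psi> i < tilt \<psi> j}"
      then have lt: "tilt \<psi> (fst p) < tilt \<psi> (snd p)" by auto
      have "((\<lambda>t. (tilt \<psi> (snd p) - t * dot n \<eta> (b (snd p))) - (tilt \<psi> (fst p) - t * dot n \<eta> (b (fst p))))
          \<longlongrightarrow> (tilt \<psi> (snd p) - 0 * dot n \<eta> (b (snd p))) - (tilt \<psi> (fst p) - 0 * dot n \<eta> (b (fst p)))) (at_right 0)"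
        by (intro tendsto_intros)
      then have "\<forall>\<^sub>F t in at_right 0. 0 <
          (tilt \<psi> (snd p) - t * dot n \<eta> (b (snd p))) - (tilt \<psi> (fst p) - t * dot n \<eta> (b (fst p)))"
        by (rule order_tendstoD(1)) (use lt in simp)
      then show "\<forall>\<^sub>F t in at_right 0.
        tilt \<psi> (fst p) - t * dot n \<eta> (b (fst p)) < tilt \<psi> (snd p) - t * dot n \<eta> (b (snd p))"
        by (simp only: diff_gt_0_iff_gt)
    qed
  qed
  then have "\<forall>\<^sub>F t in at_right 0. 0 < t \<and> (\<forall>p\<in>{(i, j) \<in> {1..N} \<times> {1..N}. tilt \<psi> i < tilt \<psi> j}.
      tilt \<psi> (fst p) - t * dot n \<eta> (b (fst p)) < tilt \<psi> (snd p) - t * dot n \<eta> (b (snd p)))"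
    by (intro eventually_conj eventually_at_right_less)
  then obtain t :: real where t: "t > 0" and ord: "\<And>i j. i \<in> {1..N} \<Longrightarrow> j \<in> {1..N} \<Longrightarrow> tilt \<psi> i < tilt \<psi> j \<Longrightarrow>
      tilt \<psi> i - t * dot n \<eta> (b i) < tilt \<psi> j - t * dot n \<eta> (b j)"
    using eventually_happens'[OF trivial_limit_at_right_real] by (smt (verit) SigmaI case_prodI fst_conv mem_Collect_eq snd_conv)
  let ?\<psi> = "\<lambda>i. \<psi> i + t * \<eta> i"
  have "\<forall>k\<in>S. \<exists>I. top_set N (tilt ?\<psi>) I \<and> card I = \<kappa> k" using \<kappa> top_set_exists by blast
  then obtain I where I: "\<And>k. k \<in> S \<Longrightarrow> top_set N (tilt ?\<psi>) (I k) \<and> card (I k) = \<kappa> k" by metis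
  \<comment> \<open>The step can break ties but not reverse the order, so a top set after it was one
    before it. The objective is therefore linear in between, and evaluating the separation at the
    indicators of these sets makes its slope negative.\<close>
  have I': "top_set N (tilt \<psi>) (I k) \<and> card (I k) = \<kappa> k" if "k \<in> S" for k
  proof -
    have IN: "I k \<subseteq> {1..N}" using I[OF that] by (simp add: top_set_def)
    have "tilt \<psi> j \<le> tilt \<psi> i" if "i \<in> I k" "j \<in> {1..N} - I k" for i j
    proof (rule ccontr)
      assume "\<not> ?thesis"
      then have "tilt ?\<psi> i < tilt ?\<psi> j" using ord[of i j] IN that by (auto simp: tilt_line)
      moreover have "tilt ?\<psi> j \<le> tilt ?\<psi> i" using I[OF \<open>k \<in> S\<close>] that unfolding top_set_def by blast
      ultimately show False by simp
    qed
    then show ?thesis using I[OF that] by (auto simp: top_set_def)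
  qed
  let ?X = "\<lambda>k j. if j \<in> I k then 1 else (0::real)"
  have "dot n \<eta> w < dot n \<eta> (mix N b S ?X)"
    using I' by (intro \<eta>(2)) (auto intro: indicator_in_face)
  also have "\<dots> = (\<Sum>k\<in>S. \<Sum>j\<in>I k. dot n \<eta> (b j))"
    unfolding dot_mix
  proof (rule sum.cong[OF refl])
    fix k assume "k \<in> S"
    then have "I k \<subseteq> {1..N}" using I by (simp add: top_set_def)
    then show "(\<Sum>j=1..N. ?X k j * dot n \<eta> (b j)) = (\<Sum>j\<in>I k. dot n \<eta> (b j))"
      using pairing_indicator[of "I k" N "\<lambda>j. dot n \<eta> (b j)"] by (simp add: pairing_def mult.commute)
  qed
  finally have "t * (dot n \<eta> w - (\<Sum>k\<in>S. \<Sum>j\<in>I k. dot n \<eta> (b j))) < 0"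
    using t by (simp add: mult_less_0_iff)
  moreover have "obj \<kappa> S w ?\<psi> = obj \<kappa> S w \<psi> + t * (dot n \<eta> w - (\<Sum>k\<in>S. \<Sum>j\<in>I k. dot n \<eta> (b j)))"
    using I I' by (intro obj_line) auto
  moreover have "obj \<kappa> S w \<psi> \<le> obj \<kappa> S w ?\<psi>" using \<psi> \<eta>(1) by (intro min) simp
  ultimately show False by simp
qed

text \<open>One decomposition of \<open>w\<close> bounds the objective below by weak duality, so
  \<open>descent\<close> turns its minimum over the finite set \<open>verts\<close> into a global
  one, and global optimality puts \<open>w\<close> into the corresponding cell.\<close>

theorem cell_cover:
  assumes \<kappa>: "\<And>k. k \<in> S \<Longrightarrow> \<kappa> k \<le> N"
  shows "cell n N b (\<lambda>_. 0) \<kappa> S = (\<Union>\<psi>\<in>verts. cell n N b (tilt \<psi>) \<kappa> S)"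
proof (intro antisym subsetI)
  fix w assume w: "w \<in> cell n N b (\<lambda>_. 0) \<kappa> S"
  obtain X where X: "\<And>k. k \<in> S \<Longrightarrow> X k \<in> face N (\<lambda>_. 0) (\<kappa> k)" "\<And>i. i < n \<Longrightarrow> w i = mix N b S X i"
    and wE: "w \<in> {..<n} \<rightarrow>\<^sub>E UNIV"
    using w by (rule cellE) blast
  note bound = obj_ge[OF \<kappa> X]
  obtain \<psi>0 where "\<psi>0 \<in> verts"
    using descent[of S \<kappa> _ w "\<lambda>_. 0", OF \<kappa> bound] by auto
  define \<psi> where "\<psi> = arg_min_on (obj \<kappa> S w) verts"
  have \<psi>: "\<psi> \<in> verts" "\<And>\<psi>'. \<psi>' \<in> verts \<Longrightarrow> obj \<kappa> S w \<psi> \<le> obj \<kappa> S w \<psi>'"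
    using arg_min_if_finite[OF finite_verts, of "obj \<kappa> S w"] \<open>\<psi>0 \<in> verts\<close> unfolding \<psi>_def
    by (auto simp: not_less[symmetric])
  have "w \<in> cell n N b (tilt \<psi>) \<kappa> S"
  proof (rule minimizer_cell[OF \<kappa> wE])
    show "\<forall>i\<ge>n. \<psi> i = 0" using \<psi>(1) by (simp add: verts_def)
    show "obj \<kappa> S w \<psi> \<le> obj \<kappa> S w \<psi>'" if z: "\<forall>i\<ge>n. \<psi>' i = 0" for \<psi>'
      using descent[of S \<kappa> _ w \<psi>', OF \<kappa> bound z] \<psi>(2) by force
  qed
  then show "w \<in> (\<Union>\<psi>\<in>verts. cell n N b (tilt \<psi>) \<kappa> S)" using \<psi>(1) by blast
next
  fix w assume "w \<in> (\<Union>\<psi>\<in>verts. cell n N b (tilt \<psi>) \<kappa> S)"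
  then obtain \<psi> where "w \<in> cell n N b (tilt \<psi>) \<kappa> S" by blast
  then obtain X where X: "w \<in> {..<n} \<rightarrow>\<^sub>E UNIV" "\<And>k. k \<in> S \<Longrightarrow> X k \<in> face N (tilt \<psi>) (\<kappa> k)"
    "\<And>i. i < n \<Longrightarrow> w i = mix N b S X i" by (rule cellE) blast
  show "w \<in> cell n N b (\<lambda>_. 0) \<kappa> S"
    by (rule cellI[OF X(1) _ X(3)]) (use X(2) face_subset_slice in blast)
qed

end

subsection \<open>Measures of cells\<close>

abbreviation leb :: "nat \<Rightarrow> (nat \<Rightarrow> real) measure"
  where "leb n \<equiv> Pi\<^sub>M {..<n} (\<lambda>_. lborel :: real measure)"

section \<open>Fubini, affine changes of one coordinate, and null hyperplanes\<close>

lemma product_lborel: "product_sigma_finite (\<lambda>_. lborel :: real measure)"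
  by standard

lemma lessThan_insert: "i < n \<Longrightarrow> {..<n} = insert i ({..<n} - {i})" for i n :: nat
  by auto

lemma nn_integral_leb_split:
  assumes i: "i < n" and f: "f \<in> borel_measurable (leb n)"
  shows "integral\<^sup>N (leb n) f = (\<integral>\<^sup>+x. \<integral>\<^sup>+y. f (x(i := y)) \<partial>lborel \<partial>Pi\<^sub>M ({..<n} - {i}) (\<lambda>_. lborel))"
  using product_sigma_finite.product_nn_integral_insert[OF product_lborel, of "{..<n} - {i}" i f] f
  unfolding lessThan_insert[OF i, symmetric] by simp

lemma component_measurable: "i < n \<Longrightarrow> (\<lambda>x. x i) \<in> borel_measurable (leb n)"
  using measurable_component_singleton[of i "{..<n}" "\<lambda>_. lborel :: real measure"] by simp

lemma coordinate_map_measurable: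
  assumes i: "i < n" and g: "g \<in> borel_measurable (leb n)"
  shows "(\<lambda>x. x(i := c * x i + g x)) \<in> measurable (leb n) (leb n)"
proof (rule measurable_fun_upd)
  show "{..<n} = {..<n} \<union> {i}" using i by auto
  show "(\<lambda>x. c * x i + g x) \<in> measurable (leb n) lborel"
    using component_measurable[OF i] g by simp
qed simp

text \<open>Fubini isolates coordinate \<open>i\<close>; as \<open>g\<close> ignores that
  coordinate, the inner integral is a one-dimensional affine substitution. Scalings, shears and
  translations along one axis are all instances.\<close>

lemma coordinate_map_measure:
  assumes i: "i < n" and c: "c \<noteq> 0" and g: "g \<in> borel_measurable (leb n)"
    and gi: "\<And>x y. g (x(i := y)) = g x" and A: "A \<in> sets (leb n)"
  shows "measure (leb n) {x \<in> space (leb n). x(i := c * x i + g x) \<in> A} = measure (leb n) A / \<bar>c\<bar>"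
proof -
  let ?I = "{..<n} - {i}"
  let ?T = "\<lambda>x. x(i := c * x i + g x)"
  have ins: "leb n = Pi\<^sub>M (insert i ?I) (\<lambda>_. lborel)" using lessThan_insert[OF i] by simp
  have T: "?T \<in> measurable (leb n) (leb n)" by (rule coordinate_map_measurable[OF i g])
  have preim: "{x \<in> space (leb n). ?T x \<in> A} \<in> sets (leb n)"
    using measurable_sets[OF T A] by (simp add: vimage_def Int_def conj_commute)
  have Am: "indicator A \<in> borel_measurable (Pi\<^sub>M (insert i ?I) (\<lambda>_. lborel))"
    using A ins by simp
  have "emeasure (leb n) {x \<in> space (leb n). ?T x \<in> A} = (\<integral>\<^sup>+x. indicator A (?T x) \<partial>leb n)"
    by (subst nn_integral_indicator[OF preim, symmetric]) (auto intro!: nn_integral_cong simp: indicator_def)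
  also have "\<dots> = (\<integral>\<^sup>+x. \<integral>\<^sup>+y. indicator A (?T (x(i := y))) \<partial>lborel \<partial>Pi\<^sub>M ?I (\<lambda>_. lborel))"
  proof -
    have "(\<lambda>x. indicator A (?T x) :: ennreal) \<in> borel_measurable (leb n)"
      using T A by measurable
    then show ?thesis by (rule nn_integral_leb_split[OF i])
  qed
  also have "\<dots> = (\<integral>\<^sup>+x. ennreal (1 / \<bar>c\<bar>) * (\<integral>\<^sup>+y. indicator A (x(i := y)) \<partial>lborel) \<partial>Pi\<^sub>M ?I (\<lambda>_. lborel))"
  proof (rule nn_integral_cong)
    fix x assume x: "x \<in> space (Pi\<^sub>M ?I (\<lambda>_. lborel :: real measure))"
    have "(\<lambda>y. x(i := y)) \<in> measurable lborel (Pi\<^sub>M (insert i ?I) (\<lambda>_. lborel))"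
      by (rule measurable_component_update[OF x]) simp
    from measurable_compose[OF this Am]
    have m: "(\<lambda>y. indicator A (x(i := y)) :: ennreal) \<in> borel_measurable borel" by simp
    have "(\<integral>\<^sup>+y. indicator A (?T (x(i := y))) \<partial>lborel) = (\<integral>\<^sup>+y. indicator A (x(i := g x + c * y)) \<partial>lborel)"
      by (simp add: gi add.commute)
    moreover have "(\<integral>\<^sup>+y. indicator A (x(i := y)) \<partial>lborel) =
        ennreal \<bar>c\<bar> * (\<integral>\<^sup>+y. indicator A (x(i := g x + c * y)) \<partial>lborel)"
      by (rule nn_integral_real_affine[OF m c])
    moreover have "ennreal (1 / \<bar>c\<bar>) * (ennreal \<bar>c\<bar> * z) = z" for z
      using c by (simp add: mult.assoc[symmetric] ennreal_mult[symmetric])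
    ultimately show "(\<integral>\<^sup>+y. indicator A (?T (x(i := y))) \<partial>lborel) =
        ennreal (1 / \<bar>c\<bar>) * (\<integral>\<^sup>+y. indicator A (x(i := y)) \<partial>lborel)" by simp
  qed
  also have "\<dots> = ennreal (1 / \<bar>c\<bar>) * (\<integral>\<^sup>+x. \<integral>\<^sup>+y. indicator A (x(i := y)) \<partial>lborel \<partial>Pi\<^sub>M ?I (\<lambda>_. lborel))"
  proof (rule nn_integral_cmult)
    have "(\<lambda>(x, y). x(i := y)) \<in> measurable (Pi\<^sub>M ?I (\<lambda>_. lborel) \<Otimes>\<^sub>M lborel) (Pi\<^sub>M (insert i ?I) (\<lambda>_. lborel :: real measure))"
      by (rule measurable_add_dim)
    from measurable_compose[OF this Am]
    have "(\<lambda>(x, y). indicator A (x(i := y)) :: ennreal) \<in> borel_measurable (Pi\<^sub>M ?I (\<lambda>_. lborel) \<Otimes>\<^sub>M lborel)"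
      by (simp add: case_prod_unfold)
    then show "(\<lambda>x. \<integral>\<^sup>+y. indicator A (x(i := y)) \<partial>lborel) \<in> borel_measurable (Pi\<^sub>M ?I (\<lambda>_. lborel))"
      by (rule sigma_finite_measure.borel_measurable_nn_integral[OF sigma_finite_lborel])
  qed
  also have "(\<integral>\<^sup>+x. \<integral>\<^sup>+y. indicator A (x(i := y)) \<partial>lborel \<partial>Pi\<^sub>M ?I (\<lambda>_. lborel)) = emeasure (leb n) A"
    using nn_integral_leb_split[OF i, of "indicator A"] A by simp
  finally have "emeasure (leb n) {x \<in> space (leb n). ?T x \<in> A} = ennreal (1 / \<bar>c\<bar>) * emeasure (leb n) A" .
  then show ?thesis unfolding measure_def by (simp only: enn2real_mult) simp
qed

text \<open>Each line parallel to axis \<open>i\<close> meets the hyperplane in at most one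
  point.\<close>

lemma hyperplane_null:
  assumes i: "i < n" "\<eta> i \<noteq> 0"
  shows "{x \<in> space (leb n). dot n \<eta> x = c} \<in> null_sets (leb n)"
proof -
  let ?I = "{..<n} - {i}"
  let ?A = "{x \<in> space (leb n). dot n \<eta> x = c}"
  have "dot n \<eta> \<in> borel_measurable (leb n)"
    unfolding dot_def[abs_def] by (intro borel_measurable_sum borel_measurable_times component_measurable) auto
  then have A: "?A \<in> sets (leb n)" by measurable
  have "emeasure (leb n) ?A = (\<integral>\<^sup>+x. indicator ?A x \<partial>leb n)" using A by simp
  also have "\<dots> = (\<integral>\<^sup>+x. \<integral>\<^sup>+y. indicator ?A (x(i := y)) \<partial>lborel \<partial>Pi\<^sub>M ?I (\<lambda>_. lborel))"
    using A by (intro nn_integral_leb_split i) simp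
  also have "\<dots> = (\<integral>\<^sup>+x. 0 \<partial>Pi\<^sub>M ?I (\<lambda>_. lborel :: real measure))"
  proof (rule nn_integral_cong)
    fix x :: "nat \<Rightarrow> real"
    let ?s = "\<Sum>j\<in>?I. \<eta> j * x j"
    have "dot n \<eta> (x(i := y)) = \<eta> i * y + ?s" for y
      unfolding dot_def by (subst lessThan_insert[OF i(1)], subst sum.insert) auto
    then have "y = (c - ?s) / \<eta> i" if "x(i := y) \<in> ?A" for y
      using that i by (simp add: field_simps)
    then have "(\<integral>\<^sup>+y. indicator ?A (x(i := y)) \<partial>lborel) \<le> (\<integral>\<^sup>+y. indicator {(c - ?s) / \<eta> i} y \<partial>lborel)"
      by (intro nn_integral_mono) (simp add: indicator_def)
    also have "\<dots> = 0" by simp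
    finally show "(\<integral>\<^sup>+y. indicator ?A (x(i := y)) \<partial>lborel) = 0" by simp
  qed
  finally show ?thesis using A by (simp add: null_sets_def)
qed

lemma translation_measure:
  assumes A: "A \<in> sets (leb n)"
  shows "measure (leb n) {x \<in> space (leb n). (\<lambda>i\<in>{..<n}. x i + t i) \<in> A} = measure (leb n) A"
proof -
  \<comment> \<open>\<open>R m\<close> translates the first \<open>m\<close> coordinates only, so
    passing to \<open>Suc m\<close> changes a single coordinate.\<close>
  define R where "R m x = (\<lambda>i\<in>{..<n}. if i < m then x i + t i else x i)" for m and x :: "nat \<Rightarrow> real"
  have main: "{x \<in> space (leb n). R m x \<in> A} \<in> sets (leb n) \<and>
      measure (leb n) {x \<in> space (leb n). R m x \<in> A} = measure (leb n) A" if "m \<le> n" for m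
    using that
  proof (induction m)
    case 0
    have "R 0 x = x" if "x \<in> space (leb n)" for x
      using that by (auto simp: R_def space_PiM PiE_def extensional_def)
    then have "{x \<in> space (leb n). R 0 x \<in> A} = A"
      using sets.sets_into_space[OF A] by auto
    then show ?case using A by simp
  next
    case (Suc m)
    let ?B = "{x \<in> space (leb n). R m x \<in> A}"
    have B: "?B \<in> sets (leb n)" "measure (leb n) ?B = measure (leb n) A" using Suc by auto
    have m: "m < n" using Suc.prems by simp
    have eq: "{x \<in> space (leb n). R (Suc m) x \<in> A} = {x \<in> space (leb n). x(m := 1 * x m + t m) \<in> ?B}"
    proof -
      have "R m (x(m := 1 * x m + t m)) = R (Suc m) x" for x
        by (auto simp: R_def fun_eq_iff less_Suc_eq)
      moreover have "x(m := 1 * x m + t m) \<in> space (leb n)" if "x \<in> space (leb n)" for x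
        using that m by (auto simp: space_PiM PiE_def extensional_def)
      ultimately show ?thesis by auto
    qed
    have "{x \<in> space (leb n). x(m := 1 * x m + t m) \<in> ?B} \<in> sets (leb n)"
      using measurable_sets[OF coordinate_map_measurable[OF m, of "\<lambda>_. t m" 1] B(1)]
      by (simp add: vimage_def Int_def conj_commute)
    moreover have "measure (leb n) {x \<in> space (leb n). x(m := 1 * x m + t m) \<in> ?B} = measure (leb n) ?B"
      using coordinate_map_measure[OF m, of 1 "\<lambda>_. t m" ?B] B(1) by simp
    ultimately show ?case unfolding eq B(2) by blast
  qed
  have "R n = (\<lambda>x. \<lambda>i\<in>{..<n}. x i + t i)" by (auto simp: R_def fun_eq_iff)
  then show ?thesis using main[of n] by simp
qed

text \<open>Measurability comes from compactness of the set of tuples, finiteness from a bounding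
  box.\<close>

lemma cell_fmeasurable:
  "cell n N b h \<kappa> S \<in> fmeasurable (leb n)"
proof -
  interpret product_sigma_finite "\<lambda>_. lborel :: real measure" by (rule product_lborel)
  \<comment> \<open>Points of the product measure are \<open>undefined\<close> from index
    \<open>n\<close> on. \<open>\<Phi>\<close> and \<open>e\<close> put zero there instead, so that
    closed sets of the full function space can be pulled back.\<close>
  define \<Phi> where "\<Phi> X i = (if i < n then mix N b S X i else 0)" for X i
  let ?K = "\<Phi> ` face_tuples N h \<kappa> S"
  have "continuous_on (face_tuples N h \<kappa> S) \<Phi>"
  proof (rule continuous_on_coordinatewise_then_product)
    show "continuous_on (face_tuples N h \<kappa> S) (\<lambda>X. \<Phi> X i)" for i
      by (cases "i < n") (simp_all add: \<Phi>_def continuous_mix)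
  qed
  then have "compact ?K" using compact_face_tuples by (rule compact_continuous_image)
  then have K: "?K \<in> sets borel" by (simp add: compact_imp_closed borel_closed)
  define e where "e x i = (if i < n then x i else (0::real))" for x :: "nat \<Rightarrow> real" and i :: nat
  have "e \<in> borel_measurable (leb n)"
  proof (rule measurable_coordinatewise_then_product)
    show "(\<lambda>x. e x i) \<in> borel_measurable (leb n)" for i
      by (cases "i < n") (simp_all add: e_def component_measurable)
  qed
  from measurable_sets[OF this K] have "e -` ?K \<inter> space (leb n) \<in> sets (leb n)" .
  also have "e -` ?K \<inter> space (leb n) = cell n N b h \<kappa> S"
  proof -
    have "e x = \<Phi> X \<longleftrightarrow> (\<forall>i<n. x i = mix N b S X i)" for x X
      by (auto simp: e_def \<Phi>_def fun_eq_iff)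
    then show ?thesis by (auto simp: cell_def space_PiM image_iff)
  qed
  finally have meas: "cell n N b h \<kappa> S \<in> sets (leb n)" .
  define R where "R i = (\<Sum>k\<in>S. \<Sum>j=1..N. \<bar>b j i\<bar>)" for i
  have "cell n N b h \<kappa> S \<subseteq> Pi\<^sub>E {..<n} (\<lambda>i. {- R i..R i})"
  proof
    fix w assume "w \<in> cell n N b h \<kappa> S"
    then obtain X where w: "w \<in> {..<n} \<rightarrow>\<^sub>E UNIV" and X: "\<And>k. k \<in> S \<Longrightarrow> X k \<in> face N h (\<kappa> k)"
      "\<And>i. i < n \<Longrightarrow> w i = mix N b S X i" by (rule cellE) blast
    have "\<bar>w i\<bar> \<le> R i" if "i < n" for i
    proof -
      have "\<bar>X k j * b j i\<bar> \<le> \<bar>b j i\<bar>" if "k \<in> S" "j \<in> {1..N}" for k j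
      proof -
        have "0 \<le> X k j" "X k j \<le> 1" using X(1) that by (auto simp: face_def)
        then show ?thesis by (simp add: abs_mult mult_left_le_one_le)
      qed
      then have "\<bar>mix N b S X i\<bar> \<le> R i"
        unfolding mix_def R_def by (intro order_trans[OF sum_abs] sum_mono) blast+
      then show ?thesis using X(2) that by simp
    qed
    then show "w \<in> Pi\<^sub>E {..<n} (\<lambda>i. {- R i..R i})" using w by (auto simp: PiE_iff abs_le_iff) (smt (verit))+
  qed
  then have "emeasure (leb n) (cell n N b h \<kappa> S) \<le> emeasure (leb n) (Pi\<^sub>E {..<n} (\<lambda>i. {- R i..R i}))"
    by (intro emeasure_mono sets_PiM_I_finite) auto
  also have "\<dots> < \<infinity>"
    by (subst emeasure_PiM) (auto simp: emeasure_lborel_Icc_eq ennreal_prod_eq_top less_top[symmetric] power_eq_top_ennreal)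
  finally show ?thesis using meas by (simp add: fmeasurable_def)
qed

text \<open>Distinct vertices differ below \<open>n\<close>, so the equation in
  \<open>cell_overlap\<close> describes a proper hyperplane and the covering cells overlap in null
  sets.\<close>

theorem (in tilted) cell_measure_sum:
  assumes \<kappa>: "\<And>k. k \<in> S \<Longrightarrow> \<kappa> k \<le> N"
  shows "measure (leb n) (cell n N b (\<lambda>_. 0) \<kappa> S) = (\<Sum>\<psi>\<in>verts. measure (leb n) (cell n N b (tilt \<psi>) \<kappa> S))"
proof -
  have "measure (leb n) (\<Union>\<psi>\<in>verts. cell n N b (tilt \<psi>) \<kappa> S) =
    (\<Sum>\<psi>\<in>verts. measure (leb n) (cell n N b (tilt \<psi>) \<kappa> S))"
  proof (rule measure_UNION_AE[OF finite_verts cell_fmeasurable pairwiseI])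
    fix \<psi> \<psi>' assume \<psi>: "\<psi> \<in> verts" "\<psi>' \<in> verts" "\<psi> \<noteq> \<psi>'"
    have "\<exists>i<n. \<psi> i - \<psi>' i \<noteq> 0"
    proof (rule ccontr)
      assume "\<not> ?thesis"
      then have "\<psi> i = \<psi>' i" for i using \<psi>(1,2) by (cases "i < n") (auto simp: verts_def)
      then show False using \<psi>(3) by auto
    qed
    then obtain i where i: "i < n" "\<psi> i - \<psi>' i \<noteq> 0" by blast
    let ?c = "(\<Sum>k\<in>S. level_max N (tilt \<psi>') (\<kappa> k)) - (\<Sum>k\<in>S. level_max N (tilt \<psi>) (\<kappa> k))"
    show "AE x in leb n. x \<notin> cell n N b (tilt \<psi>) \<kappa> S \<or> x \<notin> cell n N b (tilt \<psi>') \<kappa> S"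
    proof (rule AE_I')
      show "{x \<in> space (leb n). dot n (\<lambda>i. \<psi> i - \<psi>' i) x = ?c} \<in> null_sets (leb n)"
        using hyperplane_null[OF i(1), of "\<lambda>i. \<psi> i - \<psi>' i"] i(2) .
      show "{x \<in> space (leb n). \<not> (x \<notin> cell n N b (tilt \<psi>) \<kappa> S \<or> x \<notin> cell n N b (tilt \<psi>') \<kappa> S)}
          \<subseteq> {x \<in> space (leb n). dot n (\<lambda>i. \<psi> i - \<psi>' i) x = ?c}"
        by (rule subsetI) (simp add: cell_overlap[of S \<kappa> _ \<psi> \<psi>', OF \<kappa>])
    qed
  qed
  then show ?thesis using cell_cover[of S \<kappa>] \<kappa> by simp
qed

subsection \<open>Change of frame\<close>

definition lincomb :: "'v::real_vector list \<Rightarrow> (nat \<Rightarrow> real) \<Rightarrow> 'v"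
  where "lincomb ws x = (\<Sum>i<length ws. x i *\<^sub>R ws ! i)"

text \<open>A basis in terms of unique coordinates. Uniqueness concerns entries below
  \<open>length ws\<close> only, because coordinate vectors are functions on all naturals.\<close>

definition frame :: "'v::real_vector set \<Rightarrow> 'v list \<Rightarrow> bool"
  where "frame U ws \<longleftrightarrow> (\<forall>x. lincomb ws x \<in> U) \<and> (\<forall>u\<in>U. \<exists>x. lincomb ws x = u) \<and>
    (\<forall>x. lincomb ws x = 0 \<longrightarrow> (\<forall>i<length ws. x i = 0))"

definition frame_set :: "'v::real_vector list \<Rightarrow> 'v set \<Rightarrow> (nat \<Rightarrow> real) set"
  where "frame_set ws K = {x \<in> space (leb (length ws)). lincomb ws x \<in> K}"

lemma frame_volume_frame_set: "frame_volume ws K = measure (leb (length ws)) (frame_set ws K)"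
  by (simp add: frame_volume_def frame_set_def lincomb_def space_PiM)

lemma lincomb_add: "lincomb ws (\<lambda>i. x i + y i) = lincomb ws x + lincomb ws y"
  by (simp add: lincomb_def scaleR_left_distrib sum.distrib)

lemma lincomb_scale: "lincomb ws (\<lambda>i. c * x i) = c *\<^sub>R lincomb ws x"
  by (simp add: lincomb_def scaleR_right.sum)

lemma lincomb_diff: "lincomb ws (\<lambda>i. x i - y i) = lincomb ws x - lincomb ws y"
  by (simp add: lincomb_def scaleR_left_diff_distrib sum_subtractf)

lemma lincomb_sum: "lincomb ws (\<lambda>i. \<Sum>k\<in>A. f k i) = (\<Sum>k\<in>A. lincomb ws (f k))"
proof -
  have "lincomb ws (\<lambda>i. \<Sum>k\<in>A. f k i) = (\<Sum>i<length ws. \<Sum>k\<in>A. f k i *\<^sub>R ws ! i)"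
    by (simp add: lincomb_def scaleR_left.sum)
  also have "\<dots> = (\<Sum>k\<in>A. \<Sum>i<length ws. f k i *\<^sub>R ws ! i)" by (rule sum.swap)
  finally show ?thesis by (simp add: lincomb_def)
qed

lemma lincomb_cong: "(\<And>i. i < length ws \<Longrightarrow> x i = y i) \<Longrightarrow> lincomb ws x = lincomb ws y"
  by (simp add: lincomb_def)

lemma lincomb_unit: "k < length ws \<Longrightarrow> lincomb ws (\<lambda>i. if i = k then 1 else 0) = ws ! k"
  by (simp add: lincomb_def if_distrib[of "\<lambda>c. c *\<^sub>R _"] cong: if_cong)

lemma frame_unique:
  assumes "frame U ws" "lincomb ws x = lincomb ws y" "i < length ws"
  shows "x i = y i"
proof -
  have "lincomb ws (\<lambda>i. x i - y i) = 0" using assms(2) by (simp add: lincomb_diff)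
  then have "x i - y i = 0" using assms(1,3) unfolding frame_def by blast
  then show ?thesis by simp
qed

lemma basis_list_frame:
  assumes "basis_list U ws"
  shows "frame U ws"
proof -
  have d: "distinct ws" "independent (set ws)" "span (set ws) = U"
    using assms by (auto simp: basis_list_def)
  have set: "set ws = (!) ws ` {..<length ws}" by (auto simp: set_conv_nth)
  have inj: "inj_on ((!) ws) {..<length ws}" using d(1) by (simp add: inj_on_nth)
  have lc: "(\<Sum>z\<in>set ws. u z *\<^sub>R z) = lincomb ws (\<lambda>i. u (ws ! i))" for u
    unfolding set lincomb_def by (simp add: sum.reindex[OF inj])
  have "lincomb ws x \<in> U" for x
    unfolding lincomb_def d(3)[symmetric] by (intro span_sum span_scale span_base) simp
  moreover have "\<exists>x. lincomb ws x = u" if u: "u \<in> U" for u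
  proof -
    obtain f where "u = (\<Sum>z\<in>set ws. f z *\<^sub>R z)"
      using u d(3) by (auto simp: span_finite)
    then show ?thesis using lc by metis
  qed
  moreover have "x i = 0" if "lincomb ws x = 0" "i < length ws" for x i
  proof -
    define u where "u z = x (the_inv_into {..<length ws} ((!) ws) z)" for z
    have u: "u (ws ! j) = x j" if "j < length ws" for j
      using that the_inv_into_f_f[OF inj, of j] by (simp add: u_def)
    then have "lincomb ws (\<lambda>i. u (ws ! i)) = 0" using that(1) lincomb_cong[of ws "\<lambda>i. u (ws ! i)" x] by simp
    then have "(\<Sum>z\<in>set ws. u z *\<^sub>R z) = 0" using lc by simp
    then have "\<forall>z\<in>set ws. u z = 0" using d(2) by (auto simp: dependent_finite)
    then show ?thesis using u that(2) by simp
  qed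
  ultimately show ?thesis by (auto simp: frame_def)
qed

text \<open>Elementary operations take the place of determinants: under each of them the volume and
  the absolute value of the form change by reciprocal factors.\<close>

inductive elem_reach :: "'v::real_vector list \<Rightarrow> 'v list \<Rightarrow> bool" for ws where
  elem_refl: "elem_reach ws ws"
| elem_scale: "elem_reach ws us \<Longrightarrow> i < length us \<Longrightarrow> c \<noteq> 0 \<Longrightarrow> elem_reach ws (us[i := c *\<^sub>R us ! i])"
| elem_shear: "elem_reach ws us \<Longrightarrow> i < length us \<Longrightarrow> k < length us \<Longrightarrow> i \<noteq> k \<Longrightarrow>
    elem_reach ws (us[i := us ! i + c *\<^sub>R us ! k])"

lemma elem_reach_length: "elem_reach ws us \<Longrightarrow> length us = length ws"
  by (induction rule: elem_reach.induct) auto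

lemma elem_reach_trans: "elem_reach us vs \<Longrightarrow> elem_reach ws us \<Longrightarrow> elem_reach ws vs"
  by (induction rule: elem_reach.induct) (auto intro: elem_reach.intros)

lemma lincomb_list_update_scale:
  assumes "i < length us"
  shows "lincomb (us[i := c *\<^sub>R us ! i]) x = lincomb us (x(i := c * x i))"
  unfolding lincomb_def by (rule sum.cong) (auto simp: nth_list_update)

text \<open>Coordinates transform by the transposed matrix: changing vector \<open>i\<close> by
  vector \<open>k\<close> changes coordinate \<open>k\<close> by coordinate
  \<open>i\<close>.\<close>

lemma lincomb_list_update_shear:
  assumes "i < length us" "k < length us" "i \<noteq> k"
  shows "lincomb (us[i := us ! i + c *\<^sub>R us ! k]) x = lincomb us (x(k := x k + c * x i))"
proof -
  have "lincomb (us[i := us ! i + c *\<^sub>R us ! k]) x =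
      (\<Sum>j<length us. x j *\<^sub>R us ! j + (if j = i then (c * x i) *\<^sub>R us ! k else 0))"
    unfolding lincomb_def by (rule sum.cong) (auto simp: nth_list_update scaleR_right_distrib mult.commute)
  also have "\<dots> = (\<Sum>j<length us. x j *\<^sub>R us ! j) + (c * x i) *\<^sub>R us ! k"
    using assms by (simp add: sum.distrib)
  also have "\<dots> = (\<Sum>j<length us. x j *\<^sub>R us ! j + (if j = k then (c * x i) *\<^sub>R us ! k else 0))"
    using assms by (simp add: sum.distrib)
  also have "\<dots> = lincomb us (x(k := x k + c * x i))"
    unfolding lincomb_def by (rule sum.cong) (auto simp: scaleR_left_distrib)
  finally show ?thesis .
qed

lemma frame_transfer:
  assumes "frame U us" and len: "length us' = length us"
    and T: "\<And>x. lincomb us' x = lincomb us (T x)" and T': "\<And>y. T (T' y) = y"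
    and T0: "\<And>x. (\<forall>i<length us. T x i = 0) \<Longrightarrow> (\<forall>i<length us. x i = 0)"
  shows "frame U us'"
proof -
  have "\<exists>x. lincomb us' x = u" if u: "u \<in> U" for u
  proof -
    obtain y where "lincomb us y = u" using assms(1) u by (auto simp: frame_def)
    then have "lincomb us' (T' y) = u" by (simp add: T T')
    then show ?thesis by blast
  qed
  then show ?thesis using assms(1) T T0 len by (simp add: frame_def)
qed

lemma elem_reach_frame:
  assumes "elem_reach ws us" "frame U ws"
  shows "frame U us"
  using assms
proof (induction rule: elem_reach.induct)
  case (elem_scale us i c)
  show ?case
  proof (rule frame_transfer[of U us _ "\<lambda>x. x(i := c * x i)" "\<lambda>x. x(i := x i / c)"])
    show "\<And>x. lincomb (us[i := c *\<^sub>R us ! i]) x = lincomb us (x(i := c * x i))"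
      using elem_scale by (simp add: lincomb_list_update_scale)
  qed (use elem_scale in \<open>auto split: if_splits\<close>)
next
  case (elem_shear us i k c)
  show ?case
  proof (rule frame_transfer[of U us _ "\<lambda>x. x(k := x k + c * x i)" "\<lambda>x. x(k := x k - c * x i)"])
    show "\<And>x. lincomb (us[i := us ! i + c *\<^sub>R us ! k]) x = lincomb us (x(k := x k + c * x i))"
      using elem_shear by (simp add: lincomb_list_update_shear)
    show "\<forall>j<length us. x j = 0" if "\<forall>j<length us. (x(k := x k + c * x i)) j = 0" for x
    proof (intro allI impI)
      fix j assume j: "j < length us"
      have "x i = 0" using that[rule_format, of i] elem_shear by simp
      then show "x j = 0" using that[rule_format, of j] j by (cases "j = k") auto
    qed
  qed (use elem_shear in auto)
qed

lemma alternating_form_scale: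
  assumes "alternating_form n \<omega>" "length us = n" "i < n"
  shows "\<omega> (us[i := c *\<^sub>R us ! i]) = c * \<omega> us"
proof -
  have "linear (\<lambda>x. \<omega> (us[i := x]))" using assms by (simp add: alternating_form_def)
  then have "\<omega> (us[i := c *\<^sub>R us ! i]) = c *\<^sub>R \<omega> (us[i := us ! i])" by (rule linear_scale)
  then show ?thesis by simp
qed

lemma alternating_form_shear:
  assumes "alternating_form n \<omega>" "length us = n" "i < n" "k < n" "i \<noteq> k"
  shows "\<omega> (us[i := us ! i + c *\<^sub>R us ! k]) = \<omega> us"
proof -
  have lin: "linear (\<lambda>x. \<omega> (us[i := x]))" using assms by (simp add: alternating_form_def)
  have alt: "\<omega> xs = 0" if "length xs = n" "p < q" "q < n" "xs ! p = xs ! q" for xs p q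
    using assms(1) that unfolding alternating_form_def by blast
  have "\<omega> (us[i := us ! k]) = 0"
  proof (cases "i < k")
    case True
    then show ?thesis using assms by (intro alt[of _ i k]) auto
  next
    case False
    then show ?thesis using assms by (intro alt[of _ k i]) auto
  qed
  moreover have "\<omega> (us[i := us ! i + c *\<^sub>R us ! k]) = \<omega> (us[i := us ! i]) + c *\<^sub>R \<omega> (us[i := us ! k])"
    using linear_add[OF lin] linear_scale[OF lin] by simp
  ultimately show ?thesis by simp
qed

text \<open>A scaling divides the volume by |c| and multiplies the form by \<open>c\<close>; a shear
  preserves both. Measurability is carried along because the next operation requires it.\<close>

lemma elem_reach_volume:
  assumes "elem_reach ws us" "alternating_form (length ws) \<omega>" "frame_set ws K \<in> sets (leb (length ws))"
  shows "frame_set us K \<in> sets (leb (length ws)) \<and>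
    \<bar>\<omega> us\<bar> * frame_volume us K = \<bar>\<omega> ws\<bar> * frame_volume ws K"
  using assms
proof (induction rule: elem_reach.induct)
  case (elem_scale us i c)
  let ?n = "length ws" and ?us = "us[i := c *\<^sub>R us ! i]"
  have len: "length us = ?n" using elem_scale elem_reach_length by blast
  have i: "i < ?n" using elem_scale len by simp
  have K: "frame_set us K \<in> sets (leb ?n)" using elem_scale by simp
  have eq: "frame_set ?us K = {x \<in> space (leb ?n). x(i := c * x i + 0) \<in> frame_set us K}"
  proof -
    have "x(i := c * x i + 0) \<in> space (leb ?n)" if "x \<in> space (leb ?n)" for x
      using that i by (auto simp: space_PiM PiE_def extensional_def)
    then show ?thesis using lincomb_list_update_scale[of i us c] i len by (auto simp: frame_set_def)
  qed
  have "frame_set ?us K \<in> sets (leb ?n)" unfolding eq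
    using measurable_sets[OF coordinate_map_measurable[OF i, of "\<lambda>_. 0" c] K]
    by (simp add: vimage_def Int_def conj_commute)
  moreover have "frame_volume ?us K = frame_volume us K / \<bar>c\<bar>"
    using coordinate_map_measure[OF i \<open>c \<noteq> 0\<close>, of "\<lambda>_. 0", OF _ _ K] eq len
    by (simp add: frame_volume_frame_set)
  moreover have "\<omega> ?us = c * \<omega> us" using alternating_form_scale[OF elem_scale.prems(1) len i] .
  ultimately show ?case using elem_scale by (simp add: abs_mult)
next
  case (elem_shear us i k c)
  let ?n = "length ws" and ?us = "us[i := us ! i + c *\<^sub>R us ! k]"
  have len: "length us = ?n" using elem_shear elem_reach_length by blast
  have i: "i < ?n" "k < ?n" using elem_shear len by auto
  have K: "frame_set us K \<in> sets (leb ?n)" using elem_shear by simp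
  have g: "(\<lambda>x. c * x i) \<in> borel_measurable (leb ?n)" using component_measurable[OF i(1)] by simp
  have eq: "frame_set ?us K = {x \<in> space (leb ?n). x(k := 1 * x k + c * x i) \<in> frame_set us K}"
  proof -
    have "x(k := 1 * x k + c * x i) \<in> space (leb ?n)" if "x \<in> space (leb ?n)" for x
      using that i by (auto simp: space_PiM PiE_def extensional_def)
    then show ?thesis using lincomb_list_update_shear[of i us k c] i len elem_shear.hyps by (auto simp: frame_set_def)
  qed
  have "frame_set ?us K \<in> sets (leb ?n)" unfolding eq
    using measurable_sets[OF coordinate_map_measurable[OF i(2) g, of 1] K]
    by (simp add: vimage_def Int_def conj_commute)
  moreover have "frame_volume ?us K = frame_volume us K"
    using coordinate_map_measure[OF i(2) _ g _ K, of 1] eq len \<open>i \<noteq> k\<close>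
    by (simp add: frame_volume_frame_set)
  moreover have "\<omega> ?us = \<omega> us" using alternating_form_shear[OF elem_shear.prems(1) len i] elem_shear.hyps by simp
  ultimately show ?case using elem_shear by simp
qed simp

text \<open>One scaling of entry \<open>k\<close>, then one shear for each index in
  \<open>J\<close>.\<close>

lemma elem_reach_replace_partial:
  assumes "finite J" "J \<subseteq> {..<length zs} - {k}" "k < length zs" "c k \<noteq> 0"
  shows "elem_reach zs (zs[k := c k *\<^sub>R zs ! k + (\<Sum>j\<in>J. c j *\<^sub>R zs ! j)])"
  using assms(1,2)
proof (induction J rule: finite_induct)
  case empty
  then show ?case using elem_scale[OF elem_refl assms(3,4)] by simp
next
  case (insert j J)
  let ?us = "zs[k := c k *\<^sub>R zs ! k + (\<Sum>j\<in>J. c j *\<^sub>R zs ! j)]"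
  have "elem_reach zs ?us" using insert by simp
  then have "elem_reach zs (?us[k := ?us ! k + c j *\<^sub>R ?us ! j])"
    using insert.prems assms(3) by (intro elem_shear) auto
  moreover have "?us ! j = zs ! j" using insert.prems by auto
  ultimately show ?case using insert assms(3) by (simp add: algebra_simps)
qed

lemma elem_reach_replace:
  assumes "k < length zs" "c k \<noteq> 0"
  shows "elem_reach zs (zs[k := lincomb zs c])"
proof -
  have "lincomb zs c = c k *\<^sub>R zs ! k + (\<Sum>j\<in>{..<length zs} - {k}. c j *\<^sub>R zs ! j)"
    unfolding lincomb_def using assms(1) by (subst sum.remove[of _ k]) auto
  then show ?thesis using elem_reach_replace_partial[of "{..<length zs} - {k}" zs k c] assms by simp
qed

text \<open>Steinitz exchange in the form of Gaussian elimination: the list is made to agree with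
  \<open>us\<close> one position at a time.\<close>

lemma frames_elem_reach:
  assumes ws: "frame U ws" and us: "frame U us" and len: "length us = length ws"
  shows "elem_reach ws us"
proof -
  have "\<exists>zs. elem_reach ws zs \<and> (\<forall>j<k. zs ! j = us ! j)" if "k \<le> length us" for k
    using that
  proof (induction k)
    case 0
    then show ?case using elem_refl by auto
  next
    case (Suc k)
    then obtain zs where zs: "elem_reach ws zs" "\<forall>j<k. zs ! j = us ! j" by auto
    have k: "k < length us" using Suc.prems by simp
    have lz: "length zs = length us" using elem_reach_length[OF zs(1)] len by simp
    have fz: "frame U zs" using elem_reach_frame[OF zs(1) ws] .
    have "us ! k \<in> U" using us lincomb_unit[OF k] unfolding frame_def by metis
    then obtain c where c: "lincomb zs c = us ! k" using fz unfolding frame_def by blast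
    \<comment> \<open>Otherwise \<open>us ! k\<close> would be a combination of the earlier vectors
      of \<open>us\<close>.\<close>
    have "\<exists>i\<ge>k. i < length us \<and> c i \<noteq> 0"
    proof (rule ccontr)
      assume no: "\<not> ?thesis"
      define x where "x j = (if j < k then c j else 0) - (if j = k then 1 else 0)" for j
      have "lincomb us x = lincomb us (\<lambda>j. if j < k then c j else 0) - us ! k"
        unfolding x_def using lincomb_diff[of us "\<lambda>j. if j < k then c j else 0" "\<lambda>j. if j = k then 1 else 0"]
          lincomb_unit[OF k] by simp
      also have "lincomb us (\<lambda>j. if j < k then c j else 0) = lincomb zs c"
        unfolding lincomb_def lz using no zs(2) by (intro sum.cong) (auto simp: not_less)
      finally have "lincomb us x = 0" using c by simp
      then have "x k = 0" using us k unfolding frame_def by blast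
      then show False by (simp add: x_def)
    qed
    then obtain i where i: "i \<ge> k" "i < length us" "c i \<noteq> 0" by blast
    have "\<exists>ys e. elem_reach zs ys \<and> (\<forall>j<k. ys ! j = us ! j) \<and> lincomb ys e = us ! k \<and> e k \<noteq> 0"
    proof (cases "c k = 0")
      case False
      then show ?thesis using elem_refl zs(2) c by blast
    next
      case True
      then have ik: "i \<noteq> k" using i by auto
      \<comment> \<open>This replaces a swap: after adding vector \<open>k\<close> to vector
        \<open>i\<close>, the coordinate of \<open>us ! k\<close> at position \<open>k\<close>
        becomes \<open>- c i\<close>, which is nonzero.\<close>
      let ?ys = "zs[i := zs ! i + 1 *\<^sub>R zs ! k]" and ?e = "c(k := - c i)"
      have "elem_reach zs ?ys" using ik i k lz by (intro elem_shear elem_refl) auto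
      moreover have "\<forall>j<k. ?ys ! j = us ! j" using zs(2) i by auto
      moreover have "lincomb ?ys ?e = us ! k"
        using lincomb_list_update_shear[of i zs k 1 ?e] i ik k lz True c by (simp add: fun_upd_idem)
      moreover have "?e k \<noteq> 0" using i by simp
      ultimately show ?thesis by blast
    qed
    then obtain ys e where ys: "elem_reach zs ys" "\<forall>j<k. ys ! j = us ! j" "lincomb ys e = us ! k" "e k \<noteq> 0"
      by blast
    have ly: "length ys = length us" using elem_reach_length[OF ys(1)] lz by simp
    have "elem_reach ys (ys[k := us ! k])" using elem_reach_replace[of k ys e] ys ly k by simp
    then have "elem_reach ws (ys[k := us ! k])" using elem_reach_trans ys(1) zs(1) by blast
    moreover have "\<forall>j<Suc k. ys[k := us ! k] ! j = us ! j" using ys(2) k ly by (auto simp: less_Suc_eq)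
    ultimately show ?case by blast
  qed
  from this[of "length us"] obtain zs where "elem_reach ws zs" "\<forall>j<length us. zs ! j = us ! j" by auto
  moreover have "zs = us"
    using calculation elem_reach_length[of ws zs] len by (intro nth_equalityI) auto
  ultimately show ?thesis by simp
qed

theorem frame_volume_change:
  assumes "frame U ws" "frame U us" "length us = length ws" "alternating_form (length ws) \<omega>"
    and "frame_set ws K \<in> sets (leb (length ws))"
  shows "\<bar>\<omega> us\<bar> * frame_volume us K = \<bar>\<omega> ws\<bar> * frame_volume ws K"
  using elem_reach_volume[OF frames_elem_reach[OF assms(1-3)] assms(4,5)] by blast

lemma alternating_form_append:
  assumes "alternating_form (Suc n) \<omega>"
  shows "alternating_form n (\<lambda>ws. \<omega> (ws @ [v]))"
  unfolding alternating_form_def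
proof (intro conjI allI impI)
  fix xs :: "'a list" and i assume "length xs = n \<and> i < n"
  then have "linear (\<lambda>x. \<omega> ((xs @ [v])[i := x]))" "i < length xs"
    using assms by (auto simp: alternating_form_def)
  then show "linear (\<lambda>x. \<omega> (xs[i := x] @ [v]))" by (simp add: list_update_append)
next
  fix xs :: "'a list" and i j assume a: "length xs = n \<and> i < j \<and> j < n \<and> xs ! i = xs ! j"
  then have "length (xs @ [v]) = Suc n \<and> i < j \<and> j < Suc n \<and> (xs @ [v]) ! i = (xs @ [v]) ! j"
    by (auto simp: nth_append)
  then show "\<omega> (xs @ [v]) = 0" using assms unfolding alternating_form_def by blast
qed

lemma alternating_form_add_lincomb:
  assumes "alternating_form n \<omega>" "length us = n" "i < n" "J \<subseteq> {..<n} - {i}"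
  shows "\<omega> (us[i := us ! i + (\<Sum>j\<in>J. c j *\<^sub>R us ! j)]) = \<omega> us"
proof -
  have "finite J" using assms(4) finite_subset by blast
  then show ?thesis using assms(4)
  proof (induction J rule: finite_induct)
    case (insert j J)
    let ?us = "us[i := us ! i + (\<Sum>j\<in>J. c j *\<^sub>R us ! j)]"
    have "\<omega> (?us[i := ?us ! i + c j *\<^sub>R ?us ! j]) = \<omega> ?us"
      using insert.prems assms by (intro alternating_form_shear[OF assms(1)]) auto
    moreover have "?us ! j = us ! j" using insert.prems by auto
    ultimately show ?case using insert assms by (simp add: algebra_simps)
  qed simp
qed

subsection \<open>Hypersimplices and windows of levels\<close>

lemma sum_indicator_scaleR:
  fixes u :: "nat \<Rightarrow> 'v::real_vector"
  assumes "I \<subseteq> {1..N}"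
  shows "(\<Sum>j\<in>I. u j) = (\<Sum>j=1..N. (if j \<in> I then 1 else 0) *\<^sub>R u j)"
proof -
  have "(\<Sum>j\<in>I. u j) = (\<Sum>j=1..N. if j \<in> I then u j else 0)"
    using assms by (simp add: sum.If_cases Int_absorb1)
  also have "\<dots> = (\<Sum>j=1..N. (if j \<in> I then 1 else 0) *\<^sub>R u j)"
    by (rule sum.cong) auto
  finally show ?thesis .
qed

text \<open>Induction on the number of fractional coordinates. The integral sum forces at least two
  of them; moving mass between these two in either direction until one becomes 0 or 1 gives points
  with fewer, and \<open>x\<close> lies on the segment between them.\<close>

lemma slice_point_in_hull:
  fixes u :: "nat \<Rightarrow> 'v::real_vector"
  assumes "x \<in> face N (\<lambda>_. 0) k"
  shows "(\<Sum>j=1..N. x j *\<^sub>R u j) \<in> convex hull {(\<Sum>j\<in>I. u j) | I. I \<subseteq> {1..N} \<and> card I = k}"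
  using assms
proof (induction "card {j \<in> {1..N}. x j \<noteq> 0 \<and> x j \<noteq> 1}" arbitrary: x rule: less_induct)
  case (less x)
  let ?F = "\<lambda>x. {j \<in> {1..N}. x j \<noteq> 0 \<and> x j \<noteq> (1::real)}"
  let ?H = "convex hull {(\<Sum>j\<in>I. u j) | I. I \<subseteq> {1..N} \<and> card I = k}"
  have x01: "\<And>j. j \<in> {1..N} \<Longrightarrow> 0 \<le> x j \<and> x j \<le> 1" and xs: "(\<Sum>j=1..N. x j) = real k"
    using less.prems by (auto simp: face_def)
  show ?case
  proof (cases "?F x = {}")
    case True
    define I where "I = {j \<in> {1..N}. x j = 1}"
    have xI: "x j = (if j \<in> I then 1 else 0)" if "j \<in> {1..N}" for j
      using True that by (auto simp: I_def)
    have "I \<subseteq> {1..N}" by (auto simp: I_def)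
    then have "(\<Sum>j=1..N. if j \<in> I then 1 else 0) = real (card I)"
      by (simp add: sum.If_cases Int_absorb1)
    moreover have "(\<Sum>j=1..N. x j) = (\<Sum>j=1..N. if j \<in> I then 1 else 0)"
      by (rule sum.cong[OF refl xI])
    ultimately have "card I = k" using xs by simp
    moreover have "(\<Sum>j=1..N. x j *\<^sub>R u j) = (\<Sum>j\<in>I. u j)"
      using sum_indicator_scaleR[of I N u] \<open>I \<subseteq> {1..N}\<close> xI by simp
    ultimately show ?thesis using \<open>I \<subseteq> {1..N}\<close> by (intro hull_inc) auto
  next
    case False
    then obtain i where i: "i \<in> {1..N}" "x i \<noteq> 0" "x i \<noteq> 1" by auto
    have "\<exists>j\<in>{1..N}. j \<noteq> i \<and> x j \<noteq> 0 \<and> x j \<noteq> 1"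
    proof (rule ccontr)
      assume "\<not> ?thesis"
      then have "x j \<in> \<int>" if "j \<in> {1..N} - {i}" for j using that by fastforce
      then have "(\<Sum>j\<in>{1..N} - {i}. x j) \<in> \<int>" by (rule Ints_sum)
      moreover have "x i = real k - (\<Sum>j\<in>{1..N} - {i}. x j)"
        using xs i(1) by (simp add: sum.remove[of "{1..N}" i x])
      ultimately have "x i \<in> \<int>" by simp
      then obtain z :: int where "x i = of_int z" by (auto elim: Ints_cases)
      then show False using x01[OF i(1)] i(2,3) by (auto simp: le_less)
    qed
    then obtain j where j: "j \<in> {1..N}" "j \<noteq> i" "x j \<noteq> 0" "x j \<noteq> 1" by blast
    have step: "\<exists>y. y \<in> face N (\<lambda>_. 0) k \<and> ?F y \<subset> ?F x \<and> (\<exists>\<epsilon>>0. y = x(p := x p + \<epsilon>, q := x q - \<epsilon>))"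
      if p: "p \<in> {1..N}" "p \<in> ?F x" and q: "q \<in> {1..N}" "q \<in> ?F x" and pq: "p \<noteq> q" for p q
    proof -
      define \<epsilon> where "\<epsilon> = min (1 - x p) (x q)"
      have pos: "\<epsilon> > 0" using x01[OF p(1)] x01[OF q(1)] p q by (auto simp: \<epsilon>_def)
      define y where "y = x(p := x p + \<epsilon>, q := x q - \<epsilon>)"
      have "\<epsilon> \<le> 1 - x p" "\<epsilon> \<le> x q" by (auto simp: \<epsilon>_def)
      then have y01: "0 \<le> y m \<and> y m \<le> 1" if "m \<in> {1..N}" for m
        using x01[OF that] x01[OF p(1)] x01[OF q(1)] pos pq by (auto simp: y_def)
      have "y m = x m + (if m = p then \<epsilon> else 0) - (if m = q then \<epsilon> else 0)" for m
        using pq by (auto simp: y_def)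
      then have "(\<Sum>m=1..N. y m) = real k"
        using xs p(1) q(1) by (simp add: sum.distrib sum_subtractf)
      then have "y \<in> face N (\<lambda>_. 0) k" using y01 by (simp add: face_def)
      moreover have "?F y \<subseteq> ?F x" using p q by (auto simp: y_def split: if_splits)
      moreover have "y p = 1 \<or> y q = 0" using pq by (auto simp: y_def \<epsilon>_def min_def)
      then have "?F y \<noteq> ?F x" using p q by blast
      ultimately show ?thesis using pos y_def by blast
    qed
    obtain y \<epsilon> where y: "y \<in> face N (\<lambda>_. 0) k" "?F y \<subset> ?F x" "\<epsilon> > 0" "y = x(i := x i + \<epsilon>, j := x j - \<epsilon>)"
      using step[of i j] i j by blast
    obtain z \<delta> where z: "z \<in> face N (\<lambda>_. 0) k" "?F z \<subset> ?F x" "\<delta> > 0" "z = x(j := x j + \<delta>, i := x i - \<delta>)"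
      using step[of j i] i j by blast
    have "finite (?F x)" by simp
    then have yz: "(\<Sum>j=1..N. y j *\<^sub>R u j) \<in> ?H" "(\<Sum>j=1..N. z j *\<^sub>R u j) \<in> ?H"
      using less.hyps[OF psubset_card_mono[OF _ y(2)] y(1)] less.hyps[OF psubset_card_mono[OF _ z(2)] z(1)]
      by auto
    \<comment> \<open>The weight at which the displacements \<open>\<epsilon>\<close> and
      \<open>\<delta>\<close> cancel.\<close>
    define lam where "lam = \<delta> / (\<delta> + \<epsilon>)"
    have lamf: "0 \<le> lam" "0 \<le> 1 - lam" "lam * \<epsilon> = (1 - lam) * \<delta>"
      using y(3) z(3) by (simp_all add: lam_def field_simps)
    have "x m = lam * y m + (1 - lam) * z m" for m
    proof -
      have *: "c = lam * (c + \<epsilon>) + (1 - lam) * (c - \<delta>)" "c = lam * (c - \<epsilon>) + (1 - lam) * (c + \<delta>)" for c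
        using lamf(3) by (simp_all add: algebra_simps)
      show ?thesis using *(1)[of "x i"] *(2)[of "x j"] j(2) unfolding y(4) z(4)
        by (auto simp: algebra_simps)
    qed
    then have "(\<Sum>j=1..N. x j *\<^sub>R u j) = (\<Sum>j=1..N. (lam * y j + (1 - lam) * z j) *\<^sub>R u j)" by simp
    also have "\<dots> = lam *\<^sub>R (\<Sum>j=1..N. y j *\<^sub>R u j) + (1 - lam) *\<^sub>R (\<Sum>j=1..N. z j *\<^sub>R u j)"
      unfolding scaleR_right.sum sum.distrib[symmetric] by (rule sum.cong) (simp_all add: scaleR_left_distrib)
    also have "\<dots> \<in> ?H"
      using convexD[OF convex_convex_hull yz lamf(1,2)] by simp
    finally show ?thesis .
  qed
qed

lemma hull_eq_slice:
  fixes u :: "nat \<Rightarrow> 'v::real_vector"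
  shows "convex hull {(\<Sum>j\<in>I. u j) | I. I \<subseteq> {1..N} \<and> card I = k} =
    (\<lambda>x. \<Sum>j=1..N. x j *\<^sub>R u j) ` face N (\<lambda>_. 0) k"
proof (intro antisym hull_minimal subsetI)
  fix w assume "w \<in> {(\<Sum>j\<in>I. u j) | I. I \<subseteq> {1..N} \<and> card I = k}"
  then obtain I where "w = (\<Sum>j\<in>I. u j)" "top_set N (\<lambda>_. 0) I" "card I = k"
    by (auto simp: top_set_def)
  then show "w \<in> (\<lambda>x. \<Sum>j=1..N. x j *\<^sub>R u j) ` face N (\<lambda>_. 0) k"
    using sum_indicator_scaleR[of I N u] indicator_in_face[of N "\<lambda>_. 0" I k]
    by (intro image_eqI[of _ _ "\<lambda>j. if j \<in> I then 1 else 0"]) (simp_all add: top_set_def)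
next
  show "convex ((\<lambda>x. \<Sum>j=1..N. x j *\<^sub>R u j) ` face N (\<lambda>_. 0) k)"
  proof (rule convexI)
    fix p q and s t :: real
    assume "p \<in> (\<lambda>x. \<Sum>j=1..N. x j *\<^sub>R u j) ` face N (\<lambda>_. 0) k"
      "q \<in> (\<lambda>x. \<Sum>j=1..N. x j *\<^sub>R u j) ` face N (\<lambda>_. 0) k"
      and st: "0 \<le> s" "0 \<le> t" "s + t = 1"
    then obtain x y where x: "x \<in> face N (\<lambda>_. 0) k" "p = (\<Sum>j=1..N. x j *\<^sub>R u j)"
      and y: "y \<in> face N (\<lambda>_. 0) k" "q = (\<Sum>j=1..N. y j *\<^sub>R u j)" by blast
    have s: "s = 1 - t" "t \<le> 1" using st by auto
    have "s *\<^sub>R p + t *\<^sub>R q = (\<Sum>j=1..N. ((1 - t) * x j + t * y j) *\<^sub>R u j)"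
      unfolding x(2) y(2) s(1) scaleR_right.sum sum.distrib[symmetric]
      by (rule sum.cong) (simp_all add: scaleR_left_distrib)
    then show "s *\<^sub>R p + t *\<^sub>R q \<in> (\<lambda>x. \<Sum>j=1..N. x j *\<^sub>R u j) ` face N (\<lambda>_. 0) k"
      using face_convex[OF x(1) y(1) st(2) s(2)] by (rule image_eqI)
  qed
next
  fix w assume "w \<in> (\<lambda>x. \<Sum>j=1..N. x j *\<^sub>R u j) ` face N (\<lambda>_. 0) k"
  then show "w \<in> convex hull {(\<Sum>j\<in>I. u j) | I. I \<subseteq> {1..N} \<and> card I = k}"
    using slice_point_in_hull by blast
qed

text \<open>A strict gap after rank \<open>card I\<close> makes the face a point: a coordinate in
  \<open>I\<close> different from 1 would force all coordinates outside \<open>I\<close> to vanish,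
  and those in \<open>I\<close> could not add up to \<open>card I\<close>.\<close>

lemma face_strict:
  assumes I: "I \<subseteq> {1..N}" "\<And>i j. i \<in> I \<Longrightarrow> j \<in> {1..N} - I \<Longrightarrow> h j < h i" and x: "x \<in> face N h (card I)"
    and j: "j \<in> {1..N}"
  shows "x j = (if j \<in> I then 1 else 0)"
proof -
  have fin: "finite I" using I finite_subset by blast
  have x01: "\<And>j. j \<in> {1..N} \<Longrightarrow> 0 \<le> x j \<and> x j \<le> 1" and xs: "(\<Sum>j=1..N. x j) = real (card I)"
    and slack: "\<And>i j. i \<in> {1..N} \<Longrightarrow> j \<in> {1..N} \<Longrightarrow> h j < h i \<Longrightarrow> x i = 1 \<or> x j = 0"
    using x by (auto simp: face_def)
  have split: "(\<Sum>j=1..N. x j) = (\<Sum>j\<in>{1..N} - I. x j) + (\<Sum>j\<in>I. x j)"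
    using I(1) by (simp add: sum.subset_diff)
  have xI: "x i = 1" if "i \<in> I" for i
  proof (rule ccontr)
    assume ne: "x i \<noteq> 1"
    have "x j = 0" if "j \<in> {1..N} - I" for j
      using slack[of i j] I \<open>i \<in> I\<close> that ne by blast
    then have "real (card I) = (\<Sum>j\<in>I. x j)" using split xs by simp
    moreover have "(\<Sum>j\<in>I. x j) < (\<Sum>j\<in>I. 1)"
      using fin \<open>i \<in> I\<close> x01 I(1) ne by (intro sum_strict_mono_ex1) (force intro: le_neq_trans)+
    ultimately show False by simp
  qed
  then have "(\<Sum>j\<in>{1..N} - I. x j) = 0" using split xs by simp
  then have "x j = 0" if "j \<in> {1..N} - I" for j
    using that x01 by (subst (asm) sum_nonneg_eq_0_iff) auto
  then show ?thesis using xI j by auto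
qed

text \<open>Counting: a coordinate above the class that is not 1 would force all coordinates with
  \<open>h \<le> \<tau>\<close> to vanish, leaving a sum of at most \<open>e\<close>. A coordinate
  below the class that is not 0 would force all those with \<open>h \<ge> \<tau>\<close> to be 1,
  making the sum too large.\<close>

lemma face_window:
  fixes k e :: nat
  assumes x: "x \<in> face N h k" and e: "e = card {j \<in> {1..N}. h j > \<tau>}"
    and k: "e < k" "k < e + card {j \<in> {1..N}. h j = \<tau>}" and j: "j \<in> {1..N}"
  shows "h j > \<tau> \<Longrightarrow> x j = 1" and "h j < \<tau> \<Longrightarrow> x j = 0"
proof -
  have x01: "\<And>j. j \<in> {1..N} \<Longrightarrow> 0 \<le> x j \<and> x j \<le> 1" and xs: "(\<Sum>j=1..N. x j) = real k"
    and slack: "\<And>i j. i \<in> {1..N} \<Longrightarrow> j \<in> {1..N} \<Longrightarrow> h j < h i \<Longrightarrow> x i = 1 \<or> x j = 0"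
    using x by (auto simp: face_def)
  show "x j = 1" if hj: "h j > \<tau>"
  proof (rule ccontr)
    assume ne: "x j \<noteq> 1"
    have "x m = 0" if "m \<in> {1..N} - {j \<in> {1..N}. h j > \<tau>}" for m
      using slack[OF j, of m] that hj ne by auto
    then have "(\<Sum>j=1..N. x j) = (\<Sum>m\<in>{j \<in> {1..N}. h j > \<tau>}. x m)"
      by (intro sum.mono_neutral_right) auto
    also have "\<dots> \<le> (\<Sum>m\<in>{j \<in> {1..N}. h j > \<tau>}. 1)" using x01 by (intro sum_mono) auto
    finally show False using xs e k by simp
  qed
  show "x j = 0" if hj: "h j < \<tau>"
  proof (rule ccontr)
    assume ne: "x j \<noteq> 0"
    have "{j \<in> {1..N}. h j \<ge> \<tau>} = {j \<in> {1..N}. h j > \<tau>} \<union> {j \<in> {1..N}. h j = \<tau>}" by auto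
    then have c: "card {j \<in> {1..N}. h j \<ge> \<tau>} = e + card {j \<in> {1..N}. h j = \<tau>}"
      unfolding e by (simp add: card_Un_disjoint disjoint_iff)
    have "x m = 1" if "m \<in> {j \<in> {1..N}. h j \<ge> \<tau>}" for m
      using slack[OF _ j, of m] that hj ne by auto
    then have "real (card {j \<in> {1..N}. h j \<ge> \<tau>}) = (\<Sum>m\<in>{j \<in> {1..N}. h j \<ge> \<tau>}. x m)" by simp
    also have "\<dots> \<le> (\<Sum>j=1..N. x j)" using x01 by (intro sum_mono2) auto
    finally show False using xs c k by simp
  qed
qed

lemma window_sum:
  fixes x h :: "nat \<Rightarrow> real" and u :: "nat \<Rightarrow> 'v::real_vector"
  assumes "\<And>j. j \<in> {1..N} \<Longrightarrow> h j > \<tau> \<Longrightarrow> x j = 1" "\<And>j. j \<in> {1..N} \<Longrightarrow> h j < \<tau> \<Longrightarrow> x j = 0"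
  shows "(\<Sum>j=1..N. x j *\<^sub>R u j) = (\<Sum>j | j \<in> {1..N} \<and> h j > \<tau>. u j) + (\<Sum>j | j \<in> {1..N} \<and> h j = \<tau>. x j *\<^sub>R u j)"
proof -
  have "(\<Sum>j=1..N. x j *\<^sub>R u j) = (\<Sum>j\<in>{j. j \<in> {1..N} \<and> h j > \<tau>} \<union> {j. j \<in> {1..N} \<and> h j = \<tau>}. x j *\<^sub>R u j)"
  proof (rule sum.mono_neutral_right)
    show "\<forall>j\<in>{1..N} - ({j. j \<in> {1..N} \<and> h j > \<tau>} \<union> {j. j \<in> {1..N} \<and> h j = \<tau>}). x j *\<^sub>R u j = 0"
    proof
      fix j assume "j \<in> {1..N} - ({j. j \<in> {1..N} \<and> h j > \<tau>} \<union> {j. j \<in> {1..N} \<and> h j = \<tau>})"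
      then have "j \<in> {1..N}" "h j < \<tau>" by auto
      then show "x j *\<^sub>R u j = 0" using assms(2) by simp
    qed
  qed auto
  also have "\<dots> = (\<Sum>j | j \<in> {1..N} \<and> h j > \<tau>. x j *\<^sub>R u j) + (\<Sum>j | j \<in> {1..N} \<and> h j = \<tau>. x j *\<^sub>R u j)"
    by (rule sum.union_disjoint) auto
  also have "(\<Sum>j | j \<in> {1..N} \<and> h j > \<tau>. x j *\<^sub>R u j) = (\<Sum>j | j \<in> {1..N} \<and> h j > \<tau>. u j)"
    using assms(1) by (intro sum.cong) auto
  finally show ?thesis .
qed

text \<open>\<open>S\<close> and \<open>insert i S\<close> have equal values and opposite signs; the
  value 0 at the empty set lets it take part in the pairing.\<close>

lemma alternating_sum_toggle:
  fixes f :: "nat set \<Rightarrow> real"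
  assumes "i < n" "\<And>S. S \<subseteq> {..<n} - {i} \<Longrightarrow> f (insert i S) = f S" "f {} = 0"
  shows "(\<Sum>S\<in>Pow {..<n} - {{}}. (-1) ^ (n - card S) * f S) = 0"
proof -
  let ?g = "\<lambda>S. (-1) ^ (n - card S) * f S"
  have Pow_n: "Pow {..<n} = Pow ({..<n} - {i}) \<union> insert i ` Pow ({..<n} - {i})"
    using Pow_insert[of i "{..<n} - {i}"] lessThan_insert[OF assms(1)] by simp
  have "(\<Sum>S\<in>Pow {..<n} - {{}}. ?g S) = (\<Sum>S\<in>Pow {..<n}. ?g S)"
    using assms(3) by (intro sum.mono_neutral_left) auto
  also have "\<dots> = (\<Sum>S\<in>Pow ({..<n} - {i}) \<union> insert i ` Pow ({..<n} - {i}). ?g S)"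
    by (subst Pow_n) (rule refl)
  also have "\<dots> = (\<Sum>S\<in>Pow ({..<n} - {i}). ?g S) + (\<Sum>S\<in>insert i ` Pow ({..<n} - {i}). ?g S)"
    by (rule sum.union_disjoint) auto
  also have "(\<Sum>S\<in>insert i ` Pow ({..<n} - {i}). ?g S) = (\<Sum>S\<in>Pow ({..<n} - {i}). ?g (insert i S))"
    by (subst sum.reindex) (auto simp: inj_on_def)
  also have "\<dots> = (\<Sum>S\<in>Pow ({..<n} - {i}). - ?g S)"
  proof (rule sum.cong[OF refl])
    fix S assume S: "S \<in> Pow ({..<n} - {i})"
    then have fin: "finite S" "i \<notin> S" using finite_subset by auto
    have "card (insert i S) \<le> card {..<n}" using S assms(1) by (intro card_mono) auto
    then have "n - card S = Suc (n - card (insert i S))" using fin by simp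
    then show "?g (insert i S) = - ?g S" using assms(2) S by simp
  qed
  finally show ?thesis by (simp add: sum_negf)
qed

lemma cell_hyperplane_measure:
  assumes "i < n" "\<eta> i \<noteq> 0" "\<And>w. w \<in> cell n N b h \<kappa> S \<Longrightarrow> dot n \<eta> w = c"
  shows "measure (leb n) (cell n N b h \<kappa> S) = 0"
proof -
  have "cell n N b h \<kappa> S \<subseteq> {x \<in> space (leb n). dot n \<eta> x = c}"
    using assms(3) by (auto simp: cell_def space_PiM)
  then have "cell n N b h \<kappa> S \<in> null_sets (leb n)"
    by (rule null_sets_subset[OF hyperplane_null[where \<eta> = \<eta>, OF assms(1,2)] fmeasurableD[OF cell_fmeasurable]])
  then show ?thesis by (simp add: measure_def null_setsD1)
qed

text \<open>The empty sum is the origin, a null set in positive dimension.\<close>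

lemma cell_empty_measure:
  assumes "n \<ge> 1"
  shows "measure (leb n) (cell n N b h \<kappa> {}) = 0"
  by (rule cell_hyperplane_measure[of 0 _ "\<lambda>i. if i = 0 then 1 else 0" _ _ _ _ _ 0])
    (use assms in \<open>auto simp: cell_def mix_def dot_def\<close>)

lemma translation_measure_eq:
  assumes "A \<in> sets (leb n)" "B \<subseteq> space (leb n)"
    "\<And>x. x \<in> space (leb n) \<Longrightarrow> x \<in> B \<longleftrightarrow> (\<lambda>i\<in>{..<n}. x i + t i) \<in> A"
  shows "measure (leb n) B = measure (leb n) A"
proof -
  have "B = {x \<in> space (leb n). (\<lambda>i\<in>{..<n}. x i + t i) \<in> A}" using assms(2,3) by blast
  then show ?thesis using translation_measure[OF assms(1), of t] by simp
qed

text \<open>By \<open>face_strict\<close> the additional summand is a single point, so it only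
  translates the cell.\<close>

lemma cell_toggle_strict:
  assumes I: "I \<subseteq> {1..N}" "\<And>i j. i \<in> I \<Longrightarrow> j \<in> {1..N} - I \<Longrightarrow> h j < h i"
    and m: "\<kappa> m = card I" "m \<notin> S" "finite S"
  shows "measure (leb n) (cell n N b h \<kappa> (insert m S)) = measure (leb n) (cell n N b h \<kappa> S)"
proof (rule translation_measure_eq[OF fmeasurableD[OF cell_fmeasurable]])
  let ?t = "\<lambda>i. - (\<Sum>j\<in>I. b j i)"
  let ?one = "\<lambda>j. if j \<in> I then 1 else (0::real)"
  show "cell n N b h \<kappa> (insert m S) \<subseteq> space (leb n)" by (auto simp: cell_def space_PiM)
  have one: "?one \<in> face N h (\<kappa> m)"
    unfolding m(1) using I by (intro indicator_in_face) (auto simp: top_set_def less_imp_le)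
  have oneb: "(\<Sum>j=1..N. x j * b j i) = (\<Sum>j\<in>I. b j i)" if "x \<in> face N h (\<kappa> m)" for x :: "nat \<Rightarrow> real" and i
  proof -
    have "(\<Sum>j=1..N. x j * b j i) = (\<Sum>j=1..N. ?one j * b j i)"
      using face_strict[where x = x and h = h, OF I] that m(1) by (intro sum.cong) auto
    then show ?thesis using pairing_indicator[where h = "\<lambda>j. b j i", OF I(1)] by (simp add: pairing_def mult.commute)
  qed
  have mixi: "mix N b (insert m S) X i = (\<Sum>j=1..N. X m j * b j i) + mix N b S X i" for X i
    using m by (simp add: mix_def)
  fix x assume x: "x \<in> space (leb n)"
  show "x \<in> cell n N b h \<kappa> (insert m S) \<longleftrightarrow> (\<lambda>i\<in>{..<n}. x i + ?t i) \<in> cell n N b h \<kappa> S"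
  proof
    assume "x \<in> cell n N b h \<kappa> (insert m S)"
    then obtain X where X: "\<And>k. k \<in> insert m S \<Longrightarrow> X k \<in> face N h (\<kappa> k)"
      "\<And>i. i < n \<Longrightarrow> x i = mix N b (insert m S) X i" by (rule cellE) blast
    show "(\<lambda>i\<in>{..<n}. x i + ?t i) \<in> cell n N b h \<kappa> S"
      by (rule cellI[where X = X]) (use X mixi oneb[OF X(1)[of m]] in auto)
  next
    assume "(\<lambda>i\<in>{..<n}. x i + ?t i) \<in> cell n N b h \<kappa> S"
    then obtain X where X: "\<And>k. k \<in> S \<Longrightarrow> X k \<in> face N h (\<kappa> k)"
      "\<And>i. i < n \<Longrightarrow> (\<lambda>i\<in>{..<n}. x i + ?t i) i = mix N b S X i" by (rule cellE) blast
    let ?X = "X(m := ?one)"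
    have "mix N b S ?X i = mix N b S X i" for i
      unfolding mix_def using m by (intro sum.cong) auto
    then have "mix N b (insert m S) ?X i = (\<Sum>j\<in>I. b j i) + mix N b S X i" for i
      using mixi[of ?X i] oneb[OF one, of i] by simp
    then have mx: "x i = mix N b (insert m S) ?X i" if "i < n" for i
      using X(2)[OF that] that by simp
    show "x \<in> cell n N b h \<kappa> (insert m S)"
      by (rule cellI[where X = ?X]) (use X x mx one in \<open>auto simp: space_PiM\<close>)
  qed
qed

text \<open>The vertices of a standard simplex in R^n: unit vectors for the indices up to
  \<open>n\<close> and the origin for \<open>n + 1\<close>. Combining with them amounts to dropping
  the last coordinate of a hypersimplex point.\<close>

definition unit_coords :: "nat \<Rightarrow> nat \<Rightarrow> real"
  where "unit_coords j i = (if j = Suc i then 1 else 0)"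

lemma mix_unit_coords: "i < n \<Longrightarrow> mix (Suc n) unit_coords S Y i = (\<Sum>k\<in>S. Y k (Suc i))"
  by (auto simp: mix_def unit_coords_def if_distrib[of "\<lambda>c. _ * c"] cong: if_cong intro!: sum.cong)

text \<open>In the coordinates of \<open>E_frame\<close> a point with coordinate sum zero is given
  by its first \<open>n\<close> entries, and centering the hypersimplices is a translation.\<close>

lemma E_volume_hypersimplices:
  assumes "finite S"
  shows "E_volume n (\<Sum>k\<in>S. centered_hypersimplex n (\<kappa> k)) =
    measure (leb n) (cell n (Suc n) unit_coords (\<lambda>_. 0) \<kappa> S)"
proof -
  have len: "length (E_frame n) = n" by (simp add: E_frame_def)
  let ?K = "\<Sum>k\<in>S. centered_hypersimplex n (\<kappa> k)"
  let ?t = "\<lambda>i::nat. \<Sum>k\<in>S. real (\<kappa> k) / real (n + 1)"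
  have ev: "(\<Sum>k\<in>S. f k) j = (\<Sum>k\<in>S. f k j)" for f :: "nat \<Rightarrow> nat \<Rightarrow> real" and j
    by (induction S rule: infinite_finite_induct) auto
  have sum_shift: "(\<Sum>j=1..n+1. g j) = (\<Sum>i<n. g (Suc i)) + g (n + 1)" for g :: "nat \<Rightarrow> real"
    by (simp add: sum.shift_bounds_cl_Suc_ivl atLeast0AtMost lessThan_Suc_atMost[symmetric] One_nat_def
        flip: atLeastLessThanSuc_atLeastAtMost sum.shift_bounds_Suc_ivl atLeast0LessThan)
  have "measure (leb n) (frame_set (E_frame n) ?K) = measure (leb n) (cell n (Suc n) unit_coords (\<lambda>_. 0) \<kappa> S)"
  proof (rule translation_measure_eq[OF fmeasurableD[OF cell_fmeasurable]])
    show "frame_set (E_frame n) ?K \<subseteq> space (leb n)" by (auto simp: frame_set_def len)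
    fix x assume x: "x \<in> space (leb n)"
    show "x \<in> frame_set (E_frame n) ?K \<longleftrightarrow>
        (\<lambda>i\<in>{..<n}. x i + ?t i) \<in> cell n (Suc n) unit_coords (\<lambda>_. 0) \<kappa> S"
    proof
      assume "x \<in> frame_set (E_frame n) ?K"
      then have "lincomb (E_frame n) x \<in> ?K" by (simp add: frame_set_def)
      then obtain y where y: "lincomb (E_frame n) x = (\<Sum>k\<in>S. y k)" "\<And>k. k \<in> S \<Longrightarrow> y k \<in> centered_hypersimplex n (\<kappa> k)"
        unfolding set_sum_alt[OF assms] by blast
      define Y where "Y k = (\<lambda>j. y k j + real (\<kappa> k) / real (n + 1))" for k
      have Y: "Y k \<in> face (Suc n) (\<lambda>_. 0) (\<kappa> k)" if kS: "k \<in> S" for k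
      proof -
        obtain z where z: "\<forall>j\<in>{1..n+1}. 0 \<le> z j \<and> z j \<le> 1" "(\<Sum>j=1..n+1. z j) = real (\<kappa> k)"
          "y k = (\<lambda>j. if j \<in> {1..n+1} then z j - real (\<kappa> k) / real (n + 1) else 0)"
          using y(2)[OF kS] unfolding centered_hypersimplex_def by blast
        have "Y k j = z j" if "j \<in> {1..n+1}" for j using that by (simp add: Y_def z(3))
        then have "\<forall>j\<in>{1..n+1}. 0 \<le> Y k j \<and> Y k j \<le> 1" "(\<Sum>j=1..n+1. Y k j) = real (\<kappa> k)"
          using z(1,2) by (simp_all del: sum.cl_ivl_Suc)
        then show ?thesis unfolding face_def Suc_eq_plus1 by (simp del: sum.cl_ivl_Suc)
      qed
      have xi: "x i = (\<Sum>k\<in>S. y k (Suc i))" if "i < n" for i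
      proof -
        have "lincomb (E_frame n) x (Suc i) = x i"
          unfolding lincomb_def len E_frame_expand using that by simp
        then show ?thesis using y(1) ev by metis
      qed
      show "(\<lambda>i\<in>{..<n}. x i + ?t i) \<in> cell n (Suc n) unit_coords (\<lambda>_. 0) \<kappa> S"
        by (rule cellI[where X = Y]) (use Y in \<open>auto simp: mix_unit_coords xi Y_def sum.distrib\<close>)
    next
      assume "(\<lambda>i\<in>{..<n}. x i + ?t i) \<in> cell n (Suc n) unit_coords (\<lambda>_. 0) \<kappa> S"
      then obtain Y where Y: "\<And>k. k \<in> S \<Longrightarrow> Y k \<in> face (Suc n) (\<lambda>_. 0) (\<kappa> k)"
        "\<And>i. i < n \<Longrightarrow> (\<lambda>i\<in>{..<n}. x i + ?t i) i = mix (Suc n) unit_coords S Y i" by (rule cellE) blast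
      have xi: "x i = (\<Sum>k\<in>S. Y k (Suc i) - real (\<kappa> k) / real (n + 1))" if "i < n" for i
        using Y(2)[OF that] that by (simp add: mix_unit_coords sum_subtractf)
      define y where "y k = (\<lambda>j. if j \<in> {1..n+1} then Y k j - real (\<kappa> k) / real (n + 1) else 0)" for k
      have yD: "y k \<in> centered_hypersimplex n (\<kappa> k)" if "k \<in> S" for k
      proof -
        let ?z = "\<lambda>j. if j \<in> {1..n+1} then Y k j else 0"
        have "?z \<in> {x \<in> coord_space {1..n+1}. (\<forall>j\<in>{1..n+1}. 0 \<le> x j \<and> x j \<le> 1) \<and> (\<Sum>j=1..n+1. x j) = real (\<kappa> k)}"
          using Y(1)[OF that] unfolding face_def Suc_eq_plus1 coord_space_def
          by (simp del: sum.cl_ivl_Suc)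
        moreover have "y k = (\<lambda>j. if j \<in> {1..n+1} then ?z j - real (\<kappa> k) / real (n + 1) else 0)"
          by (auto simp: y_def fun_eq_iff)
        ultimately show ?thesis unfolding centered_hypersimplex_def by (intro image_eqI)
      qed
      have ysum: "(\<Sum>j=1..n+1. y k j) = 0" if "k \<in> S" for k
      proof -
        have "(\<Sum>j=1..n+1. y k j) = (\<Sum>j=1..n+1. Y k j - real (\<kappa> k) / real (n + 1))"
          by (rule sum.cong) (auto simp: y_def)
        then show ?thesis using Y(1)[OF that] unfolding face_def Suc_eq_plus1
          by (simp add: sum_subtractf del: sum.cl_ivl_Suc)
      qed
      have "lincomb (E_frame n) x = (\<Sum>k\<in>S. y k)"
      proof
        fix j
        \<comment> \<open>The frame coordinates fix the first \<open>n\<close> entries only; the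
          last one agrees because every \<open>y k\<close> sums to zero.\<close>
        have last: "(\<Sum>k\<in>S. y k (n + 1)) = - (\<Sum>i<n. x i)"
        proof -
          have "y k (n + 1) = - (\<Sum>i<n. y k (Suc i))" if "k \<in> S" for k
            using ysum[OF that] sum_shift[of "y k"] by simp
          then have "(\<Sum>k\<in>S. y k (n + 1)) = - (\<Sum>k\<in>S. \<Sum>i<n. y k (Suc i))" by (simp add: sum_negf)
          also have "(\<Sum>k\<in>S. \<Sum>i<n. y k (Suc i)) = (\<Sum>i<n. \<Sum>k\<in>S. y k (Suc i))" by (rule sum.swap)
          also have "\<dots> = (\<Sum>i<n. x i)" by (intro sum.cong) (auto simp: xi y_def)
          finally show ?thesis .
        qed
        consider i where "j = Suc i" "i < n" | "j = n + 1" | "j \<notin> {1..n+1}"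
          by (cases j) (auto, metis le_eq_less_or_eq)
        then show "lincomb (E_frame n) x j = (\<Sum>k\<in>S. y k) j"
          unfolding lincomb_def len E_frame_expand ev
        proof cases
          case 1
          then show "(if j \<in> {1..n} then x (j - 1) else if j = n + 1 then - (\<Sum>i<n. x i) else 0) = (\<Sum>k\<in>S. y k j)"
            by (simp add: xi y_def)
        next
          case 2
          then show "(if j \<in> {1..n} then x (j - 1) else if j = n + 1 then - (\<Sum>i<n. x i) else 0) = (\<Sum>k\<in>S. y k j)"
            using last by simp
        next
          case 3
          then show "(if j \<in> {1..n} then x (j - 1) else if j = n + 1 then - (\<Sum>i<n. x i) else 0) = (\<Sum>k\<in>S. y k j)"
            by (auto simp: y_def)
        qed
      qed
      then have "lincomb (E_frame n) x \<in> ?K" unfolding set_sum_alt[OF assms] using yD by blast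
      then show "x \<in> frame_set (E_frame n) ?K" using x by (simp add: frame_set_def len)
    qed
  qed
  then show ?thesis by (simp add: E_volume_def frame_volume_frame_set len)
qed

subsection \<open>Coordinates of a flat arrangement\<close>

lemma span_image_sum:
  fixes a :: "nat \<Rightarrow> 'v::real_vector"
  assumes "finite I" "u \<in> span (a ` I)"
  shows "\<exists>z. u = (\<Sum>j\<in>I. z j *\<^sub>R a j)"
proof -
  let ?S = "range (\<lambda>z. \<Sum>j\<in>I. z j *\<^sub>R a j)"
  have "span (a ` I) \<subseteq> ?S"
  proof (rule span_minimal)
    show "a ` I \<subseteq> ?S"
    proof
      fix w assume "w \<in> a ` I"
      then obtain i where i: "i \<in> I" "w = a i" by blast
      have "(\<Sum>j\<in>I. (if j = i then 1 else 0) *\<^sub>R a j) = a i"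
        using i assms(1) by (simp add: if_distrib[of "\<lambda>c. c *\<^sub>R _"] cong: if_cong)
      then show "w \<in> ?S" unfolding i(2) by (intro range_eqI[of _ _ "\<lambda>j. if j = i then 1 else 0"]) (rule sym)
    qed
    show "subspace ?S"
    proof (rule subspaceI)
      show "0 \<in> ?S" by (rule range_eqI[of _ _ "\<lambda>_. 0"]) simp
      show "x + y \<in> ?S" if "x \<in> ?S" "y \<in> ?S" for x y
      proof -
        obtain z z' where "x = (\<Sum>j\<in>I. z j *\<^sub>R a j)" "y = (\<Sum>j\<in>I. z' j *\<^sub>R a j)"
          using \<open>x \<in> ?S\<close> \<open>y \<in> ?S\<close> by blast
        then show ?thesis
          by (intro range_eqI[of _ _ "\<lambda>j. z j + z' j"]) (simp add: scaleR_left_distrib sum.distrib)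
      qed
      show "c *\<^sub>R x \<in> ?S" if "x \<in> ?S" for c x
      proof -
        obtain z where "x = (\<Sum>j\<in>I. z j *\<^sub>R a j)" using \<open>x \<in> ?S\<close> by blast
        then show ?thesis by (intro range_eqI[of _ _ "\<lambda>j. c * z j"]) (simp add: scaleR_right.sum)
      qed
    qed
  qed
  then show ?thesis using assms(2) by blast
qed

text \<open>A labeled family may repeat vectors, so injectivity is a claim of its own: two equal
  vectors would give a relation with coefficients 1 and -1.\<close>

lemma family_independent:
  fixes a :: "nat \<Rightarrow> 'v::real_vector"
  assumes fin: "finite C" and ind: "\<And>z j. (\<Sum>j\<in>C. z j *\<^sub>R a j) = 0 \<Longrightarrow> j \<in> C \<Longrightarrow> z j = 0"
  shows "inj_on a C \<and> independent (a ` C)"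
proof
  show inj: "inj_on a C"
  proof (rule inj_onI, rule ccontr)
    fix i j assume ij: "i \<in> C" "j \<in> C" "a i = a j" "i \<noteq> j"
    let ?z = "\<lambda>m. (if m = i then 1 else 0) - (if m = j then 1 else (0::real))"
    have "(\<Sum>m\<in>C. ?z m *\<^sub>R a m) = (\<Sum>m\<in>C. (if m = i then a i else 0) - (if m = j then a j else 0))"
      by (rule sum.cong) (auto simp: scaleR_left_diff_distrib)
    also have "\<dots> = 0" using ij fin by (simp add: sum_subtractf)
    finally have "?z i = 0" using ij(1) by (rule ind)
    then show False using ij by simp
  qed
  show "independent (a ` C)"
  proof
    assume "dependent (a ` C)"
    then obtain u w where u: "(\<Sum>z\<in>a ` C. u z *\<^sub>R z) = 0" and w: "w \<in> a ` C" "u w \<noteq> 0"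
      using fin by (auto simp: dependent_finite)
    then have "(\<Sum>j\<in>C. u (a j) *\<^sub>R a j) = 0" by (simp add: sum.reindex[OF inj])
    then have "u (a j) = 0" if "j \<in> C" for j using that by (rule ind)
    then show False using w by auto
  qed
qed

text \<open>\<open>v\<close> spans a complement of the kernel, since
  \<open>x - \<phi> x *\<^sub>R v\<close> lies in the kernel; so a basis of the kernel together with
  \<open>v\<close> is a basis of the whole space.\<close>

lemma functional_level_space:
  fixes \<phi> :: "'v::real_vector \<Rightarrow> real"
  assumes dimV: "dim (UNIV :: 'v set) = Suc n" and lin: "linear \<phi>" and v: "\<phi> v = 1"
  shows "\<exists>ws. basis_list {w. \<phi> w = 0} ws"
    and "basis_list {w. \<phi> w = 0} ws \<Longrightarrow> length ws = n"
proof -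
  let ?W = "{w. \<phi> w = 0}"
  have sub: "subspace ?W" using lin by (auto simp: subspace_def linear_0 linear_add linear_scale)
  obtain T :: "'v set" where T: "independent T" "UNIV \<subseteq> span T" "card T = dim (UNIV :: 'v set)"
    by (rule basis_exists[of UNIV])
  then have finT: "finite T" using dimV card_gt_0_iff[of T] by simp
  obtain B where B: "B \<subseteq> ?W" "independent B" "?W \<subseteq> span B" by (rule basis_exists[of ?W])
  have "B \<subseteq> span T" using T by blast
  then have finB: "finite B" using independent_span_bound[OF finT B(2)] by blast
  obtain bs where bs: "set bs = B" "distinct bs" using finite_distinct_list[OF finB] by blast
  have "span B = ?W" using B span_minimal[OF B(1) sub] by blast
  then show "\<exists>ws. basis_list ?W ws" using bs B by (auto simp: basis_list_def)
  assume ws: "basis_list ?W ws"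
  then have d: "distinct ws" "independent (set ws)" "span (set ws) = ?W" by (auto simp: basis_list_def)
  have vn: "v \<notin> span (set ws)" using d(3) v by simp
  then have "independent (insert v (set ws))" using d(2) by (simp add: independent_insert)
  moreover have "UNIV \<subseteq> span (insert v (set ws))"
  proof
    fix x
    have "x - \<phi> x *\<^sub>R v \<in> span (set ws)" using d(3) v lin by (simp add: linear_diff linear_scale)
    then show "x \<in> span (insert v (set ws))" by (auto simp: span_insert)
  qed
  ultimately have "dim (UNIV :: 'v set) = card (insert v (set ws))"
    by (intro dim_unique[OF _ _ _ refl]) auto
  moreover have "v \<notin> set ws" using vn span_base by blast
  ultimately show "length ws = n" using dimV distinct_card[OF d(1)] by simp
qed

text \<open>\<open>ws\<close> is an arbitrary frame here; the main proof takes the basis list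
  selected by \<open>density_volume\<close>.\<close>

locale flat_setup =
  fixes a :: "nat \<Rightarrow> 'v::real_vector" and \<omega> :: "'v list \<Rightarrow> real" and \<phi> :: "'v \<Rightarrow> real" and v :: 'v
    and \<rho> :: "nat \<Rightarrow> real" and n N :: nat and ws :: "'v list"
  assumes dimV: "dim (UNIV :: 'v set) = Suc n" and n_pos: "n \<ge> 1"
    and form: "alternating_form (Suc n) \<omega>" and flat: "flat_arrangement N a \<phi>" and \<phi>_v: "\<phi> v = 1"
    and generic: "circuit_generic N a \<rho>"
    and ws: "frame {w. \<phi> w = 0} ws" and length_ws: "length ws = n"
begin

lemma linear_\<phi>: "linear \<phi>" and \<phi>_a: "j \<in> {1..N} \<Longrightarrow> \<phi> (a j) = 1"
  and span_a: "span (a ` {1..N}) = UNIV"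
  using flat by (auto simp: flat_arrangement_def)

lemma independent_card:
  fixes S :: "'v set"
  assumes "independent S"
  shows "finite S" "card S \<le> Suc n"
proof -
  obtain T :: "'v set" where T: "independent T" "UNIV \<subseteq> span T" "card T = dim (UNIV :: 'v set)"
    by (rule basis_exists[of UNIV])
  then have "finite T" using dimV card_gt_0_iff[of T] by simp
  moreover have "S \<subseteq> span T" using T by blast
  ultimately show "finite S" "card S \<le> Suc n"
    using independent_span_bound[of T S] assms T(3) dimV by auto
qed

lemma independent_spans:
  fixes S :: "'v set"
  assumes "independent S" "card S = Suc n"
  shows "span S = UNIV"
proof (rule ccontr)
  assume "span S \<noteq> UNIV"
  then obtain x where x: "x \<notin> span S" by blast
  then have "independent (insert x S)" using assms(1) by (simp add: independent_insert)
  then have "card (insert x S) \<le> Suc n" by (rule independent_card)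
  moreover have "x \<notin> S" using x span_base by blast
  ultimately show False using independent_card(1)[OF assms(1)] assms(2) by simp
qed

definition b :: "nat \<Rightarrow> nat \<Rightarrow> real"
  where "b j = (SOME x. lincomb ws x = a j - v)"

lemma lincomb_b:
  assumes "j \<in> {1..N}"
  shows "lincomb ws (b j) = a j - v"
proof -
  have "a j - v \<in> {w. \<phi> w = 0}" using \<phi>_a[OF assms] \<phi>_v linear_\<phi> by (simp add: linear_diff)
  then have "\<exists>x. lincomb ws x = a j - v" using ws by (auto simp: frame_def)
  then show ?thesis unfolding b_def by (rule someI_ex)
qed

lemma \<phi>_sum: "I \<subseteq> {1..N} \<Longrightarrow> \<phi> (\<Sum>j\<in>I. z j *\<^sub>R a j) = (\<Sum>j\<in>I. z j)"
  using \<phi>_a by (auto simp: linear_sum[OF linear_\<phi>] linear_scale[OF linear_\<phi>] subset_iff intro!: sum.cong)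

lemma lincomb_sum_b:
  assumes "I \<subseteq> {1..N}"
  shows "lincomb ws (\<lambda>i. \<Sum>j\<in>I. z j * b j i) = (\<Sum>j\<in>I. z j *\<^sub>R (a j - v))"
  unfolding lincomb_sum lincomb_scale using assms lincomb_b by (intro sum.cong) auto

lemma sum_b_coords:
  assumes I: "I \<subseteq> {1..N}" and eq: "(\<Sum>j\<in>I. z j *\<^sub>R a j) = lincomb ws x" and i: "i < n"
  shows "(\<Sum>j\<in>I. z j) = 0" "(\<Sum>j\<in>I. z j * b j i) = x i"
proof -
  have "lincomb ws x \<in> {w. \<phi> w = 0}" using ws unfolding frame_def by blast
  then show z0: "(\<Sum>j\<in>I. z j) = 0" using \<phi>_sum[OF I, of z] unfolding eq by simp
  have "(\<Sum>j\<in>I. z j *\<^sub>R (a j - v)) = (\<Sum>j\<in>I. z j *\<^sub>R a j) - (\<Sum>j\<in>I. z j) *\<^sub>R v"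
    by (simp add: scaleR_right_diff_distrib sum_subtractf scaleR_left.sum)
  then have "lincomb ws (\<lambda>i. \<Sum>j\<in>I. z j * b j i) = lincomb ws x"
    using lincomb_sum_b[OF I] eq z0 by simp
  from frame_unique[OF ws this] show "(\<Sum>j\<in>I. z j * b j i) = x i" using i length_ws by simp
qed

lemma dot_sum_b: "(\<Sum>j\<in>I. z j * dot n \<eta> (b j)) = dot n \<eta> (\<lambda>i. \<Sum>j\<in>I. z j * b j i)"
proof -
  have "(\<Sum>j\<in>I. z j * dot n \<eta> (b j)) = (\<Sum>j\<in>I. \<Sum>i<n. \<eta> i * (z j * b j i))"
    by (simp add: dot_def sum_distrib_left mult_ac)
  also have "\<dots> = (\<Sum>i<n. \<Sum>j\<in>I. \<eta> i * (z j * b j i))" by (rule sum.swap)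
  finally show ?thesis by (simp add: dot_def sum_distrib_left)
qed

text \<open>The frame vector \<open>ws ! k\<close> is a combination of the \<open>a j\<close> with
  coefficients of sum zero. Hence \<open>\<eta> k\<close> is the same combination of the numbers
  \<open>dot n \<eta> (b j)\<close>, which is zero if these agree.\<close>

lemma separating_family:
  assumes I: "I \<subseteq> {1..N}" "span (a ` I) = UNIV"
    and const: "\<And>i j. i \<in> I \<Longrightarrow> j \<in> I \<Longrightarrow> dot n \<eta> (b i) = dot n \<eta> (b j)" and k: "k < n"
  shows "\<eta> k = 0"
proof -
  have "finite I" using I(1) finite_subset by blast
  then obtain z where "lincomb ws (\<lambda>i. if i = k then 1 else 0) = (\<Sum>j\<in>I. z j *\<^sub>R a j)"
    using span_image_sum[of I _ a] I(2) by blast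
  note z = sum_b_coords[OF I(1) this[symmetric]]
  have "\<eta> k = dot n \<eta> (\<lambda>i. \<Sum>j\<in>I. z j * b j i)"
    using z(2) k by (simp add: dot_def if_distrib[of "\<lambda>c. _ * c"] cong: if_cong)
  also have "\<dots> = (\<Sum>j\<in>I. z j * dot n \<eta> (b j))" by (rule dot_sum_b[symmetric])
  also have "\<dots> = 0"
  proof (cases "I = {}")
    case False
    then obtain i0 where i0: "i0 \<in> I" by blast
    have "(\<Sum>j\<in>I. z j * dot n \<eta> (b j)) = (\<Sum>j\<in>I. z j * dot n \<eta> (b i0))"
      by (intro sum.cong refl arg_cong2[of _ _ _ _ "(*)"] const i0)
    also have "\<dots> = (\<Sum>j\<in>I. z j) * dot n \<eta> (b i0)" by (rule sum_distrib_right[symmetric])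
    also have "\<dots> = 0" unfolding z(1)[OF k] by simp
    finally show ?thesis .
  qed simp
  finally show ?thesis .
qed

sublocale tilted n N b \<rho>
proof
  fix \<eta> :: "nat \<Rightarrow> real" and i
  assume "\<And>i j. i \<in> {1..N} \<Longrightarrow> j \<in> {1..N} \<Longrightarrow> dot n \<eta> (b i) = dot n \<eta> (b j)" "i < n"
  then show "\<eta> i = 0" using separating_family[OF subset_refl span_a, of \<eta>] by blast
qed

text \<open>Applying \<phi> to the relation shows that its coefficients sum to zero. It is then also
  a relation among the \<open>b j\<close>, so the dual part of the tilt pairs to zero with
  it.\<close>

lemma kernel_pairing:
  assumes "z \<in> arr_kernel N a"
  shows "(\<Sum>j=1..N. z j) = 0" "pairing N (tilt \<psi>) z = pairing N \<rho> z"
proof -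
  have "(\<Sum>j=1..N. z j *\<^sub>R a j) = lincomb ws (\<lambda>_. 0)"
    using assms by (simp add: arr_kernel_def arr_map_def lincomb_def)
  note z = sum_b_coords[OF subset_refl this]
  show "(\<Sum>j=1..N. z j) = 0" using z(1)[of 0] n_pos by simp
  have "dot n \<psi> (\<lambda>i. \<Sum>j=1..N. z j * b j i) = 0" using z(2) by (simp add: dot_def)
  then show "pairing N (tilt \<psi>) z = pairing N \<rho> z" by (simp add: pairing_tilt dot_sum_b)
qed

text \<open>A relation inside a tie class yields a circuit there; its pairing with \<rho> equals
  that with the tilt, which is \<open>\<tau>\<close> times a vanishing coordinate sum, against
  genericity.\<close>

lemma tie_class_free:
  assumes C: "C \<subseteq> {1..N}" "\<And>j. j \<in> C \<Longrightarrow> tilt \<psi> j = \<tau>"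
    and z: "(\<Sum>j\<in>C. z j *\<^sub>R a j) = 0" and j: "j \<in> C"
  shows "z j = 0"
proof (rule ccontr)
  assume nz: "z j \<noteq> 0"
  let ?Q = "\<lambda>y. y \<in> arr_kernel N a \<and> y \<noteq> 0 \<and> supp y \<subseteq> C"
  define z' where "z' i = (if i \<in> C then z i else 0)" for i
  have "(\<Sum>i=1..N. z' i *\<^sub>R a i) = (\<Sum>i\<in>C. z' i *\<^sub>R a i)"
    using C(1) by (intro sum.mono_neutral_right) (auto simp: z'_def)
  also have "\<dots> = 0" using z by (simp add: z'_def)
  finally have "?Q z'" using C(1) nz j
    by (auto simp: arr_kernel_def arr_map_def coord_space_def supp_def z'_def fun_eq_iff)
  \<comment> \<open>A nonzero kernel vector in \<open>C\<close> with smallest support is a circuit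
    vector.\<close>
  then obtain y where y: "?Q y" "\<And>y'. ?Q y' \<Longrightarrow> card (supp y) \<le> card (supp y')"
    using ex_has_least_nat[of ?Q z' "\<lambda>y. card (supp y)"] by blast
  have fin: "finite (supp y)" using y(1) C(1) finite_subset[of "supp y" "{1..N}"] by blast
  have "circuit_vector N a y"
    unfolding circuit_vector_def
  proof (intro conjI ballI impI)
    fix y' assume y': "y' \<in> arr_kernel N a" "y' \<noteq> 0 \<and> supp y' \<subseteq> supp y"
    then have "card (supp y) \<le> card (supp y')" using y(1) by (intro y(2)) blast
    then show "supp y' = supp y" using y' fin by (intro card_seteq) auto
  qed (use y(1) in auto)
  then have "pairing N \<rho> y \<noteq> 0" using generic by (simp add: circuit_generic_def)
  moreover have "pairing N (tilt \<psi>) y = \<tau> * (\<Sum>i=1..N. y i)"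
  proof -
    have "pairing N (tilt \<psi>) y = (\<Sum>i=1..N. \<tau> * y i)"
      unfolding pairing_def
    proof (rule sum.cong[OF refl])
      fix i show "tilt \<psi> i * y i = \<tau> * y i"
        using y(1) C(2)[of i] by (cases "i \<in> C") (auto simp: supp_def)
    qed
    then show ?thesis by (simp only: sum_distrib_left)
  qed
  ultimately show False using kernel_pairing(1)[of y] kernel_pairing(2)[of y \<psi>] y(1) by simp
qed

lemma tie_class_independent:
  assumes C: "C \<subseteq> {1..N}" "\<And>j. j \<in> C \<Longrightarrow> tilt \<psi> j = \<tau>"
  shows "inj_on a C" "independent (a ` C)" "card C \<le> Suc n"
proof -
  have "finite C" using C(1) finite_subset by blast
  then have "inj_on a C \<and> independent (a ` C)"
    by (rule family_independent) (rule tie_class_free[OF C])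
  then show "inj_on a C" "independent (a ` C)" by auto
  then show "card C \<le> Suc n" using independent_card(2)[of "a ` C"] card_image by metis
qed

section \<open>Bases, their coordinates and fundamental circuits\<close>

lemma arr_map_coord_space: "B \<subseteq> {1..N} \<Longrightarrow> x \<in> coord_space B \<Longrightarrow> arr_map N a x = (\<Sum>j\<in>B. x j *\<^sub>R a j)"
  unfolding arr_map_def by (intro sum.mono_neutral_right) (auto simp: coord_space_def)

lemma tie_class_basis:
  assumes C: "C \<subseteq> {1..N}" "\<And>j. j \<in> C \<Longrightarrow> tilt \<psi> j = \<tau>" and card: "card C = Suc n"
  shows "C \<in> arr_bases N a"
proof -
  note ind = tie_class_independent[OF C]
  have finC: "finite C" using C(1) finite_subset by blast
  have "span (a ` C) = UNIV" using independent_spans[OF ind(2)] card_image[OF ind(1)] card by simp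
  have "bij_betw (arr_map N a) (coord_space C) UNIV"
    unfolding bij_betw_def
  proof
    show "inj_on (arr_map N a) (coord_space C)"
    proof (rule inj_onI)
      fix x y assume xy: "x \<in> coord_space C" "y \<in> coord_space C" "arr_map N a x = arr_map N a y"
      then have "(\<Sum>j\<in>C. (x j - y j) *\<^sub>R a j) = 0"
        by (simp add: arr_map_coord_space[OF C(1)] scaleR_left_diff_distrib sum_subtractf)
      then have "x j - y j = 0" if "j \<in> C" for j
        using tie_class_free[of C \<psi> \<tau> "\<lambda>j. x j - y j" j] C that by blast
      then have "x j = y j" for j using xy(1,2) by (cases "j \<in> C") (auto simp: coord_space_def)
      then show "x = y" ..
    qed
    show "arr_map N a ` coord_space C = UNIV"
    proof (intro antisym subsetI UNIV_I)
      fix u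
      obtain z where z: "u = (\<Sum>j\<in>C. z j *\<^sub>R a j)"
        using span_image_sum[OF finC, of u a] \<open>span (a ` C) = UNIV\<close> by blast
      let ?z = "\<lambda>j. if j \<in> C then z j else 0"
      have "?z \<in> coord_space C" by (simp add: coord_space_def)
      moreover from this have "arr_map N a ?z = u" using arr_map_coord_space[OF C(1)] z by simp
      ultimately show "u \<in> arr_map N a ` coord_space C" by blast
    qed
  qed
  then show ?thesis using C(1) card dimV by (simp add: arr_bases_def)
qed

lemma basesD:
  assumes "B \<in> arr_bases N a"
  shows "B \<subseteq> {1..N}" "card B = Suc n" "finite B" "bij_betw (arr_map N a) (coord_space B) UNIV"
    "span (a ` B) = UNIV"
proof -
  show B: "B \<subseteq> {1..N}" "card B = Suc n" "bij_betw (arr_map N a) (coord_space B) UNIV"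
    using assms dimV by (auto simp: arr_bases_def)
  show "finite B" using B(1) finite_subset by blast
  have "u \<in> span (a ` B)" for u
  proof -
    have "u \<in> arr_map N a ` coord_space B" using B(3) by (simp add: bij_betw_def)
    then obtain x where x: "x \<in> coord_space B" "u = arr_map N a x" by blast
    show ?thesis unfolding x(2) arr_map_coord_space[OF B(1) x(1)]
      by (intro span_sum span_scale span_base) auto
  qed
  then show "span (a ` B) = UNIV" by blast
qed

definition bcoord :: "nat set \<Rightarrow> 'v \<Rightarrow> nat \<Rightarrow> real"
  where "bcoord B u = inv_into (coord_space B) (arr_map N a) u"

lemma bcoord:
  assumes "B \<in> arr_bases N a"
  shows "bcoord B u \<in> coord_space B" "(\<Sum>j\<in>B. bcoord B u j *\<^sub>R a j) = u"
proof -
  have "u \<in> arr_map N a ` coord_space B" using basesD(4)[OF assms] by (simp add: bij_betw_def)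
  then show 1: "bcoord B u \<in> coord_space B" and "(\<Sum>j\<in>B. bcoord B u j *\<^sub>R a j) = u"
    using inv_into_into[of u "arr_map N a" "coord_space B"] f_inv_into_f[of u "arr_map N a" "coord_space B"]
      arr_map_coord_space[OF basesD(1)[OF assms]]
    by (simp_all add: bcoord_def)
qed

lemma bcoord_unique:
  assumes B: "B \<in> arr_bases N a" and eq: "(\<Sum>j\<in>B. x j *\<^sub>R a j) = (\<Sum>j\<in>B. y j *\<^sub>R a j)" and j: "j \<in> B"
  shows "x j = y j"
proof -
  let ?r = "\<lambda>x j. if j \<in> B then x j else (0::real)"
  have r: "?r x \<in> coord_space B" "arr_map N a (?r x) = (\<Sum>j\<in>B. x j *\<^sub>R a j)" for x
  proof -
    show 1: "?r x \<in> coord_space B" by (simp add: coord_space_def)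
    show "arr_map N a (?r x) = (\<Sum>j\<in>B. x j *\<^sub>R a j)"
      using arr_map_coord_space[OF basesD(1)[OF B] 1] by simp
  qed
  have "?r x = ?r y"
    using basesD(4)[OF B] r eq by (intro inj_onD[of "arr_map N a" "coord_space B"]) (auto simp: bij_betw_def)
  then have "?r x j = ?r y j" by (rule fun_cong)
  then show ?thesis using j by simp
qed

text \<open>Stated for a general \<open>g\<close> to serve both the vector sum and the
  pairing.\<close>

lemma sum_fund_circuit:
  fixes g :: "real \<Rightarrow> nat \<Rightarrow> 'c::ab_group_add"
  assumes B: "B \<in> arr_bases N a" and j: "j \<in> {1..N} - B" and g: "\<And>k. g 0 k = 0"
  shows "(\<Sum>k=1..N. g (fund_circuit N a B j k) k) = g 1 j + (\<Sum>k\<in>B. g (- bcoord B (a j) k) k)"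
proof -
  note Bs = basesD(1-3)[OF B]
  let ?z = "fund_circuit N a B j"
  have "(\<Sum>k=1..N. g (?z k) k) = (\<Sum>k\<in>insert j B. g (?z k) k)"
    using j Bs(1) g by (intro sum.mono_neutral_right) (auto simp: fund_circuit_def)
  also have "\<dots> = g (?z j) j + (\<Sum>k\<in>B. g (?z k) k)" using j Bs(3) by simp
  also have "(\<Sum>k\<in>B. g (?z k) k) = (\<Sum>k\<in>B. g (- bcoord B (a j) k) k)"
    using j by (intro sum.cong) (auto simp: fund_circuit_def bcoord_def)
  finally show ?thesis by (simp add: fund_circuit_def)
qed

lemma fund_circuit_kernel:
  assumes B: "B \<in> arr_bases N a" and j: "j \<in> {1..N} - B"
  shows "fund_circuit N a B j \<in> arr_kernel N a"
    and "pairing N h (fund_circuit N a B j) = h j - (\<Sum>k\<in>B. h k * bcoord B (a j) k)"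
proof -
  note Bs = basesD(1-3)[OF B]
  let ?z = "fund_circuit N a B j"
  have "arr_map N a ?z = a j + (\<Sum>k\<in>B. (- bcoord B (a j) k) *\<^sub>R a k)"
    unfolding arr_map_def using sum_fund_circuit[OF B j, of "\<lambda>c k. c *\<^sub>R a k"] by simp
  also have "\<dots> = 0" using bcoord(2)[OF B, of "a j"] by (simp add: sum_negf)
  finally show "?z \<in> arr_kernel N a"
    using j Bs(1) by (auto simp: arr_kernel_def coord_space_def fund_circuit_def)
  show "pairing N h ?z = h j - (\<Sum>k\<in>B. h k * bcoord B (a j) k)"
    unfolding pairing_def using sum_fund_circuit[OF B j, of "\<lambda>c k. h k * c"] by (simp add: sum_negf)
qed

text \<open>The coordinates of \<open>a j\<close> in the basis sum to one, by \<phi>, so the tied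
  values contribute exactly \<open>\<tau>\<close>.\<close>

lemma pairing_fund_circuit:
  assumes B: "B \<in> arr_bases N a" and j: "j \<in> {1..N} - B" and tie: "\<And>k. k \<in> B \<Longrightarrow> tilt \<psi> k = \<tau>"
  shows "pairing N \<rho> (fund_circuit N a B j) = tilt \<psi> j - \<tau>"
proof -
  note fc = fund_circuit_kernel[OF B j]
  have "pairing N \<rho> (fund_circuit N a B j) = tilt \<psi> j - (\<Sum>k\<in>B. tilt \<psi> k * bcoord B (a j) k)"
    using kernel_pairing(2)[OF fc(1), of \<psi>] fc(2) by simp
  also have "(\<Sum>k\<in>B. tilt \<psi> k * bcoord B (a j) k) = \<tau> * (\<Sum>k\<in>B. bcoord B (a j) k)"
    using tie by (simp add: sum_distrib_left)
  also have "(\<Sum>k\<in>B. bcoord B (a j) k) = 1"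
    using \<phi>_sum[OF basesD(1)[OF B], of "bcoord B (a j)"] bcoord(2)[OF B, of "a j"] \<phi>_a j by simp
  finally show ?thesis by simp
qed

text \<open>The sign of a fundamental circuit tells on which side of the class its index
  lies.\<close>

lemma ext_eq:
  assumes B: "B \<in> arr_bases N a" and tie: "\<And>k. k \<in> B \<Longrightarrow> tilt \<psi> k = \<tau>"
  shows "ext N a \<rho> B = card {j \<in> {1..N}. tilt \<psi> j > \<tau>}"
proof -
  have "{j \<in> {1..N} - B. pairing N \<rho> (fund_circuit N a B j) > 0} = {j \<in> {1..N}. tilt \<psi> j > \<tau>}"
    using pairing_fund_circuit[OF B _ tie] tie by force
  then show ?thesis by (simp add: ext_def)
qed

lemma tie_class_eq_basis:
  assumes B: "B \<in> arr_bases N a" and tie: "\<And>k. k \<in> B \<Longrightarrow> tilt \<psi> k = \<tau>"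
  shows "{j \<in> {1..N}. tilt \<psi> j = \<tau>} = B"
proof -
  let ?C = "{j \<in> {1..N}. tilt \<psi> j = \<tau>}"
  have "card ?C \<le> Suc n" by (rule tie_class_independent(3)[of _ \<psi> \<tau>]) auto
  then show ?thesis using basesD[OF B] tie by (intro card_seteq[symmetric]) auto
qed

text \<open>\<open>R\<close> is the linear functional with value \<open>\<rho> k\<close> at
  \<open>a k\<close> for \<open>k\<close> in \<open>B\<close>, and \<open>\<psi>\<close> lists its
  values on the frame of the kernel. Since \<open>R (a j - v) = \<rho> j - R v\<close>, every tilted
  value on \<open>B\<close> equals \<open>R v\<close>.\<close>

lemma basis_vertex:
  assumes B: "B \<in> arr_bases N a"
  shows "\<exists>\<psi>\<in>verts. \<exists>\<tau>. \<forall>k\<in>B. tilt \<psi> k = \<tau>"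
proof -
  define R where "R u = (\<Sum>k\<in>B. bcoord B u k * \<rho> k)" for u
  define \<psi> where "\<psi> i = (if i < n then R (ws ! i) else 0)" for i
  have R_lin: "R (\<Sum>i<n. x i *\<^sub>R ws ! i) = (\<Sum>i<n. x i * R (ws ! i))" for x
  proof -
    have "(\<Sum>k\<in>B. (\<Sum>i<n. x i * bcoord B (ws ! i) k) *\<^sub>R a k) = (\<Sum>i<n. x i *\<^sub>R ws ! i)"
    proof -
      have "(\<Sum>k\<in>B. (\<Sum>i<n. x i * bcoord B (ws ! i) k) *\<^sub>R a k) = (\<Sum>k\<in>B. \<Sum>i<n. x i *\<^sub>R bcoord B (ws ! i) k *\<^sub>R a k)"
        by (simp add: scaleR_left.sum)
      also have "\<dots> = (\<Sum>i<n. \<Sum>k\<in>B. x i *\<^sub>R bcoord B (ws ! i) k *\<^sub>R a k)" by (rule sum.swap)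
      also have "\<dots> = (\<Sum>i<n. x i *\<^sub>R ws ! i)"
        unfolding scaleR_right.sum[symmetric] bcoord(2)[OF B] ..
      finally show ?thesis .
    qed
    then have "bcoord B (\<Sum>i<n. x i *\<^sub>R ws ! i) k = (\<Sum>i<n. x i * bcoord B (ws ! i) k)" if "k \<in> B" for k
      using bcoord(2)[OF B, of "\<Sum>i<n. x i *\<^sub>R ws ! i"] that by (intro bcoord_unique[OF B]) auto
    then have "R (\<Sum>i<n. x i *\<^sub>R ws ! i) = (\<Sum>k\<in>B. \<Sum>i<n. x i * bcoord B (ws ! i) k * \<rho> k)"
      by (simp add: R_def sum_distrib_right)
    also have "\<dots> = (\<Sum>i<n. \<Sum>k\<in>B. x i * bcoord B (ws ! i) k * \<rho> k)" by (rule sum.swap)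
    finally show ?thesis by (simp add: R_def sum_distrib_left mult_ac)
  qed
  have tie: "tilt \<psi> j = R v" if j: "j \<in> B" for j
  proof -
    have jN: "j \<in> {1..N}" using basesD(1)[OF B] j by blast
    have "dot n \<psi> (b j) = R (\<Sum>i<n. b j i *\<^sub>R ws ! i)"
      unfolding R_lin by (simp add: dot_def \<psi>_def mult.commute)
    also have "(\<Sum>i<n. b j i *\<^sub>R ws ! i) = a j - v"
      using lincomb_b[OF jN] by (simp add: lincomb_def length_ws)
    also have "R (a j - v) = \<rho> j - R v"
    proof -
      have "(\<Sum>k\<in>B. ((if k = j then 1 else 0) - bcoord B v k) *\<^sub>R a k) =
          (\<Sum>k\<in>B. (if k = j then a j else 0) - bcoord B v k *\<^sub>R a k)"
        by (rule sum.cong) (auto simp: scaleR_left_diff_distrib)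
      also have "\<dots> = a j - v"
        using j basesD(3)[OF B] by (simp add: sum_subtractf bcoord(2)[OF B])
      finally have "(\<Sum>k\<in>B. ((if k = j then 1 else 0) - bcoord B v k) *\<^sub>R a k) = a j - v" .
      then have bc: "bcoord B (a j - v) k = (if k = j then 1 else 0) - bcoord B v k" if "k \<in> B" for k
        using bcoord(2)[OF B, of "a j - v"] that by (intro bcoord_unique[OF B]) auto
      then have "R (a j - v) = (\<Sum>k\<in>B. (if k = j then \<rho> j else 0) - bcoord B v k * \<rho> k)"
        unfolding R_def by (intro sum.cong) (auto simp: bc left_diff_distrib)
      also have "\<dots> = \<rho> j - R v"
        using j basesD(3)[OF B] by (simp add: sum_subtractf R_def)
      finally show ?thesis .
    qed
    finally show ?thesis by (simp add: tilt_def)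
  qed
  have "\<psi> \<in> verts"
    unfolding verts_def
  proof (intro CollectI conjI allI impI)
    show "\<psi> i = 0" if "n \<le> i" for i using that by (simp add: \<psi>_def)
    fix \<eta> i assume \<eta>: "\<forall>(i, j)\<in>ties \<psi>. dot n \<eta> (b i) = dot n \<eta> (b j)" and i: "i < n"
    show "\<eta> i = 0"
    proof (rule separating_family[OF basesD(1,5)[OF B] _ i])
      fix p q assume "p \<in> B" "q \<in> B"
      then have "(p, q) \<in> ties \<psi>" using tie basesD(1)[OF B] by (auto simp: ties_def)
      then show "dot n \<eta> (b p) = dot n \<eta> (b q)" using \<eta> by blast
    qed
  qed
  then show ?thesis using tie by blast
qed

text \<open>Ties along a spanning family determine the dual point, by
  \<open>separating_family\<close> applied to the difference.\<close>

lemma basis_vertex_unique: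
  assumes B: "B \<in> arr_bases N a" and \<psi>: "\<psi> \<in> verts" "\<psi>' \<in> verts"
    and tie: "\<And>k. k \<in> B \<Longrightarrow> tilt \<psi> k = \<tau>" "\<And>k. k \<in> B \<Longrightarrow> tilt \<psi>' k = \<tau>'"
  shows "\<psi> = \<psi>'"
proof
  fix i
  show "\<psi> i = \<psi>' i"
  proof (cases "i < n")
    case True
    have "\<psi> i - \<psi>' i = 0"
    proof (rule separating_family[OF basesD(1,5)[OF B], of "\<lambda>i. \<psi> i - \<psi>' i"])
      fix p q assume "p \<in> B" "q \<in> B"
      then have "tilt \<psi> p = tilt \<psi> q" "tilt \<psi>' p = tilt \<psi>' q" using tie by auto
      then show "dot n (\<lambda>i. \<psi> i - \<psi>' i) (b p) = dot n (\<lambda>i. \<psi> i - \<psi>' i) (b q)"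
        by (simp add: tilt_def dot_diff)
    qed (rule True)
    then show ?thesis by simp
  next
    case False
    then show ?thesis using \<psi> by (simp add: verts_def)
  qed
qed

text \<open>A class that does not span is annihilated by some nonzero functional \<open>g\<close>.
  On the cell the coordinates above and below the class are fixed and those of the class have a
  fixed sum, while all their \<open>b j\<close> take the same value \<open>- g v\<close>; so the
  cell lies in a hyperplane.\<close>

lemma small_class_measure:
  assumes \<tau>: "C = {j \<in> {1..N}. tilt \<psi> j = \<tau>}" "e = card {j \<in> {1..N}. tilt \<psi> j > \<tau>}"
    and \<kappa>: "\<And>k. k \<in> S \<Longrightarrow> e < \<kappa> k \<and> \<kappa> k < e + card C" and C: "C \<noteq> {}" "card C < Suc n"
  shows "measure (leb n) (cell n N b (tilt \<psi>) \<kappa> S) = 0"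
proof -
  have CN: "C \<subseteq> {1..N}" "\<And>j. j \<in> C \<Longrightarrow> tilt \<psi> j = \<tau>" using \<tau>(1) by auto
  note ind = tie_class_independent[OF CN]
  have "span (a ` C) \<noteq> UNIV"
  proof
    assume "span (a ` C) = UNIV"
    then have "dim (UNIV :: 'v set) = card (a ` C)"
      using ind(2) by (intro dim_unique[OF _ _ _ refl]) auto
    then show False using dimV card_image[OF ind(1)] C(2) by simp
  qed
  then obtain x where x: "x \<notin> span (a ` C)" by blast
  then have indx: "independent (insert x (a ` C))" using ind(2) by (simp add: independent_insert)
  obtain g where g: "linear g" "\<forall>y\<in>insert x (a ` C). g y = (if y = x then 1 else (0::real))"
    using linear_independent_extend[OF indx, of "\<lambda>y. if y = x then 1 else 0"] by blast
  have ga: "g (a j) = 0" if "j \<in> C" for j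
    using g(2) that x span_base[of "a j" "a ` C"] by auto
  define \<eta> where "\<eta> i = g (ws ! i)" for i
  have dot_g: "dot n \<eta> y = g (lincomb ws y)" for y
    by (simp add: dot_def \<eta>_def lincomb_def length_ws linear_sum[OF g(1)] linear_scale[OF g(1)] mult.commute)
  have const: "dot n \<eta> (b j) = - g v" if "j \<in> C" for j
    using that CN(1) lincomb_b[of j] ga[OF that] by (auto simp: dot_g linear_diff[OF g(1)])
  \<comment> \<open>Otherwise \<open>g\<close> vanishes on the kernel of \<phi> and, the class being
    nonempty, also at \<open>v\<close>, hence everywhere.\<close>
  have "\<exists>i<n. \<eta> i \<noteq> 0"
  proof (rule ccontr)
    assume "\<not> ?thesis"
    then have d0: "dot n \<eta> y = 0" for y by (simp add: dot_def)
    have gW: "g u = 0" if "\<phi> u = 0" for u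
    proof -
      obtain y where "lincomb ws y = u" using ws \<open>\<phi> u = 0\<close> unfolding frame_def by blast
      then show ?thesis using d0 dot_g by metis
    qed
    obtain j where "j \<in> C" using C(1) by blast
    then have "g v = 0" using const d0 by simp
    have "\<phi> (x - \<phi> x *\<^sub>R v) = 0" using \<phi>_v by (simp add: linear_diff[OF linear_\<phi>] linear_scale[OF linear_\<phi>])
    then have "g (x - \<phi> x *\<^sub>R v) = 0" by (rule gW)
    then have "g x = 0" using \<open>g v = 0\<close> by (simp add: linear_diff[OF g(1)] linear_scale[OF g(1)])
    then show False using g(2) by simp
  qed
  then obtain i where i: "i < n" "\<eta> i \<noteq> 0" by blast
  define \<gamma> where "\<gamma> = (\<Sum>k\<in>S. (\<Sum>j | j \<in> {1..N} \<and> tilt \<psi> j > \<tau>. dot n \<eta> (b j)) + (real (\<kappa> k) - real e) * (- g v))"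
  show ?thesis
  proof (rule cell_hyperplane_measure[of i n \<eta> N b "tilt \<psi>" \<kappa> S \<gamma>])
    fix w assume "w \<in> cell n N b (tilt \<psi>) \<kappa> S"
    then obtain X where X: "\<And>k. k \<in> S \<Longrightarrow> X k \<in> face N (tilt \<psi>) (\<kappa> k)"
      "\<And>i. i < n \<Longrightarrow> w i = mix N b S X i" by (rule cellE) blast
    have "dot n \<eta> w = (\<Sum>k\<in>S. \<Sum>j=1..N. X k j * dot n \<eta> (b j))"
      using dot_cong[of n w "mix N b S X" \<eta>] X(2) dot_mix[of n \<eta> N b S X] by simp
    also have "\<dots> = \<gamma>" unfolding \<gamma>_def
    proof (rule sum.cong[OF refl])
      fix k assume k: "k \<in> S"
      note fw = face_window[OF X(1)[OF k] \<tau>(2)]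
      have fw1: "X k j = 1" if "j \<in> {1..N}" "tilt \<psi> j > \<tau>" for j
        using fw(1)[of j] \<kappa>[OF k] that \<tau>(1) by simp
      have fw0: "X k j = 0" if "j \<in> {1..N}" "tilt \<psi> j < \<tau>" for j
        using fw(2)[of j] \<kappa>[OF k] that \<tau>(1) by simp
      have "(\<Sum>j=1..N. X k j * 1) = real e + (\<Sum>j | j \<in> {1..N} \<and> tilt \<psi> j = \<tau>. X k j)"
        using window_sum[where u = "\<lambda>_. 1::real" and x = "X k", OF fw1 fw0] \<tau>(2) by simp
      then have sumC: "(\<Sum>j | j \<in> {1..N} \<and> tilt \<psi> j = \<tau>. X k j) = real (\<kappa> k) - real e"
        using X(1)[OF k] by (simp add: face_def)
      have "(\<Sum>j=1..N. X k j * dot n \<eta> (b j)) = (\<Sum>j | j \<in> {1..N} \<and> tilt \<psi> j > \<tau>. dot n \<eta> (b j)) +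
          (\<Sum>j | j \<in> {1..N} \<and> tilt \<psi> j = \<tau>. X k j * dot n \<eta> (b j))"
        using window_sum[where u = "\<lambda>j. dot n \<eta> (b j)" and x = "X k", OF fw1 fw0] by simp
      also have "(\<Sum>j | j \<in> {1..N} \<and> tilt \<psi> j = \<tau>. X k j * dot n \<eta> (b j)) =
          (\<Sum>j | j \<in> {1..N} \<and> tilt \<psi> j = \<tau>. X k j * (- g v))"
        using const \<tau>(1) by (intro sum.cong) auto
      also have "\<dots> = (real (\<kappa> k) - real e) * (- g v)"
        by (simp only: sum_distrib_right[symmetric] sumC)
      finally show "(\<Sum>j=1..N. X k j * dot n \<eta> (b j)) = (\<Sum>j | j \<in> {1..N} \<and> tilt \<psi> j > \<tau>. dot n \<eta> (b j)) +
        (real (\<kappa> k) - real e) * (- g v)" .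
    qed
    finally show "dot n \<eta> w = \<gamma>" .
  qed (use i in auto)
qed

end

subsection \<open>Cells of bases\<close>

lemma sum_from_one: "(\<Sum>j=1..m. g j) = (\<Sum>i<m. g (Suc i))" for g :: "nat \<Rightarrow> 'a::comm_monoid_add"
  by (rule sum.reindex_bij_witness[of _ Suc "\<lambda>j. j - 1"]) auto

context flat_setup
begin

lemma lincomb_mix: "lincomb ws (mix N b S X) = (\<Sum>k\<in>S. \<Sum>j=1..N. X k j *\<^sub>R (a j - v))"
proof -
  have "lincomb ws (mix N b S X) = (\<Sum>k\<in>S. lincomb ws (\<lambda>i. \<Sum>j=1..N. X k j * b j i))"
    unfolding lincomb_sum[symmetric] by (rule lincomb_cong) (simp add: mix_def)
  then show ?thesis by (simp add: lincomb_sum_b[OF subset_refl])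
qed

lemma frame_volume_hypersimplices:
  assumes "finite S"
  shows "frame_volume ws (\<Sum>k\<in>S. proj_hypersimplex N a v (\<kappa> k)) = measure (leb n) (cell n N b (\<lambda>_. 0) \<kappa> S)"
proof -
  let ?K = "\<Sum>k\<in>S. proj_hypersimplex N a v (\<kappa> k)"
  have "frame_set ws ?K = cell n N b (\<lambda>_. 0) \<kappa> S"
  proof (intro antisym subsetI)
    fix x assume x: "x \<in> frame_set ws ?K"
    then obtain y where y: "lincomb ws x = (\<Sum>k\<in>S. y k)" "\<And>k. k \<in> S \<Longrightarrow> y k \<in> proj_hypersimplex N a v (\<kappa> k)"
      unfolding frame_set_def set_sum_alt[OF assms] by blast
    have "\<forall>k\<in>S. \<exists>X. X \<in> face N (\<lambda>_. 0) (\<kappa> k) \<and> y k = (\<Sum>j=1..N. X j *\<^sub>R (a j - v))"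
      using y(2) unfolding proj_hypersimplex_def hull_eq_slice by blast
    then obtain X where X: "\<And>k. k \<in> S \<Longrightarrow> X k \<in> face N (\<lambda>_. 0) (\<kappa> k)"
      "\<And>k. k \<in> S \<Longrightarrow> y k = (\<Sum>j=1..N. X k j *\<^sub>R (a j - v))"
      using bchoice[of S "\<lambda>k X. X \<in> face N (\<lambda>_. 0) (\<kappa> k) \<and> y k = (\<Sum>j=1..N. X j *\<^sub>R (a j - v))"] by blast
    have "lincomb ws x = lincomb ws (mix N b S X)" unfolding y(1) lincomb_mix using X(2) by simp
    from frame_unique[OF ws this] have "x i = mix N b S X i" if "i < n" for i using that length_ws by simp
    then show "x \<in> cell n N b (\<lambda>_. 0) \<kappa> S"
      using x X(1) by (intro cellI[where X = X]) (auto simp: frame_set_def space_PiM length_ws)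
  next
    fix x assume "x \<in> cell n N b (\<lambda>_. 0) \<kappa> S"
    then obtain X where X: "x \<in> {..<n} \<rightarrow>\<^sub>E UNIV" "\<And>k. k \<in> S \<Longrightarrow> X k \<in> face N (\<lambda>_. 0) (\<kappa> k)"
      "\<And>i. i < n \<Longrightarrow> x i = mix N b S X i" by (rule cellE) blast
    have "lincomb ws x = lincomb ws (mix N b S X)" using X(3) length_ws by (intro lincomb_cong) simp
    moreover have "(\<Sum>j=1..N. X k j *\<^sub>R (a j - v)) \<in> proj_hypersimplex N a v (\<kappa> k)" if "k \<in> S" for k
      unfolding proj_hypersimplex_def hull_eq_slice using X(2)[OF that] by blast
    ultimately have "lincomb ws x \<in> ?K" unfolding set_sum_alt[OF assms] lincomb_mix by blast
    then show "x \<in> frame_set ws ?K" using X(1) by (simp add: frame_set_def space_PiM length_ws)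
  qed
  then show ?thesis by (simp add: frame_volume_frame_set length_ws)
qed

lemma frame_set_cell:
  "frame_set ws (lincomb ws ` cell n N b h \<kappa> S) = cell n N b h \<kappa> S"
proof (intro antisym subsetI)
  fix x assume x: "x \<in> frame_set ws (lincomb ws ` cell n N b h \<kappa> S)"
  then obtain y where y: "y \<in> cell n N b h \<kappa> S" "lincomb ws x = lincomb ws y" by (auto simp: frame_set_def)
  have "x i = y i" for i
  proof (cases "i < n")
    case True
    then show ?thesis using frame_unique[OF ws y(2)] length_ws by simp
  next
    case False
    then show ?thesis using x y(1) by (auto simp: frame_set_def cell_def space_PiM PiE_def extensional_def length_ws)
  qed
  then have "x = y" ..
  then show "x \<in> cell n N b h \<kappa> S" using y(1) by simp
next
  fix x assume "x \<in> cell n N b h \<kappa> S"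
  then show "x \<in> frame_set ws (lincomb ws ` cell n N b h \<kappa> S)"
    by (auto simp: frame_set_def cell_def space_PiM length_ws)
qed

text \<open>Edge vectors of the simplex on the points of \<open>B\<close>, issuing from its last
  vertex; they are the counterpart of \<open>E_frame\<close>.\<close>

definition basis_frame :: "nat set \<Rightarrow> 'v list"
  where "basis_frame B = map (\<lambda>i. a (sorted_list_of_set B ! i) - a (sorted_list_of_set B ! n)) [0..<n]"

lemma length_basis_frame: "length (basis_frame B) = n"
  by (simp add: basis_frame_def)

lemma lincomb_basis_frame:
  "lincomb (basis_frame B) x = (\<Sum>i<n. x i *\<^sub>R (a (sorted_list_of_set B ! i) - a (sorted_list_of_set B ! n)))"
  by (simp add: lincomb_def basis_frame_def)

lemma bij_sorted_basis:
  assumes "B \<in> arr_bases N a"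
  shows "bij_betw ((!) (sorted_list_of_set B)) {..<Suc n} B"
  using basesD(2,3)[OF assms] by (intro bij_betw_nth) auto

lemma sorted_basis_in:
  assumes "B \<in> arr_bases N a" "i < Suc n"
  shows "sorted_list_of_set B ! i \<in> B" "sorted_list_of_set B ! i \<in> {1..N}"
proof -
  show "sorted_list_of_set B ! i \<in> B"
    using bij_sorted_basis[OF assms(1)] assms(2) by (auto simp: bij_betw_def)
  then show "sorted_list_of_set B ! i \<in> {1..N}" using basesD(1)[OF assms(1)] by blast
qed

lemma sum_basis:
  assumes "B \<in> arr_bases N a"
  shows "(\<Sum>j\<in>B. g j) = (\<Sum>i<n. g (sorted_list_of_set B ! i)) + g (sorted_list_of_set B ! n)"
  using sum.reindex_bij_betw[OF bij_sorted_basis[OF assms], of g] by simp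

definition basis_index :: "nat set \<Rightarrow> nat \<Rightarrow> nat"
  where "basis_index B = the_inv_into {..<Suc n} ((!) (sorted_list_of_set B))"

lemma basis_index:
  assumes "B \<in> arr_bases N a"
  shows "i < Suc n \<Longrightarrow> basis_index B (sorted_list_of_set B ! i) = i"
    and "j \<in> B \<Longrightarrow> basis_index B j < Suc n"
proof -
  note bij = bij_sorted_basis[OF assms]
  show "basis_index B (sorted_list_of_set B ! i) = i" if "i < Suc n"
    unfolding basis_index_def using bij that by (intro the_inv_into_f_f) (auto simp: bij_betw_def)
  show "basis_index B j < Suc n" if "j \<in> B"
    using the_inv_into_into[of "(!) (sorted_list_of_set B)" "{..<Suc n}" j "{..<Suc n}"] bij that
    by (auto simp: basis_index_def bij_betw_def)
qed

text \<open>The prescribed sum eliminates the last coefficient. The reference point \<open>u\<close>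
  is 0 or \<open>v\<close> in the applications.\<close>

lemma sum_basis_frame:
  assumes B: "B \<in> arr_bases N a" and z: "(\<Sum>j\<in>B. z j) = c"
  shows "(\<Sum>j\<in>B. z j *\<^sub>R (a j - u)) =
    lincomb (basis_frame B) (\<lambda>i. z (sorted_list_of_set B ! i)) + c *\<^sub>R (a (sorted_list_of_set B ! n) - u)"
proof -
  let ?q = "\<lambda>i. sorted_list_of_set B ! i"
  have zn: "z (?q n) = c - (\<Sum>i<n. z (?q i))" using z sum_basis[OF B, of z] by simp
  have "(\<Sum>j\<in>B. z j *\<^sub>R (a j - u)) = (\<Sum>i<n. z (?q i) *\<^sub>R (a (?q i) - u)) + z (?q n) *\<^sub>R (a (?q n) - u)"
    by (rule sum_basis[OF B])
  also have "\<dots> = (\<Sum>i<n. z (?q i) *\<^sub>R (a (?q i) - u) - z (?q i) *\<^sub>R (a (?q n) - u)) + c *\<^sub>R (a (?q n) - u)"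
    by (simp add: zn sum_subtractf scaleR_left_diff_distrib scaleR_left.sum)
  also have "(\<Sum>i<n. z (?q i) *\<^sub>R (a (?q i) - u) - z (?q i) *\<^sub>R (a (?q n) - u)) =
      lincomb (basis_frame B) (\<lambda>i. z (?q i))"
    unfolding lincomb_basis_frame by (rule sum.cong) (simp_all add: scaleR_right_diff_distrib)
  finally show ?thesis .
qed

lemma basis_frame:
  assumes B: "B \<in> arr_bases N a"
  shows "frame {w. \<phi> w = 0} (basis_frame B)"
proof -
  let ?q = "\<lambda>i. sorted_list_of_set B ! i"
  note qB = sorted_basis_in(2)[OF B]
  have "lincomb (basis_frame B) x \<in> {w. \<phi> w = 0}" for x
    using \<phi>_a qB
    by (simp add: lincomb_basis_frame linear_sum[OF linear_\<phi>] linear_scale[OF linear_\<phi>] linear_diff[OF linear_\<phi>])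
  moreover have "\<exists>x. lincomb (basis_frame B) x = u" if u: "u \<in> {w. \<phi> w = 0}" for u
  proof -
    have "(\<Sum>j\<in>B. bcoord B u j) = 0" using \<phi>_sum[OF basesD(1)[OF B], of "bcoord B u"] bcoord(2)[OF B, of u] u by simp
    from sum_basis_frame[OF B this, of 0]
    have "lincomb (basis_frame B) (\<lambda>i. bcoord B u (?q i)) = u" using bcoord(2)[OF B, of u] by simp
    then show ?thesis by blast
  qed
  moreover have "x i = 0" if x: "lincomb (basis_frame B) x = 0" and i: "i < n" for x i
  proof -
    define z where "z j = (if basis_index B j < n then x (basis_index B j) else - (\<Sum>i<n. x i))" for j
    have zq: "z (?q i) = x i" if "i < n" for i using basis_index(1)[OF B, of i] that by (simp add: z_def)
    have zn: "z (?q n) = - (\<Sum>i<n. x i)" using basis_index(1)[OF B, of n] by (simp add: z_def)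
    have "(\<Sum>j\<in>B. z j) = 0" using sum_basis[OF B, of z] zq zn by simp
    from sum_basis_frame[OF B this, of 0]
    have "(\<Sum>j\<in>B. z j *\<^sub>R a j) = lincomb (basis_frame B) (\<lambda>i. z (?q i))" by simp
    also have "\<dots> = 0" using x zq lincomb_cong[of "basis_frame B" "\<lambda>i. z (?q i)" x] length_basis_frame by simp
    finally have "(\<Sum>j\<in>B. z j *\<^sub>R a j) = (\<Sum>j\<in>B. (\<lambda>_. 0) j *\<^sub>R a j)" by simp
    moreover have "?q i \<in> B" using i by (intro sorted_basis_in(1)[OF B]) simp
    ultimately have "z (?q i) = 0" using bcoord_unique[OF B, of z "\<lambda>_. 0"] by blast
    then show ?thesis using zq i by simp
  qed
  ultimately show ?thesis unfolding frame_def length_basis_frame by blast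
qed

text \<open>Two rounds of shears: \<open>v\<close> becomes the last basis vector, as their
  difference is a combination of the edges; then adding the last vector turns each edge into the
  basis vector at its other end.\<close>

lemma basis_frame_form:
  assumes B: "B \<in> arr_bases N a"
  shows "\<bar>\<omega> (basis_frame B @ [v])\<bar> = basis_weight \<omega> a B"
proof -
  let ?q = "\<lambda>i. sorted_list_of_set B ! i"
  let ?us = "basis_frame B"
  have "a (?q n) - v \<in> {w. \<phi> w = 0}"
  proof -
    have "?q n \<in> {1..N}" by (rule sorted_basis_in(2)[OF B]) simp
    then show ?thesis using \<phi>_a \<phi>_v by (simp add: linear_diff[OF linear_\<phi>])
  qed
  then obtain c where c: "lincomb ?us c = a (?q n) - v" using basis_frame[OF B] unfolding frame_def by blast
  let ?L = "?us @ [v]"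
  have len: "length ?L = Suc n" by (simp add: length_basis_frame)
  have "(\<Sum>j<n. c j *\<^sub>R ?L ! j) = lincomb ?us c"
    unfolding lincomb_def length_basis_frame by (rule sum.cong) (auto simp: nth_append length_basis_frame)
  then have "?L[n := ?L ! n + (\<Sum>j<n. c j *\<^sub>R ?L ! j)] = ?us @ [a (?q n)]"
    using c by (simp add: nth_append length_basis_frame list_update_append)
  then have 1: "\<omega> (?us @ [a (?q n)]) = \<omega> ?L"
    using alternating_form_add_lincomb[OF form len, of n "{..<n}" c] by fastforce
  \<comment> \<open>The list after \<open>m\<close> shears of the second round.\<close>
  define M where "M m = map (\<lambda>i. if i < m then a (?q i) else a (?q i) - a (?q n)) [0..<n] @ [a (?q n)]" for m
  have "\<omega> (M m) = \<omega> (?us @ [a (?q n)])" if "m \<le> n" for m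
    using that
  proof (induction m)
    case 0
    then show ?case by (simp add: M_def basis_frame_def)
  next
    case (Suc m)
    have lenM: "length (M m) = Suc n" by (simp add: M_def)
    have "(M m)[m := M m ! m + 1 *\<^sub>R M m ! n] = M (Suc m)"
    proof (rule nth_equalityI)
      fix i assume "i < length ((M m)[m := M m ! m + 1 *\<^sub>R M m ! n])"
      then show "(M m)[m := M m ! m + 1 *\<^sub>R M m ! n] ! i = M (Suc m) ! i"
        using Suc.prems by (auto simp: M_def nth_append nth_list_update)
    qed (simp add: M_def)
    moreover have "\<omega> ((M m)[m := M m ! m + 1 *\<^sub>R M m ! n]) = \<omega> (M m)"
      using Suc.prems by (intro alternating_form_shear[OF form lenM]) auto
    ultimately show ?case using Suc by simp
  qed
  from this[of n] have "\<omega> (M n) = \<omega> ?L" using 1 by simp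
  moreover have "M n = map a (sorted_list_of_set B)"
    by (rule nth_equalityI) (auto simp: M_def nth_append basesD(2)[OF B] less_Suc_eq)
  ultimately show ?thesis by (simp add: basis_weight_def)
qed

text \<open>On the cell only the coordinates of the class are free; for summand \<open>k\<close>
  they form a hypersimplex point of level \<open>\<kappa> k - e\<close>. In the frame of edges of
  \<open>B\<close> the cell is thus a translate of the standard one, and the change of frame brings
  in the weight.\<close>

lemma basis_cell_measure:
  assumes B: "B \<in> arr_bases N a" and tie: "\<And>k. k \<in> B \<Longrightarrow> tilt \<psi> k = \<tau>"
    and e: "e = card {j \<in> {1..N}. tilt \<psi> j > \<tau>}"
    and \<kappa>: "\<And>k. k \<in> S \<Longrightarrow> e < \<kappa> k \<and> \<kappa> k < e + Suc n"
  shows "\<bar>\<omega> (ws @ [v])\<bar> * measure (leb n) (cell n N b (tilt \<psi>) \<kappa> S) =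
    basis_weight \<omega> a B * measure (leb n) (cell n (Suc n) unit_coords (\<lambda>_. 0) (\<lambda>k. \<kappa> k - e) S)"
proof -
  let ?q = "\<lambda>i. sorted_list_of_set B ! i"
  let ?us = "basis_frame B"
  let ?U = "{j. j \<in> {1..N} \<and> tilt \<psi> j > \<tau>}"
  let ?c = "\<lambda>k. (\<Sum>j\<in>?U. a j - v) + (real (\<kappa> k) - real e) *\<^sub>R (a (?q n) - v)"
  have C: "{j. j \<in> {1..N} \<and> tilt \<psi> j = \<tau>} = B" using tie_class_eq_basis[OF B tie] .
  have BN: "B \<subseteq> {1..N}" using basesD(1)[OF B] .
  note qB = sorted_basis_in(1)[OF B]
  have qn: "?q n \<in> {1..N}" by (rule sorted_basis_in(2)[OF B]) simp
  have "(\<Sum>k\<in>S. ?c k) \<in> {w. \<phi> w = 0}"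
    using \<phi>_a \<phi>_v qn by (simp add: linear_sum[OF linear_\<phi>] linear_add[OF linear_\<phi>] linear_diff[OF linear_\<phi>] linear_scale[OF linear_\<phi>])
  \<comment> \<open>The fixed part of all summands: indices above the class enter fully, and the
    mass on the class is placed at its last vertex.\<close>
  then obtain t where t: "lincomb ?us t = (\<Sum>k\<in>S. ?c k)" using basis_frame[OF B] unfolding frame_def by blast
  have comb: "(\<Sum>k\<in>S. \<Sum>j=1..N. X k j *\<^sub>R (a j - v)) = lincomb ?us (\<lambda>i. t i + (\<Sum>k\<in>S. X k (?q i)))"
    and sumB: "\<And>k. k \<in> S \<Longrightarrow> (\<Sum>j\<in>B. X k j) = real (\<kappa> k) - real e"
    if X: "\<And>k. k \<in> S \<Longrightarrow> X k \<in> face N (tilt \<psi>) (\<kappa> k)" for X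
  proof -
    have fw: "(\<tau> < tilt \<psi> j \<longrightarrow> X k j = 1) \<and> (tilt \<psi> j < \<tau> \<longrightarrow> X k j = 0)" if "k \<in> S" "j \<in> {1..N}" for k j
      using face_window[OF X[OF that(1)] e, of j] \<kappa>[OF that(1)] that(2) C basesD(2)[OF B] by simp
    have win: "(\<Sum>j=1..N. X k j *\<^sub>R u j) = (\<Sum>j\<in>?U. u j) + (\<Sum>j\<in>B. X k j *\<^sub>R u j)"
      if "k \<in> S" for k and u :: "nat \<Rightarrow> 'w::real_vector"
      using window_sum[of N \<tau> "tilt \<psi>" "X k" u] fw[OF that] C by simp
    show sumB: "(\<Sum>j\<in>B. X k j) = real (\<kappa> k) - real e" if "k \<in> S" for k
      using win[OF that, of "\<lambda>_. 1::real"] X[OF that] e by (simp add: face_def)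
    have "(\<Sum>j=1..N. X k j *\<^sub>R (a j - v)) = ?c k + lincomb ?us (\<lambda>i. X k (?q i))" if "k \<in> S" for k
      unfolding win[OF that] sum_basis_frame[OF B sumB[OF that]] by (simp add: algebra_simps)
    then have "(\<Sum>k\<in>S. \<Sum>j=1..N. X k j *\<^sub>R (a j - v)) = (\<Sum>k\<in>S. ?c k + lincomb ?us (\<lambda>i. X k (?q i)))"
      by (rule sum.cong[OF refl])
    also have "\<dots> = lincomb ?us (\<lambda>i. t i + (\<Sum>k\<in>S. X k (?q i)))"
      by (simp only: sum.distrib t lincomb_add lincomb_sum)
    finally show "(\<Sum>k\<in>S. \<Sum>j=1..N. X k j *\<^sub>R (a j - v)) = lincomb ?us (\<lambda>i. t i + (\<Sum>k\<in>S. X k (?q i)))" .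
  qed
  let ?cell = "cell n N b (tilt \<psi>) \<kappa> S"
  let ?E = "cell n (Suc n) unit_coords (\<lambda>_. 0) (\<lambda>k. \<kappa> k - e) S"
  let ?K = "lincomb ws ` ?cell"
  have "measure (leb n) (frame_set ?us ?K) = measure (leb n) ?E"
  proof (rule translation_measure_eq[OF fmeasurableD[OF cell_fmeasurable], where t = "\<lambda>i. - t i"])
    show "frame_set ?us ?K \<subseteq> space (leb n)" by (auto simp: frame_set_def length_basis_frame)
    fix x assume x: "x \<in> space (leb n)"
    show "x \<in> frame_set ?us ?K \<longleftrightarrow> (\<lambda>i\<in>{..<n}. x i + - t i) \<in> ?E"
    proof
      assume "x \<in> frame_set ?us ?K"
      then obtain w where w: "w \<in> ?cell" "lincomb ?us x = lincomb ws w" by (auto simp: frame_set_def)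
      obtain X where X: "\<And>k. k \<in> S \<Longrightarrow> X k \<in> face N (tilt \<psi>) (\<kappa> k)" "\<And>i. i < n \<Longrightarrow> w i = mix N b S X i"
        using w(1) by (rule cellE) blast
      have "lincomb ws w = lincomb ws (mix N b S X)" using X(2) length_ws by (intro lincomb_cong) simp
      then have "lincomb ?us x = lincomb ?us (\<lambda>i. t i + (\<Sum>k\<in>S. X k (?q i)))"
        using w(2) comb[of X] X(1) by (simp add: lincomb_mix)
      from frame_unique[OF basis_frame[OF B] this]
      have xi: "x i = t i + (\<Sum>k\<in>S. X k (?q i))" if "i < n" for i using that by (simp add: length_basis_frame)
      define Y where "Y k j = X k (?q (j - 1))" for k j
      have "Y k \<in> face (Suc n) (\<lambda>_. 0) (\<kappa> k - e)" if k: "k \<in> S" for k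
      proof -
        have "0 \<le> Y k j \<and> Y k j \<le> 1" if "j \<in> {1..Suc n}" for j
        proof -
          have "?q (j - 1) \<in> {1..N}" using that by (intro sorted_basis_in(2)[OF B]) auto
          then show ?thesis using X(1)[OF k] by (auto simp: face_def Y_def)
        qed
        moreover have "(\<Sum>j=1..Suc n. Y k j) = real (\<kappa> k - e)"
        proof -
          have "(\<Sum>j=1..Suc n. Y k j) = (\<Sum>i<Suc n. X k (?q i))"
            unfolding sum_from_one by (simp add: Y_def)
          also have "\<dots> = (\<Sum>j\<in>B. X k j)" using sum_basis[OF B, of "X k"] by simp
          also have "\<dots> = real (\<kappa> k) - real e" by (rule sumB[OF X(1) k])
          finally show ?thesis using \<kappa>[OF k] by simp
        qed
        ultimately show ?thesis unfolding face_def by blast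
      qed
      then show "(\<lambda>i\<in>{..<n}. x i + - t i) \<in> ?E"
        by (intro cellI[where X = Y]) (auto simp: mix_unit_coords xi Y_def)
    next
      assume "(\<lambda>i\<in>{..<n}. x i + - t i) \<in> ?E"
      then obtain Y where Y: "\<And>k. k \<in> S \<Longrightarrow> Y k \<in> face (Suc n) (\<lambda>_. 0) (\<kappa> k - e)"
        "\<And>i. i < n \<Longrightarrow> (\<lambda>i\<in>{..<n}. x i + - t i) i = mix (Suc n) unit_coords S Y i" by (rule cellE) blast
      \<comment> \<open>The inverse of the passage to \<open>Y\<close>: ones above the class, the
        hypersimplex point on it, zeros below.\<close>
      define X where "X k j = (if tilt \<psi> j > \<tau> then 1 else if j \<in> B then Y k (Suc (basis_index B j)) else 0)" for k j
      have XB: "X k j = Y k (Suc (basis_index B j))" if "j \<in> B" for k j using that tie by (simp add: X_def)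
      have Xq: "X k (?q i) = Y k (Suc i)" if "i < Suc n" for k i
        using XB[OF qB[OF that]] basis_index(1)[OF B that] by simp
      have XF: "X k \<in> face N (tilt \<psi>) (\<kappa> k)" if k: "k \<in> S" for k
      proof -
        have y01: "0 \<le> Y k (Suc i) \<and> Y k (Suc i) \<le> 1" if "i < Suc n" for i
          using Y(1)[OF k] that by (auto simp: face_def)
        have "0 \<le> X k j \<and> X k j \<le> 1" if "j \<in> {1..N}" for j
          using y01[of "basis_index B j"] basis_index(2)[OF B, of j] by (auto simp: X_def)
        moreover have "(\<Sum>j=1..N. X k j) = real (\<kappa> k)"
        proof -
          have "X k j = 1" if "tilt \<psi> j > \<tau>" for j using that by (simp add: X_def)
          moreover have "X k j = 0" if "tilt \<psi> j < \<tau>" for j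
            using that tie[of j] by (auto simp: X_def)
          ultimately have "(\<Sum>j=1..N. X k j *\<^sub>R (1::real)) = (\<Sum>j\<in>?U. 1) + (\<Sum>j\<in>B. X k j *\<^sub>R 1)"
            using window_sum[of N \<tau> "tilt \<psi>" "X k" "\<lambda>_. 1::real"] C by simp
          also have "(\<Sum>j\<in>B. X k j *\<^sub>R (1::real)) = (\<Sum>i<Suc n. Y k (Suc i))"
            using sum_basis[OF B, of "X k"] Xq by simp
          also have "\<dots> = real (\<kappa> k - e)" using Y(1)[OF k] unfolding face_def sum_from_one by simp
          finally show ?thesis using \<kappa>[OF k] e by simp
        qed
        moreover have "X k i = 1 \<or> X k j = 0" if "tilt \<psi> j < tilt \<psi> i" for i j
          using that tie[of j] tie[of i] by (cases "tilt \<psi> i > \<tau>") (auto simp: X_def)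
        ultimately show ?thesis unfolding face_def by blast
      qed
      let ?w = "\<lambda>i\<in>{..<n}. mix N b S X i"
      have "?w \<in> ?cell" using XF by (intro cellI[where X = X]) auto
      moreover have "lincomb ?us x = lincomb ws ?w"
      proof -
        have "lincomb ws ?w = lincomb ws (mix N b S X)" using length_ws by (intro lincomb_cong) simp
        also have "\<dots> = lincomb ?us (\<lambda>i. t i + (\<Sum>k\<in>S. X k (?q i)))"
          unfolding lincomb_mix by (rule comb[OF XF])
        also have "\<dots> = lincomb ?us x"
        proof (rule lincomb_cong)
          fix i assume "i < length ?us"
          then have i: "i < n" by (simp add: length_basis_frame)
          have "x i + - t i = (\<Sum>k\<in>S. Y k (Suc i))" using Y(2)[OF i] i by (simp add: mix_unit_coords)
          then show "t i + (\<Sum>k\<in>S. X k (?q i)) = x i" using Xq[of i] i by simp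
        qed
        finally show ?thesis by simp
      qed
      ultimately show "x \<in> frame_set ?us ?K" using x by (simp add: frame_set_def length_basis_frame)
    qed
  qed
  then have "frame_volume ?us ?K = measure (leb n) ?E" by (simp add: frame_volume_frame_set length_basis_frame)
  moreover have "frame_volume ws ?K = measure (leb n) ?cell"
    by (simp add: frame_volume_frame_set frame_set_cell length_ws)
  moreover have "\<bar>\<omega> (?us @ [v])\<bar> * frame_volume ?us ?K = \<bar>\<omega> (ws @ [v])\<bar> * frame_volume ws ?K"
    using frame_volume_change[OF ws basis_frame[OF B], of "\<lambda>ws. \<omega> (ws @ [v])" ?K]
      alternating_form_append[OF form, of v] fmeasurableD[OF cell_fmeasurable]
    by (simp add: frame_set_cell length_ws length_basis_frame)
  ultimately show ?thesis using basis_frame_form[OF B] by simp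
qed

end

subsection \<open>Polarization\<close>

text \<open>The polarization sum without its factorial, as a linear functional of set functions so
  that it commutes with sums over cells.\<close>

definition alt_sum :: "nat \<Rightarrow> (nat set \<Rightarrow> real) \<Rightarrow> real"
  where "alt_sum n f = (\<Sum>S\<in>Pow {..<n} - {{}}. (-1) ^ (n - card S) * f S)"

lemma alt_sum_cong: "(\<And>S. S \<subseteq> {..<n} \<Longrightarrow> f S = g S) \<Longrightarrow> alt_sum n f = alt_sum n g"
  unfolding alt_sum_def by (rule sum.cong) auto

lemma alt_sum_scale: "alt_sum n (\<lambda>S. c * f S) = c * alt_sum n f"
  by (simp add: alt_sum_def sum_distrib_left mult_ac)

lemma alt_sum_sum: "alt_sum n (\<lambda>S. \<Sum>x\<in>A. f x S) = (\<Sum>x\<in>A. alt_sum n (f x))"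
  unfolding alt_sum_def sum_distrib_left by (rule sum.swap)

context flat_setup
begin

text \<open>The bases whose level class is cut by all of the levels \<open>s, \<dots>, s + l - 1\<close>.\<close>

definition good_bases :: "nat \<Rightarrow> nat \<Rightarrow> nat set set"
  where "good_bases s l = {B \<in> arr_bases N a. ext N a \<rho> B < s \<and> s + l \<le> ext N a \<rho> B + Suc n}"

lemma finite_arr_bases: "finite (arr_bases N a)"
  by (rule finite_subset[of _ "Pow {1..N}"]) (auto simp: arr_bases_def)

lemma good_basis_term:
  assumes \<kappa>: "\<kappa> ` {..<n} = {s..<s + l}" and B: "B \<in> good_bases s l"
    and tie: "\<And>k. k \<in> B \<Longrightarrow> tilt \<psi> k = \<tau>"
  shows "alt_sum n (\<lambda>S. \<bar>\<omega> (ws @ [v])\<bar> * measure (leb n) (cell n N b (tilt \<psi>) \<kappa> S)) =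
    basis_weight \<omega> a B *
      alt_sum n (\<lambda>S. measure (leb n) (cell n (Suc n) unit_coords (\<lambda>_. 0) (\<lambda>k. \<kappa> k - ext N a \<rho> B) S))"
  unfolding alt_sum_scale[symmetric]
proof (rule alt_sum_cong)
  fix S assume S: "S \<subseteq> {..<n}"
  have Bb: "B \<in> arr_bases N a" using B by (simp add: good_bases_def)
  show "\<bar>\<omega> (ws @ [v])\<bar> * measure (leb n) (cell n N b (tilt \<psi>) \<kappa> S) =
    basis_weight \<omega> a B * measure (leb n) (cell n (Suc n) unit_coords (\<lambda>_. 0) (\<lambda>k. \<kappa> k - ext N a \<rho> B) S)"
  proof (rule basis_cell_measure[OF Bb tie ext_eq[OF Bb tie]])
    fix k assume "k \<in> S"
    then have "\<kappa> k \<in> {s..<s + l}" using S \<kappa> by blast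
    then show "ext N a \<rho> B < \<kappa> k \<and> \<kappa> k < ext N a \<rho> B + Suc n" using B by (simp add: good_bases_def)
  qed
qed

text \<open>A strict gap at an occurring level would make the sum vanish. So the class of the
  \<open>s\<close>-th largest value, which begins at rank \<open>s\<close> or before, cannot end at
  a rank in the window and must reach rank \<open>s + l\<close>. All levels then cut it strictly,
  and \<open>small_class_measure\<close> leaves only the case of a basis.\<close>

lemma contributing_vertex:
  assumes \<kappa>: "\<kappa> ` {..<n} = {s..<s + l}" and sl: "1 \<le> s" "1 \<le> l" "s + l \<le> N"
    and nz: "alt_sum n (\<lambda>S. \<bar>\<omega> (ws @ [v])\<bar> * measure (leb n) (cell n N b (tilt \<psi>) \<kappa> S)) \<noteq> 0"
  shows "\<exists>B\<in>good_bases s l. \<exists>\<tau>. \<forall>k\<in>B. tilt \<psi> k = \<tau>"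
proof -
  let ?h = "tilt \<psi>"
  have no_strict: False
    if I: "I \<subseteq> {1..N}" "\<And>i j. i \<in> I \<Longrightarrow> j \<in> {1..N} - I \<Longrightarrow> ?h j < ?h i" and k: "card I \<in> {s..<s + l}" for I
  proof -
    \<comment> \<open>Every level of the window occurs as some \<open>\<kappa> m\<close>, so this
      summand can be toggled.\<close>
    obtain m where m: "m < n" "\<kappa> m = card I" using \<kappa> k by (metis imageE lessThan_iff)
    have "alt_sum n (\<lambda>S. \<bar>\<omega> (ws @ [v])\<bar> * measure (leb n) (cell n N b ?h \<kappa> S)) = 0"
      unfolding alt_sum_def
    proof (rule alternating_sum_toggle[OF m(1)])
      fix S assume S: "S \<subseteq> {..<n} - {m}"
      then have "finite S" "m \<notin> S" using finite_subset by auto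
      then show "\<bar>\<omega> (ws @ [v])\<bar> * measure (leb n) (cell n N b ?h \<kappa> (insert m S)) =
          \<bar>\<omega> (ws @ [v])\<bar> * measure (leb n) (cell n N b ?h \<kappa> S)"
        using cell_toggle_strict[where h = ?h and \<kappa> = \<kappa> and m = m, OF I m(2)] by simp
    next
      show "\<bar>\<omega> (ws @ [v])\<bar> * measure (leb n) (cell n N b ?h \<kappa> {}) = 0"
        using cell_empty_measure[OF n_pos] by simp
    qed
    then show False using nz by simp
  qed
  obtain I where I: "top_set N ?h I" "card I = s" using top_set_exists[of s N ?h] sl by auto
  have IN: "I \<subseteq> {1..N}" "finite I" "I \<noteq> {}" using I sl finite_subset by (auto simp: top_set_def)
  \<comment> \<open>The \<open>s\<close>-th largest value of the tilt.\<close>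
  define \<tau> where "\<tau> = Min (?h ` I)"
  have "\<tau> \<in> ?h ` I" using IN by (simp add: \<tau>_def)
  then obtain i0 where i0: "i0 \<in> I" "?h i0 = \<tau>" by auto
  have \<tau>_le: "\<tau> \<le> ?h i" if "i \<in> I" for i using IN that by (simp add: \<tau>_def)
  define C where "C = {j \<in> {1..N}. ?h j = \<tau>}"
  define e where "e = card {j \<in> {1..N}. ?h j > \<tau>}"
  let ?G = "{j \<in> {1..N}. ?h j \<ge> \<tau>}"
  have cG: "card ?G = e + card C"
  proof -
    have "?G = {j \<in> {1..N}. ?h j > \<tau>} \<union> C" by (auto simp: C_def)
    then show ?thesis unfolding e_def by (simp add: C_def card_Un_disjoint disjoint_iff)
  qed
  have es: "e < s"
  proof -
    have "j \<in> I" if "j \<in> {1..N}" "?h j > \<tau>" for j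
    proof (rule ccontr)
      assume "j \<notin> I"
      then have "?h j \<le> ?h i0" using I(1) i0(1) that(1) unfolding top_set_def by blast
      then show False using that(2) i0(2) by simp
    qed
    then have "{j \<in> {1..N}. ?h j > \<tau>} \<subset> I" using i0 by auto
    then show ?thesis unfolding e_def I(2)[symmetric] by (rule psubset_card_mono[OF IN(2)])
  qed
  have "s \<le> card ?G" unfolding I(2)[symmetric] using IN \<tau>_le by (intro card_mono) auto
  \<comment> \<open>\<open>?G\<close> lies strictly above its complement, so its size cannot be an
    occurring level.\<close>
  moreover have "card ?G \<notin> {s..<s + l}"
    using no_strict[of ?G] by force
  ultimately have sG: "s + l \<le> e + card C" using cG by simp
  have win: "e < \<kappa> k \<and> \<kappa> k < e + card C" if "k < n" for k
  proof -
    have "\<kappa> k \<in> {s..<s + l}" using \<kappa> that by blast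
    then show ?thesis using es sG by simp
  qed
  have CN: "C \<subseteq> {1..N}" "\<And>j. j \<in> C \<Longrightarrow> ?h j = \<tau>" by (auto simp: C_def)
  have "card C \<le> Suc n" by (rule tie_class_independent(3)[OF CN])
  moreover have "\<not> card C < Suc n"
  proof
    assume "card C < Suc n"
    moreover have "i0 \<in> C" using i0 IN(1) unfolding C_def by blast
    then have "C \<noteq> {}" by blast
    ultimately have "measure (leb n) (cell n N b ?h \<kappa> S) = 0" if "S \<subseteq> {..<n}" for S
      using that win by (intro small_class_measure[OF C_def e_def]) auto
    then have "alt_sum n (\<lambda>S. \<bar>\<omega> (ws @ [v])\<bar> * measure (leb n) (cell n N b ?h \<kappa> S)) = alt_sum n (\<lambda>_. 0)"
      by (intro alt_sum_cong) simp
    then show False using nz by (simp add: alt_sum_def)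
  qed
  ultimately have cC: "card C = Suc n" by simp
  have CB: "C \<in> arr_bases N a" by (rule tie_class_basis[OF CN cC])
  have "ext N a \<rho> C = e" unfolding e_def by (rule ext_eq[OF CB CN(2)])
  then have "C \<in> good_bases s l" using CB es sG cC by (simp add: good_bases_def)
  then show ?thesis by (intro bexI[of _ C] exI[of _ \<tau>] ballI CN(2))
qed

section \<open>Matching bases with vertices\<close>

definition vertex_of :: "nat set \<Rightarrow> nat \<Rightarrow> real"
  where "vertex_of B = (SOME \<psi>. \<psi> \<in> verts \<and> (\<exists>\<tau>. \<forall>k\<in>B. tilt \<psi> k = \<tau>))"

lemma vertex_of:
  assumes "B \<in> arr_bases N a"
  shows "vertex_of B \<in> verts" "\<exists>\<tau>. \<forall>k\<in>B. tilt (vertex_of B) k = \<tau>"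
proof -
  have "\<exists>\<psi>. \<psi> \<in> verts \<and> (\<exists>\<tau>. \<forall>k\<in>B. tilt \<psi> k = \<tau>)" using basis_vertex[OF assms] by blast
  from someI_ex[OF this] show "vertex_of B \<in> verts" "\<exists>\<tau>. \<forall>k\<in>B. tilt (vertex_of B) k = \<tau>"
    by (auto simp: vertex_of_def)
qed

text \<open>Two classes of one tilt cannot both be good: the \<open>Suc n\<close> elements of the
  higher one, and everything above them, count towards \<open>ext\<close> of the lower one, which is
  then at least \<open>s + l\<close> instead of below \<open>s\<close>.\<close>

lemma inj_on_vertex_of: "1 \<le> l \<Longrightarrow> inj_on vertex_of (good_bases s l)"
proof (rule inj_onI)
  fix B B' assume l: "1 \<le> l" and B: "B \<in> good_bases s l" "B' \<in> good_bases s l" and eq: "vertex_of B = vertex_of B'"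
  have Bb: "B \<in> arr_bases N a" "B' \<in> arr_bases N a" using B by (auto simp: good_bases_def)
  obtain \<tau> where \<tau>: "\<And>k. k \<in> B \<Longrightarrow> tilt (vertex_of B) k = \<tau>" using vertex_of(2)[OF Bb(1)] by blast
  obtain \<tau>' where \<tau>': "\<And>k. k \<in> B' \<Longrightarrow> tilt (vertex_of B) k = \<tau>'" using vertex_of(2)[OF Bb(2)] eq by auto
  let ?h = "tilt (vertex_of B)"
  have ord: "\<not> \<sigma>' < \<sigma>" if D: "D \<in> good_bases s l" "D' \<in> good_bases s l"
    and \<sigma>: "\<And>k. k \<in> D \<Longrightarrow> ?h k = \<sigma>" "\<And>k. k \<in> D' \<Longrightarrow> ?h k = \<sigma>'" for D D' \<sigma> \<sigma>'
  proof
    assume lt: "\<sigma>' < \<sigma>"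
    have Db: "D \<in> arr_bases N a" "D' \<in> arr_bases N a" using D by (auto simp: good_bases_def)
    have "{j \<in> {1..N}. ?h j > \<sigma>} \<union> D \<subseteq> {j \<in> {1..N}. ?h j > \<sigma>'}"
      using lt \<sigma>(1) basesD(1)[OF Db(1)] by auto
    then have "card ({j \<in> {1..N}. ?h j > \<sigma>} \<union> D) \<le> card {j \<in> {1..N}. ?h j > \<sigma>'}" by (intro card_mono) auto
    moreover have "card ({j \<in> {1..N}. ?h j > \<sigma>} \<union> D) = ext N a \<rho> D + Suc n"
      using basesD[OF Db(1)] \<sigma>(1) ext_eq[OF Db(1) \<sigma>(1)] by (subst card_Un_disjoint) auto
    moreover have "card {j \<in> {1..N}. ?h j > \<sigma>'} = ext N a \<rho> D'" using ext_eq[OF Db(2) \<sigma>(2)] by simp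
    ultimately show False using D l by (simp add: good_bases_def)
  qed
  have "\<not> \<tau> < \<tau>'" "\<not> \<tau>' < \<tau>" using ord[OF B(2) B(1) \<tau>' \<tau>] ord[OF B \<tau> \<tau>'] by auto
  then have "\<tau> = \<tau>'" by simp
  then show "B = B'" using tie_class_eq_basis[OF Bb(1) \<tau>] tie_class_eq_basis[OF Bb(2) \<tau>'] by simp
qed

text \<open>Only vertices that carry a good basis survive the alternating sum, and each good basis
  belongs to exactly one vertex, so the sum over cells becomes a sum over bases.\<close>

theorem alt_sum_volume:
  assumes \<kappa>: "\<kappa> ` {..<n} = {s..<s + l}" and sl: "1 \<le> s" "1 \<le> l" "s + l \<le> N"
  shows "alt_sum n (\<lambda>S. \<bar>\<omega> (ws @ [v])\<bar> * measure (leb n) (cell n N b (\<lambda>_. 0) \<kappa> S)) =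
    (\<Sum>B\<in>good_bases s l. basis_weight \<omega> a B *
      alt_sum n (\<lambda>S. measure (leb n) (cell n (Suc n) unit_coords (\<lambda>_. 0) (\<lambda>k. \<kappa> k - ext N a \<rho> B) S)))"
proof -
  define T where "T \<psi> = alt_sum n (\<lambda>S. \<bar>\<omega> (ws @ [v])\<bar> * measure (leb n) (cell n N b (tilt \<psi>) \<kappa> S))" for \<psi>
  have "\<kappa> k \<le> N" if "k < n" for k
  proof -
    have "\<kappa> k \<in> {s..<s + l}" using \<kappa> that by blast
    then show ?thesis using sl by simp
  qed
  then have "alt_sum n (\<lambda>S. \<bar>\<omega> (ws @ [v])\<bar> * measure (leb n) (cell n N b (\<lambda>_. 0) \<kappa> S)) =
      alt_sum n (\<lambda>S. \<Sum>\<psi>\<in>verts. \<bar>\<omega> (ws @ [v])\<bar> * measure (leb n) (cell n N b (tilt \<psi>) \<kappa> S))"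
    by (intro alt_sum_cong) (subst cell_measure_sum, auto simp: sum_distrib_left)
  also have "\<dots> = (\<Sum>\<psi>\<in>verts. T \<psi>)" unfolding T_def by (rule alt_sum_sum)
  also have "\<dots> = (\<Sum>\<psi>\<in>vertex_of ` good_bases s l. T \<psi>)"
  proof (rule sum.mono_neutral_right[OF finite_verts])
    show "vertex_of ` good_bases s l \<subseteq> verts" using vertex_of(1) by (auto simp: good_bases_def)
    show "\<forall>\<psi>\<in>verts - vertex_of ` good_bases s l. T \<psi> = 0"
    proof (intro ballI, rule ccontr)
      fix \<psi> assume \<psi>: "\<psi> \<in> verts - vertex_of ` good_bases s l" and "T \<psi> \<noteq> 0"
      then obtain B \<tau> where B: "B \<in> good_bases s l" and tie: "\<And>k. k \<in> B \<Longrightarrow> tilt \<psi> k = \<tau>"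
        using contributing_vertex[OF \<kappa> sl, of \<psi>] unfolding T_def by blast
      have Bb: "B \<in> arr_bases N a" using B by (simp add: good_bases_def)
      obtain \<tau>' where "\<And>k. k \<in> B \<Longrightarrow> tilt (vertex_of B) k = \<tau>'" using vertex_of(2)[OF Bb] by blast
      then have "\<psi> = vertex_of B"
        using \<psi> vertex_of(1)[OF Bb] tie by (intro basis_vertex_unique[OF Bb]) auto
      then show False using \<psi> B by blast
    qed
  qed
  also have "\<dots> = (\<Sum>B\<in>good_bases s l. T (vertex_of B))"
    using inj_on_vertex_of[OF sl(2)] by (simp add: sum.reindex)
  also have "\<dots> = (\<Sum>B\<in>good_bases s l. basis_weight \<omega> a B *
      alt_sum n (\<lambda>S. measure (leb n) (cell n (Suc n) unit_coords (\<lambda>_. 0) (\<lambda>k. \<kappa> k - ext N a \<rho> B) S)))"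
  proof (rule sum.cong[OF refl])
    fix B assume B: "B \<in> good_bases s l"
    then have Bb: "B \<in> arr_bases N a" by (simp add: good_bases_def)
    obtain \<tau> where "\<And>k. k \<in> B \<Longrightarrow> tilt (vertex_of B) k = \<tau>" using vertex_of(2)[OF Bb] by blast
    then show "T (vertex_of B) = basis_weight \<omega> a B *
      alt_sum n (\<lambda>S. measure (leb n) (cell n (Suc n) unit_coords (\<lambda>_. 0) (\<lambda>k. \<kappa> k - ext N a \<rho> B) S))"
      unfolding T_def by (rule good_basis_term[OF \<kappa> B])
  qed
  finally show ?thesis .
qed

text \<open>A basis contributes at the index \<open>m\<close> with
  \<open>ext N a \<rho> B + m + 1 = s\<close>, and such an \<open>m\<close> exists in
  \<open>{0..n-l}\<close> exactly for good bases. As \<open>ext\<close> never exceeds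
  \<open>N - Suc n\<close>, the zero convention outside the range loses nothing.\<close>

lemma sum_coeff_flat_poly:
  assumes "1 \<le> s" "l \<le> n"
  shows "(\<Sum>m=0..n-l. g m * coeff_in_range (flat_poly \<omega> N a \<rho>) (N - Suc n) (int s - int m - 1)) =
    (\<Sum>B\<in>good_bases s l. basis_weight \<omega> a B * g (s - 1 - ext N a \<rho> B))"
proof -
  have ext_le: "ext N a \<rho> B \<le> N - Suc n" if "B \<in> arr_bases N a" for B
  proof -
    have "ext N a \<rho> B \<le> card ({1..N} - B)" unfolding ext_def by (intro card_mono) auto
    then show ?thesis using basesD(1-3)[OF that] by (simp add: card_Diff_subset)
  qed
  have coeff: "coeff_in_range (flat_poly \<omega> N a \<rho>) (N - Suc n) (int s - int m - 1) =
      (\<Sum>B\<in>arr_bases N a. if ext N a \<rho> B + m + 1 = s then basis_weight \<omega> a B else 0)" for m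
  proof (cases "m + 1 \<le> s \<and> s - m - 1 \<le> N - Suc n")
    case True
    then have "nat (int s - int m - 1) = s - m - 1" "0 \<le> int s - int m - 1" "int s - int m - 1 \<le> int (N - Suc n)"
      by auto
    then have "coeff_in_range (flat_poly \<omega> N a \<rho>) (N - Suc n) (int s - int m - 1) =
        (\<Sum>B\<in>arr_bases N a. if ext N a \<rho> B = s - m - 1 then basis_weight \<omega> a B else 0)"
      by (simp add: coeff_in_range_def flat_poly_def coeff_sum)
    also have "\<dots> = (\<Sum>B\<in>arr_bases N a. if ext N a \<rho> B + m + 1 = s then basis_weight \<omega> a B else 0)"
      using True by (intro sum.cong) auto
    finally show ?thesis .
  next
    case False
    then have "coeff_in_range (flat_poly \<omega> N a \<rho>) (N - Suc n) (int s - int m - 1) = 0"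
      by (auto simp: coeff_in_range_def)
    moreover have "(\<Sum>B\<in>arr_bases N a. if ext N a \<rho> B + m + 1 = s then basis_weight \<omega> a B else 0) = 0"
      using False ext_le by (intro sum.neutral) auto
    ultimately show ?thesis by simp
  qed
  have "(\<Sum>m=0..n-l. g m * coeff_in_range (flat_poly \<omega> N a \<rho>) (N - Suc n) (int s - int m - 1)) =
      (\<Sum>m=0..n-l. \<Sum>B\<in>arr_bases N a. if ext N a \<rho> B + m + 1 = s then basis_weight \<omega> a B * g m else 0)"
    unfolding coeff sum_distrib_left by (intro sum.cong) auto
  also have "\<dots> = (\<Sum>B\<in>arr_bases N a. \<Sum>m=0..n-l. if ext N a \<rho> B + m + 1 = s then basis_weight \<omega> a B * g m else 0)"
    by (rule sum.swap)
  also have "\<dots> = (\<Sum>B\<in>arr_bases N a. if B \<in> good_bases s l then basis_weight \<omega> a B * g (s - 1 - ext N a \<rho> B) else 0)"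
  proof (rule sum.cong[OF refl])
    fix B assume B: "B \<in> arr_bases N a"
    show "(\<Sum>m=0..n-l. if ext N a \<rho> B + m + 1 = s then basis_weight \<omega> a B * g m else 0) =
      (if B \<in> good_bases s l then basis_weight \<omega> a B * g (s - 1 - ext N a \<rho> B) else 0)"
    proof (cases "B \<in> good_bases s l")
      case True
      then have m: "s - 1 - ext N a \<rho> B \<in> {0..n-l}" "\<And>m. ext N a \<rho> B + m + 1 = s \<longleftrightarrow> m = s - 1 - ext N a \<rho> B"
        using assms by (auto simp: good_bases_def)
      then show ?thesis using True by simp
    next
      case False
      then show ?thesis using B assms by (auto simp: good_bases_def intro!: sum.neutral)
    qed
  qed
  also have "\<dots> = (\<Sum>B\<in>good_bases s l. basis_weight \<omega> a B * g (s - 1 - ext N a \<rho> B))"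
    using finite_arr_bases by (simp add: sum.If_cases Int_def good_bases_def)
  finally show ?thesis .
qed

end

section \<open>Lists of levels\<close>

lemma length_concat_replicate: "length (concat (map (\<lambda>j. replicate (c ! j) (f j)) [0..<length c])) = sum_list c"
proof -
  have "map (length \<circ> (\<lambda>j. replicate (c ! j) (f j))) [0..<length c] = c"
    by (rule nth_equalityI) auto
  then show ?thesis by (simp add: length_concat)
qed

text \<open>The multiplicities vanish outside \<open>{m + 1..m + length c}\<close>, so only the
  middle block of the list of levels survives.\<close>

lemma concat_shifted_composition:
  assumes "m + length c \<le> n"
  shows "concat (map (\<lambda>k. replicate (shifted_composition c m k) (f k)) [1..<n+1]) =
    concat (map (\<lambda>j. replicate (c ! j) (f (m + 1 + j))) [0..<length c])"
proof -
  let ?l = "length c"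
  have "[1..<n+1] = [1..<m+1] @ [m+1..<m+1+?l] @ [m+1+?l..<n+1]"
    using assms upt_add_eq_append[of 1 "m+1" "n - m"] upt_add_eq_append[of "m+1" "m+1+?l" "n - m - ?l"]
    by (simp add: add.commute)
  moreover have "concat (map (\<lambda>k. replicate (shifted_composition c m k) (f k)) [1..<m+1]) = []"
    by (auto simp: shifted_composition_def)
  moreover have "concat (map (\<lambda>k. replicate (shifted_composition c m k) (f k)) [m+1+?l..<n+1]) = []"
    by (auto simp: shifted_composition_def)
  moreover have "map (\<lambda>k. replicate (shifted_composition c m k) (f k)) [m+1..<m+1+?l] =
      map (\<lambda>j. replicate (c ! j) (f (m + 1 + j))) [0..<?l]"
    by (rule nth_equalityI) (auto simp: shifted_composition_def)
  ultimately show ?thesis by (simp only: map_append concat_append append_Nil append_Nil2)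
qed

lemma mixed_volume_map:
  assumes "length ks = n"
  shows "mixed_volume vol (map P ks) = 1 / fact n * alt_sum n (\<lambda>S. vol (\<Sum>i\<in>S. P (ks ! i)))"
proof -
  have "(\<Sum>i\<in>S. map P ks ! i) = (\<Sum>i\<in>S. P (ks ! i))" if "S \<subseteq> {..<n}" for S
    using that assms by (intro sum.cong) auto
  then have "alt_sum n (\<lambda>S. vol (\<Sum>i\<in>S. map P ks ! i)) = alt_sum n (\<lambda>S. vol (\<Sum>i\<in>S. P (ks ! i)))"
    by (intro alt_sum_cong) simp
  then show ?thesis by (simp add: mixed_volume_def alt_sum_def assms)
qed

theorem theorem4p5:
  fixes a :: "nat \<Rightarrow> 'v::real_vector"
    and \<omega> :: "'v list \<Rightarrow> real" and \<phi> :: "'v \<Rightarrow> real" and v :: 'v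
    and \<rho> :: "nat \<Rightarrow> real" and c :: "nat list"
    and d n r N s l :: nat
  assumes "dim (UNIV :: 'v set) = d" and "d \<ge> 2"
    and "n = d - 1" and "r = N - d"
    and "alternating_form d \<omega>" and "\<exists>xs. length xs = d \<and> \<omega> xs \<noteq> 0"
    and "flat_arrangement N a \<phi>"
    and "\<phi> v = 1"
    and "circuit_generic N a \<rho>"
    and "length c = l" and "sum_list c = n" and "\<forall>x\<in>set c. x \<ge> 1"
    and "1 \<le> s" and "s + l \<le> N"
  shows "mixed_volume (W_volume \<omega> \<phi> v)
           (concat (map (\<lambda>j. replicate (c ! j) (proj_hypersimplex N a v (s + j))) [0..<l])) =
         1 / fact n * (\<Sum>m=0..n-l. mixed_eulerian n (shifted_composition c m) *
           coeff_in_range (flat_poly \<omega> N a \<rho>) r (int s - int m - 1))"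
proof -
  have d: "d = Suc n" and n: "n \<ge> 1" using assms(2,3) by auto
  have lin: "linear \<phi>" using assms(7) by (simp add: flat_arrangement_def)
  \<comment> \<open>The same choice as inside \<open>density_volume\<close>, so that
    \<open>W_volume\<close> unfolds to this frame.\<close>
  define ws where "ws = (SOME ws. basis_list {w. \<phi> w = 0} ws)"
  have dimV: "dim (UNIV :: 'v set) = Suc n" using assms(1) d by simp
  have bws: "basis_list {w. \<phi> w = 0} ws"
    unfolding ws_def by (rule someI_ex[OF functional_level_space(1)[OF dimV lin assms(8)]])
  have form: "alternating_form (Suc n) \<omega>" using assms(5) d by simp
  interpret flat_setup a \<omega> \<phi> v \<rho> n N ws
    by (rule flat_setup.intro[OF dimV n form assms(7-9) basis_list_frame[OF bws]
        functional_level_space(2)[OF dimV lin assms(8) bws]])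
  \<comment> \<open>The levels of the \<open>n\<close> summands, listed with multiplicity.\<close>
  define ks where "ks = concat (map (\<lambda>j. replicate (c ! j) (s + j)) [0..<l])"
  have lenks: "length ks = n" unfolding ks_def using length_concat_replicate[of c "\<lambda>j. s + j"] assms(10,11) by simp
  have ll: "l \<le> n"
  proof -
    have "(\<Sum>x\<leftarrow>c. 1) \<le> (\<Sum>x\<leftarrow>c. x)" using assms(12) by (intro sum_list_mono) auto
    then show ?thesis using assms(10,11) by (simp add: sum_list_triv)
  qed
  have l1: "1 \<le> l" using assms(10,11) n by (cases c) auto
  have "set ks = {s..<s + l}"
  proof -
    have "c ! j \<noteq> 0" if "j < l" for j using assms(10,12) that nth_mem[of j c] by fastforce
    then have "set ks = {s + j | j. j < l}" by (auto simp: ks_def)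
    also have "\<dots> = {s..<s + l}" by (auto simp: le_iff_add)
    finally show ?thesis .
  qed
  then have \<kappa>: "(!) ks ` {..<n} = {s..<s + l}" using lenks by (metis lessThan_atLeast0 nth_image order_refl take_all)
  have mapks: "concat (map (\<lambda>j. replicate (c ! j) (f (s + j))) [0..<l]) = map f ks" for f :: "nat \<Rightarrow> 'b set"
    by (simp add: ks_def map_concat comp_def)
  let ?E = "\<lambda>e. alt_sum n (\<lambda>S. measure (leb n) (cell n (Suc n) unit_coords (\<lambda>_. 0) (\<lambda>k. ks ! k - e) S))"
  \<comment> \<open>Subtracting \<open>e\<close> takes level \<open>s + j\<close> to
    \<open>s + j - e\<close>, which is entry \<open>m + 1 + j\<close> for the shift
    \<open>m = s - 1 - e\<close>.\<close>
  have ME: "mixed_eulerian n (shifted_composition c (s - 1 - e)) = ?E e" if e: "e < s" "s + l \<le> e + Suc n" for e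
  proof -
    have "concat (map (\<lambda>k. replicate (shifted_composition c (s - 1 - e) k) (centered_hypersimplex n k)) [1..<n+1]) =
        concat (map (\<lambda>j. replicate (c ! j) (centered_hypersimplex n (s - 1 - e + 1 + j))) [0..<l])"
      unfolding assms(10)[symmetric] by (rule concat_shifted_composition) (use e assms(10) in simp)
    also have "\<dots> = concat (map (\<lambda>j. replicate (c ! j) (centered_hypersimplex n (s + j - e))) [0..<l])"
      using e by (intro arg_cong[of _ _ concat] map_cong) auto
    also have "\<dots> = map (\<lambda>k. centered_hypersimplex n (k - e)) ks"
      using mapks[of "\<lambda>k. centered_hypersimplex n (k - e)"] by simp
    finally have "mixed_eulerian n (shifted_composition c (s - 1 - e)) =
        alt_sum n (\<lambda>S. E_volume n (\<Sum>i\<in>S. centered_hypersimplex n (ks ! i - e)))"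
      by (simp add: mixed_eulerian_def mixed_volume_map[OF lenks])
    also have "\<dots> = ?E e"
      using finite_subset by (intro alt_sum_cong E_volume_hypersimplices) blast
    finally show ?thesis .
  qed
  have "mixed_volume (W_volume \<omega> \<phi> v)
      (concat (map (\<lambda>j. replicate (c ! j) (proj_hypersimplex N a v (s + j))) [0..<l])) =
    1 / fact n * alt_sum n (\<lambda>S. W_volume \<omega> \<phi> v (\<Sum>i\<in>S. proj_hypersimplex N a v (ks ! i)))"
    unfolding mapks[of "proj_hypersimplex N a v"] by (rule mixed_volume_map[OF lenks])
  also have "alt_sum n (\<lambda>S. W_volume \<omega> \<phi> v (\<Sum>i\<in>S. proj_hypersimplex N a v (ks ! i))) =
      alt_sum n (\<lambda>S. \<bar>\<omega> (ws @ [v])\<bar> * measure (leb n) (cell n N b (\<lambda>_. 0) ((!) ks) S))"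
  proof (rule alt_sum_cong)
    fix S assume "S \<subseteq> {..<n}"
    then have "finite S" using finite_subset by blast
    then show "W_volume \<omega> \<phi> v (\<Sum>i\<in>S. proj_hypersimplex N a v (ks ! i)) =
        \<bar>\<omega> (ws @ [v])\<bar> * measure (leb n) (cell n N b (\<lambda>_. 0) ((!) ks) S)"
      using frame_volume_hypersimplices[of S "(!) ks"]
      by (simp add: W_volume_def density_volume_def ws_def[symmetric])
  qed
  also have "\<dots> = (\<Sum>B\<in>good_bases s l. basis_weight \<omega> a B * ?E (ext N a \<rho> B))"
    by (rule alt_sum_volume[OF \<kappa> assms(13) l1 assms(14)])
  also have "\<dots> = (\<Sum>B\<in>good_bases s l. basis_weight \<omega> a B *
      mixed_eulerian n (shifted_composition c (s - 1 - ext N a \<rho> B)))"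
    by (intro sum.cong refl arg_cong2[of _ _ _ _ "(*)"] ME[symmetric]) (auto simp: good_bases_def)
  also have "\<dots> = (\<Sum>m=0..n-l. mixed_eulerian n (shifted_composition c m) *
      coeff_in_range (flat_poly \<omega> N a \<rho>) r (int s - int m - 1))"
    using sum_coeff_flat_poly[OF assms(13) ll, of "\<lambda>m. mixed_eulerian n (shifted_composition c m)"] assms(4) d by simp
  finally show ?thesis .
qed

end
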